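(* Let $F$ be a field of characteristic $0$ and let $M_3$ be the free Malcev algebra over $F$ with set of free generators $X=\{x,y,z\}$. Let $$\mathbf{U}=\{J(x,y,z)\,G^k L_{x,x}^l L_{y,y}^m L_{z,z}^n L_{x,y}^p L_{x,z}^q L_{y,z}^r \mid k,l,m,n,p,q,r\in\mathbb{N}\cup\{0\}\}.$$ Then the set of vectors $$\mathbf{U}\cup \mathbf{U}x\cup \mathbf{U}y\cup \mathbf{U}z\cup \mathbf{U}xy\cup \mathbf{U}xz\cup \mathbf{U}yz$$ forms a basis of the $F$-vector space $J(M_3,M_3,M_3)$. Furthermore, $M_3$ is special.
   Context: A Malcev algebra over $F$ is a (nonassociative) $F$-algebra satisfying the identities $x^2=0$ and $J(x,y,xz)=J(x,y,z)x$, where $J(x,y,z)=(xy)z+(zx)y+(yz)x$. Products written without brackets are left-normed: $x_1x_2\cdots x_n=(\dots((x_1x_2)x_3)\dots)x_n$. Operators are written on the right and composed from left to right. $R_a$ is the right multiplication $u\mapsto ua$, and $L_{a,b}=\frac12(R_aR_b+R_bR_a)$, i.e. $uL_{a,b}=\frac12\big((ua)b+(ub)a\big)$. The function $G$ is $G(a,b,c,d)=J(ab,c,d)-bJ(a,c,d)-J(b,c,d)a$; for the fixed generators $x,y,z$, $tG$ denotes $G(t,x,y,z)$ and $tG^n$ denotes the $n$-fold iterate $G(\dots G(G(t,x,y,z),x,y,z)\dots,x,y,z)$ (with $tG^0=t$). $J(M_3,M_3,M_3)$ is the linear span of all $J(a,b,c)$ with $a,b,c\in M_3$. For a set $\mathbf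 U$ of elements, $\mathbf{U}a=\{ua\mid u\in\mathbf U\}$ and $\mathbf{U}ab=\{(ua)b\mid u\in \mathbf U\}$. A Malcev algebra is called special if it is (isomorphic to) a subalgebra of the commutator algebra $A^-$ (the space $A$ with product $[a,b]=ab-ba$) for some alternative algebra $A$. *)

theory Defs
  imports "HOL-Algebra.Algebraic_Closure_Type"
begin

section \<open>Nonassociative algebras over a field\<close>

text \<open>
  An algebra with explicit carrier is a \<^type>\<open>module\<close> record over the field \<^typ>\<open>'f\<close>, its
  product being the field \<^const>\<open>monoid.mult\<close> of the record.  Algebras need not be unital: the
  component \<^const>\<open>monoid.one\<close> of the record is never used.
\<close>

locale nonassoc_algebra =
  module "ring_of_type_algebra :: 'f::field ring" A
  for A :: "('f::field, 'a) module" (structure) +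
  assumes mult_closed: "a \<in> carrier A \<Longrightarrow> b \<in> carrier A \<Longrightarrow> a \<otimes> b \<in> carrier A"
    and mult_add_left: "a \<in> carrier A \<Longrightarrow> b \<in> carrier A \<Longrightarrow> c \<in> carrier A \<Longrightarrow>
          (a \<oplus> b) \<otimes> c = a \<otimes> c \<oplus> b \<otimes> c"
    and mult_add_right: "a \<in> carrier A \<Longrightarrow> b \<in> carrier A \<Longrightarrow> c \<in> carrier A \<Longrightarrow>
          a \<otimes> (b \<oplus> c) = a \<otimes> b \<oplus> a \<otimes> c"
    and mult_smult_left: "a \<in> carrier A \<Longrightarrow> b \<in> carrier A \<Longrightarrow> (k \<odot> a) \<otimes> b = k \<odot> (a \<otimes> b)"
    and mult_smult_right: "a \<in> carrier A \<Longrightarrow> b \<in> carrier A \<Longrightarrow> a \<otimes> (k \<odot> b) = k \<odot> (a \<otimes> b)"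

locale alternative_algebra = nonassoc_algebra +
  assumes left_alternative: "a \<in> carrier A \<Longrightarrow> b \<in> carrier A \<Longrightarrow> (a \<otimes> a) \<otimes> b = a \<otimes> (a \<otimes> b)"
    and right_alternative: "a \<in> carrier A \<Longrightarrow> b \<in> carrier A \<Longrightarrow> (a \<otimes> b) \<otimes> b = a \<otimes> (b \<otimes> b)"

definition jacobian_on :: "('f, 'a) module \<Rightarrow> 'a \<Rightarrow> 'a \<Rightarrow> 'a \<Rightarrow> 'a" where
  "jacobian_on A a b c =
     ((a \<otimes>\<^bsub>A\<^esub> b) \<otimes>\<^bsub>A\<^esub> c) \<oplus>\<^bsub>A\<^esub> ((c \<otimes>\<^bsub>A\<^esub> a) \<otimes>\<^bsub>A\<^esub> b) \<oplus>\<^bsub>A\<^esub> ((b \<otimes>\<^bsub>A\<^esub> c) \<otimes>\<^bsub>A\<^esub> a)"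

locale malcev_algebra = nonassoc_algebra +
  assumes square_zero: "a \<in> carrier A \<Longrightarrow> a \<otimes> a = \<zero>"
    and malcev: "a \<in> carrier A \<Longrightarrow> b \<in> carrier A \<Longrightarrow> c \<in> carrier A \<Longrightarrow>
          jacobian_on A a b (a \<otimes> c) = jacobian_on A a b c \<otimes> a"

definition algebra_hom :: "('f, 'a) module \<Rightarrow> ('f, 'b) module \<Rightarrow> ('a \<Rightarrow> 'b) set" where
  "algebra_hom A B = {h \<in> hom A B \<inter> hom (add_monoid A) (add_monoid B).
     \<forall>k. \<forall>a \<in> carrier A. h (k \<odot>\<^bsub>A\<^esub> a) = k \<odot>\<^bsub>B\<^esub> h a}"

definition commutator_algebra :: "('f, 'a) module \<Rightarrow> ('f, 'a) module" where
  "commutator_algebra A = A\<lparr>monoid.mult := \<lambda>a b. (a \<otimes>\<^bsub>A\<^esub> b) \<ominus>\<^bsub>A\<^esub> (b \<otimes>\<^bsub>A\<^esub> a)\<rparr>"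


section \<open>Terms and special algebras\<close>

datatype ('f, 'v) aterm =
    Var 'v
  | Zero
  | Add "('f, 'v) aterm" "('f, 'v) aterm"
  | Scale 'f "('f, 'v) aterm"
  | Mul "('f, 'v) aterm" "('f, 'v) aterm"

text \<open>
  HOL cannot quantify existentially over the type of the elements of the alternative algebra.
  The type of algebra terms over the elements of \<^term>\<open>M\<close> is large enough to lose nothing: the
  subalgebra of \<^term>\<open>A\<close> generated by the image of \<^term>\<open>M\<close> consists of values of such terms.
  This is the content of the lemma \<open>specialI\<close> below, where the alternative algebra lives on an
  arbitrary type.
\<close>

definition special :: "('f::field, 'm) module \<Rightarrow> bool" where
  "special M \<longleftrightarrow> (\<exists>(A :: ('f, ('f, 'm) aterm) module) h.
     alternative_algebra A \<and> h \<in> algebra_hom M (commutator_algebra A) \<and> inj_on h (carrier M))"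

primrec eval_term :: "('f, 'a) module \<Rightarrow> ('v \<Rightarrow> 'a) \<Rightarrow> ('f, 'v) aterm \<Rightarrow> 'a" where
  "eval_term A f (Var v) = f v"
| "eval_term A f Zero = \<zero>\<^bsub>A\<^esub>"
| "eval_term A f (Add s t) = eval_term A f s \<oplus>\<^bsub>A\<^esub> eval_term A f t"
| "eval_term A f (Scale k t) = k \<odot>\<^bsub>A\<^esub> eval_term A f t"
| "eval_term A f (Mul s t) = eval_term A f s \<otimes>\<^bsub>A\<^esub> eval_term A f t"

context nonassoc_algebra
begin

lemma scalar_simps [simp]:
  "carrier (ring_of_type_algebra :: 'f ring) = UNIV"
  "k \<oplus>\<^bsub>(ring_of_type_algebra :: 'f ring)\<^esub> l = k + l"
  "k \<otimes>\<^bsub>(ring_of_type_algebra :: 'f ring)\<^esub> l = k * l"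
  "\<one>\<^bsub>(ring_of_type_algebra :: 'f ring)\<^esub> = 1"
  "\<zero>\<^bsub>(ring_of_type_algebra :: 'f ring)\<^esub> = 0"
  by (simp_all add: ring_of_type_algebra_def)

lemma smult_closed': "a \<in> carrier A \<Longrightarrow> k \<odot> a \<in> carrier A"
  by (rule smult_closed) simp_all

lemma smult_minus_one: "a \<in> carrier A \<Longrightarrow> a \<oplus> (-1) \<odot> a = \<zero>"
proof -
  assume a: "a \<in> carrier A"
  have "(1 + (-1 :: 'f)) \<odot> a = 1 \<odot> a \<oplus> (-1) \<odot> a"
    using smult_l_distr[of 1 "-1" a] a by simp
  moreover have "(0::'f) \<odot> a = \<zero>" using smult_l_null[OF a] by simp
  moreover have "(1::'f) \<odot> a = a" using smult_one[OF a] by simp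
  ultimately show ?thesis by simp
qed

lemma eval_term_closed: "range f \<subseteq> carrier A \<Longrightarrow> eval_term A f t \<in> carrier A"
  by (induction t) (auto simp: mult_closed smult_closed')

end

lemma nonassoc_algebraI:
  fixes A :: "('f::field, 'a) module" (structure)
  assumes "\<zero> \<in> carrier A"
    and "\<And>a b. a \<in> carrier A \<Longrightarrow> b \<in> carrier A \<Longrightarrow> a \<oplus> b \<in> carrier A"
    and "\<And>k a. a \<in> carrier A \<Longrightarrow> k \<odot> a \<in> carrier A"
    and "\<And>a b. a \<in> carrier A \<Longrightarrow> b \<in> carrier A \<Longrightarrow> a \<otimes> b \<in> carrier A"
    and "\<And>a b c. a \<in> carrier A \<Longrightarrow> b \<in> carrier A \<Longrightarrow> c \<in> carrier A \<Longrightarrow>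
           (a \<oplus> b) \<oplus> c = a \<oplus> (b \<oplus> c)"
    and "\<And>a b. a \<in> carrier A \<Longrightarrow> b \<in> carrier A \<Longrightarrow> a \<oplus> b = b \<oplus> a"
    and "\<And>a. a \<in> carrier A \<Longrightarrow> \<zero> \<oplus> a = a"
    and "\<And>a. a \<in> carrier A \<Longrightarrow> (-1) \<odot> a \<oplus> a = \<zero>"
    and "\<And>k l a. a \<in> carrier A \<Longrightarrow> (k + l) \<odot> a = k \<odot> a \<oplus> l \<odot> a"
    and "\<And>k a b. a \<in> carrier A \<Longrightarrow> b \<in> carrier A \<Longrightarrow> k \<odot> (a \<oplus> b) = k \<odot> a \<oplus> k \<odot> b"
    and "\<And>k l a. a \<in> carrier A \<Longrightarrow> (k * l) \<odot> a = k \<odot> (l \<odot> a)"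
    and "\<And>a. a \<in> carrier A \<Longrightarrow> 1 \<odot> a = a"
    and "\<And>a b c. a \<in> carrier A \<Longrightarrow> b \<in> carrier A \<Longrightarrow> c \<in> carrier A \<Longrightarrow>
           (a \<oplus> b) \<otimes> c = a \<otimes> c \<oplus> b \<otimes> c"
    and "\<And>a b c. a \<in> carrier A \<Longrightarrow> b \<in> carrier A \<Longrightarrow> c \<in> carrier A \<Longrightarrow>
           a \<otimes> (b \<oplus> c) = a \<otimes> b \<oplus> a \<otimes> c"
    and "\<And>k a b. a \<in> carrier A \<Longrightarrow> b \<in> carrier A \<Longrightarrow> (k \<odot> a) \<otimes> b = k \<odot> (a \<otimes> b)"
    and "\<And>k a b. a \<in> carrier A \<Longrightarrow> b \<in> carrier A \<Longrightarrow> a \<otimes> (k \<odot> b) = k \<odot> (a \<otimes> b)"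
  shows "nonassoc_algebra A"
proof -
  have "abelian_group A"
  proof (rule abelian_groupI)
    fix a assume a: "a \<in> carrier A"
    show "\<exists>b \<in> carrier A. b \<oplus> a = \<zero>"
      by (rule bexI[of _ "(-1) \<odot> a"]) (fact assms(8)[OF a], fact assms(3)[OF a])
  qed (fact assms)+
  then have "module (ring_of_type_algebra :: 'f ring) A"
    using assms cring_from_type_algebra
    by (intro Module.moduleI) (auto simp: ring_of_type_algebra_def)
  then show ?thesis
    using assms by (simp add: nonassoc_algebra_def nonassoc_algebra_axioms_def)
qed

lemma specialI:
  fixes A :: "('f::field, 'b) module" and M :: "('f, 'm) module"
  assumes alt: "alternative_algebra A"
    and hom: "h \<in> algebra_hom M (commutator_algebra A)"
    and inj: "inj_on h (carrier M)"
  shows "special M"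
proof -
  interpret A: alternative_algebra A by (rule alt)
  define f where "f v = (if v \<in> carrier M then h v else \<zero>\<^bsub>A\<^esub>)" for v
  define ev where "ev = eval_term A f"
  have hA: "h v \<in> carrier A" if "v \<in> carrier M" for v
    using hom that by (auto simp: algebra_hom_def hom_def commutator_algebra_def)
  have f: "range f \<subseteq> carrier A" using hA by (auto simp: f_def)
  have evA [simp]: "ev t \<in> carrier A" for t
    unfolding ev_def using A.eval_term_closed[OF f] .
  define s where "s b = (SOME t. ev t = b)" for b
  have s: "ev (s (ev t)) = ev t" for t
    unfolding s_def by (rule someI) simp
  have ev_s: "ev (s \<zero>\<^bsub>A\<^esub>) = \<zero>\<^bsub>A\<^esub>"
    "ev (s (ev t \<oplus>\<^bsub>A\<^esub> ev u)) = ev t \<oplus>\<^bsub>A\<^esub> ev u"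
    "ev (s (k \<odot>\<^bsub>A\<^esub> ev t)) = k \<odot>\<^bsub>A\<^esub> ev t"
    "ev (s (ev t \<otimes>\<^bsub>A\<^esub> ev u)) = ev t \<otimes>\<^bsub>A\<^esub> ev u" for t u k
    using s[of Zero] s[of "Add t u"] s[of "Scale k t"] s[of "Mul t u"]
    by (simp_all add: ev_def)
  define B :: "('f, ('f, 'm) aterm) module" where
    "B = \<lparr>carrier = range (s \<circ> ev), monoid.mult = (\<lambda>t u. s (ev t \<otimes>\<^bsub>A\<^esub> ev u)), one = undefined,
          zero = s \<zero>\<^bsub>A\<^esub>, add = (\<lambda>t u. s (ev t \<oplus>\<^bsub>A\<^esub> ev u)), module.smult = (\<lambda>k t. s (k \<odot>\<^bsub>A\<^esub> ev t))\<rparr>"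
  have B_simps: "\<zero>\<^bsub>B\<^esub> = s \<zero>\<^bsub>A\<^esub>" "t \<oplus>\<^bsub>B\<^esub> u = s (ev t \<oplus>\<^bsub>A\<^esub> ev u)"
    "k \<odot>\<^bsub>B\<^esub> t = s (k \<odot>\<^bsub>A\<^esub> ev t)" "t \<otimes>\<^bsub>B\<^esub> u = s (ev t \<otimes>\<^bsub>A\<^esub> ev u)" for t u k
    by (simp_all add: B_def)
  have carrB: "t \<in> carrier B \<longleftrightarrow> s (ev t) = t" for t
    using s by (auto simp: B_def image_iff) metis
  have one: "1 \<odot>\<^bsub>A\<^esub> ev a = ev a" for a using A.smult_one[of "ev a"] by simp
  have minus: "(-1) \<odot>\<^bsub>A\<^esub> ev a \<oplus>\<^bsub>A\<^esub> ev a = \<zero>\<^bsub>A\<^esub>" for a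
    using A.smult_minus_one[of "ev a"] by (simp add: A.add.m_comm A.smult_closed')
  have distr: "(k + l) \<odot>\<^bsub>A\<^esub> ev a = k \<odot>\<^bsub>A\<^esub> ev a \<oplus>\<^bsub>A\<^esub> l \<odot>\<^bsub>A\<^esub> ev a" for k l a
    using A.smult_l_distr[of k l "ev a"] by simp
  have distr': "k \<odot>\<^bsub>A\<^esub> (ev a \<oplus>\<^bsub>A\<^esub> ev b) = k \<odot>\<^bsub>A\<^esub> ev a \<oplus>\<^bsub>A\<^esub> k \<odot>\<^bsub>A\<^esub> ev b" for k a b
    using A.smult_r_distr[of k "ev a" "ev b"] by simp
  have assoc: "(k * l) \<odot>\<^bsub>A\<^esub> ev a = k \<odot>\<^bsub>A\<^esub> (l \<odot>\<^bsub>A\<^esub> ev a)" for k l a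
    using A.smult_assoc1[of k l "ev a"] by simp
  have "nonassoc_algebra B"
    by (rule nonassoc_algebraI)
      (simp_all add: carrB B_simps ev_s one minus distr distr' assoc A.a_ac
        A.mult_add_left A.mult_add_right A.mult_smult_left A.mult_smult_right)
  then have B: "alternative_algebra B"
    unfolding alternative_algebra_def alternative_algebra_axioms_def
    by (simp add: carrB B_simps ev_s A.left_alternative A.right_alternative)
  interpret B: alternative_algebra B by (rule B)
  have ev_minus: "ev (a \<ominus>\<^bsub>B\<^esub> b) = ev a \<ominus>\<^bsub>A\<^esub> ev b" if "a \<in> carrier B" "b \<in> carrier B" for a b
  proof -
    have ev_add: "ev (p \<oplus>\<^bsub>B\<^esub> q) = ev p \<oplus>\<^bsub>A\<^esub> ev q" for p q by (simp add: B_simps ev_s)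
    have "ev b \<oplus>\<^bsub>A\<^esub> ev (\<ominus>\<^bsub>B\<^esub> b) = \<zero>\<^bsub>A\<^esub>"
      using B.r_neg[OF that(2)] ev_add[of b "\<ominus>\<^bsub>B\<^esub> b"] by (simp add: B_simps ev_s)
    then have "ev (\<ominus>\<^bsub>B\<^esub> b) = \<ominus>\<^bsub>A\<^esub> ev b"
      by (metis A.minus_equality A.a_comm evA)
    then show ?thesis by (simp add: a_minus_def ev_add)
  qed
  have ev_h: "ev (s (h a)) = h a" if "a \<in> carrier M" for a
    using s[of "Var a"] that by (simp add: ev_def f_def)
  have sB: "s (h a) \<in> carrier B" if "a \<in> carrier M" for a
    using ev_h[OF that] by (simp add: carrB)
  have M1: "h (a \<otimes>\<^bsub>M\<^esub> b) = (h a \<otimes>\<^bsub>A\<^esub> h b) \<ominus>\<^bsub>A\<^esub> (h b \<otimes>\<^bsub>A\<^esub> h a)"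
    "h (a \<oplus>\<^bsub>M\<^esub> b) = h a \<oplus>\<^bsub>A\<^esub> h b" "h (k \<odot>\<^bsub>M\<^esub> a) = k \<odot>\<^bsub>A\<^esub> h a"
    if "a \<in> carrier M" "b \<in> carrier M" for a b k
    using hom that by (auto simp: algebra_hom_def hom_def commutator_algebra_def)
  have "s (h (a \<otimes>\<^bsub>M\<^esub> b)) = (s (h a) \<otimes>\<^bsub>B\<^esub> s (h b)) \<ominus>\<^bsub>B\<^esub> (s (h b) \<otimes>\<^bsub>B\<^esub> s (h a))"
    if "a \<in> carrier M" "b \<in> carrier M" for a b
  proof -
    let ?c = "(s (h a) \<otimes>\<^bsub>B\<^esub> s (h b)) \<ominus>\<^bsub>B\<^esub> (s (h b) \<otimes>\<^bsub>B\<^esub> s (h a))"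
    have "?c \<in> carrier B" using sB that by (simp add: B.mult_closed)
    then have "?c = s (ev ?c)" by (simp add: carrB)
    also have "ev ?c = ev (s (h a) \<otimes>\<^bsub>B\<^esub> s (h b)) \<ominus>\<^bsub>A\<^esub> ev (s (h b) \<otimes>\<^bsub>B\<^esub> s (h a))"
      by (rule ev_minus) (simp_all add: sB that B.mult_closed)
    also have "\<dots> = h (a \<otimes>\<^bsub>M\<^esub> b)"
      using that ev_s(4)[of "s (h a)" "s (h b)"] ev_s(4)[of "s (h b)" "s (h a)"]
      by (simp add: B_simps ev_h M1)
    finally show ?thesis by simp
  qed
  then have "s \<circ> h \<in> algebra_hom M (commutator_algebra B)"
    unfolding algebra_hom_def hom_def commutator_algebra_def using M1 sB
    by (auto simp: B_simps ev_h)
  moreover have "inj_on (s \<circ> h) (carrier M)"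
    by (rule inj_onI) (metis comp_apply ev_h inj inj_onD)
  ultimately show ?thesis
    unfolding special_def using B by (intro exI[of _ B] exI[of _ "s \<circ> h"] conjI)
qed


section \<open>Free Malcev algebras\<close>

text \<open>The congruence on terms generated by all instances of the axioms of Malcev algebras.\<close>

inductive malcev_eq :: "('f::field, 'v) aterm \<Rightarrow> ('f, 'v) aterm \<Rightarrow> bool" where
  refl: "malcev_eq a a"
| sym: "malcev_eq a b \<Longrightarrow> malcev_eq b a"
| trans: "malcev_eq a b \<Longrightarrow> malcev_eq b c \<Longrightarrow> malcev_eq a c"
| add_cong: "malcev_eq a a' \<Longrightarrow> malcev_eq b b' \<Longrightarrow> malcev_eq (Add a b) (Add a' b')"
| scale_cong: "malcev_eq a a' \<Longrightarrow> malcev_eq (Scale k a) (Scale k a')"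
| mul_cong: "malcev_eq a a' \<Longrightarrow> malcev_eq b b' \<Longrightarrow> malcev_eq (Mul a b) (Mul a' b')"
| add_assoc: "malcev_eq (Add (Add a b) c) (Add a (Add b c))"
| add_comm: "malcev_eq (Add a b) (Add b a)"
| add_zero: "malcev_eq (Add Zero a) a"
| add_neg: "malcev_eq (Add (Scale (-1) a) a) Zero"
| scale_add_left: "malcev_eq (Scale (k + l) a) (Add (Scale k a) (Scale l a))"
| scale_add_right: "malcev_eq (Scale k (Add a b)) (Add (Scale k a) (Scale k b))"
| scale_scale: "malcev_eq (Scale (k * l) a) (Scale k (Scale l a))"
| scale_one: "malcev_eq (Scale 1 a) a"
| mul_add_left: "malcev_eq (Mul (Add a b) c) (Add (Mul a c) (Mul b c))"
| mul_add_right: "malcev_eq (Mul a (Add b c)) (Add (Mul a b) (Mul a c))"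
| mul_scale_left: "malcev_eq (Mul (Scale k a) b) (Scale k (Mul a b))"
| mul_scale_right: "malcev_eq (Mul a (Scale k b)) (Scale k (Mul a b))"
| square: "malcev_eq (Mul a a) Zero"
| malcev: "malcev_eq
    (Add (Add (Mul (Mul a b) (Mul a c)) (Mul (Mul (Mul a c) a) b)) (Mul (Mul b (Mul a c)) a))
    (Mul (Add (Add (Mul (Mul a b) c) (Mul (Mul c a) b)) (Mul (Mul b c) a)) a)"

quotient_type (overloaded) ('f, 'v) free_malcev = "('f::field, 'v) aterm" / malcev_eq
  by (intro equivpI reflpI sympI transpI)
    (rule malcev_eq.refl, erule malcev_eq.sym, rule malcev_eq.trans)

instantiation free_malcev :: (field, type) "{ab_group_add, times}"
begin

lift_definition zero_free_malcev :: "('a, 'b) free_malcev" is Zero .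
lift_definition plus_free_malcev :: "('a, 'b) free_malcev \<Rightarrow> ('a, 'b) free_malcev \<Rightarrow> ('a, 'b) free_malcev"
  is Add by (rule add_cong)
lift_definition uminus_free_malcev :: "('a, 'b) free_malcev \<Rightarrow> ('a, 'b) free_malcev"
  is "Scale (-1)" by (rule scale_cong)
definition minus_free_malcev :: "('a, 'b) free_malcev \<Rightarrow> ('a, 'b) free_malcev \<Rightarrow> ('a, 'b) free_malcev"
  where "minus_free_malcev a b = a + (- b)"
lift_definition times_free_malcev :: "('a, 'b) free_malcev \<Rightarrow> ('a, 'b) free_malcev \<Rightarrow> ('a, 'b) free_malcev"
  is Mul by (rule mul_cong)

instance
proof
  fix a b c :: "('a, 'b) free_malcev"
  show "a + b + c = a + (b + c)" by transfer (rule malcev_eq.add_assoc)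
  show "a + b = b + a" by transfer (rule malcev_eq.add_comm)
  show "0 + a = a" by transfer (rule malcev_eq.add_zero)
  show "- a + a = 0" by transfer (rule malcev_eq.add_neg)
  show "a - b = a + - b" by (rule minus_free_malcev_def)
qed

end

lift_definition gen :: "'v \<Rightarrow> ('f::field, 'v) free_malcev" is Var .

lift_definition fscale :: "'f::field \<Rightarrow> ('f, 'v) free_malcev \<Rightarrow> ('f, 'v) free_malcev"
  is Scale by (rule scale_cong)

global_interpretation free_malcev: vector_space "fscale :: 'f::field \<Rightarrow> _ \<Rightarrow> ('f, 'v) free_malcev"
proof
  fix k l :: 'f and a b :: "('f, 'v) free_malcev"
  show "fscale k (a + b) = fscale k a + fscale k b" by transfer (rule malcev_eq.scale_add_right)
  show "fscale (k + l) a = fscale k a + fscale l a" by transfer (rule malcev_eq.scale_add_left)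
  show "fscale k (fscale l a) = fscale (k * l) a"
    by transfer (rule malcev_eq.scale_scale[THEN malcev_eq.sym])
  show "fscale 1 a = a" by transfer (rule malcev_eq.scale_one)
qed

lemma free_malcev_mult:
  fixes a b c :: "('f::field, 'v) free_malcev"
  shows "(a + b) * c = a * c + b * c"
    and "a * (b + c) = a * b + a * c"
    and "fscale k a * b = fscale k (a * b)"
    and "a * fscale k b = fscale k (a * b)"
    and "a * a = 0"
    and "(a * b) * (a * c) + ((a * c) * a) * b + (b * (a * c)) * a
           = ((a * b) * c + (c * a) * b + (b * c) * a) * a"
  by (transfer, rule malcev_eq.mul_add_left, transfer, rule malcev_eq.mul_add_right,
      transfer, rule malcev_eq.mul_scale_left, transfer, rule malcev_eq.mul_scale_right,
      transfer, rule malcev_eq.square, transfer, rule malcev_eq.malcev)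

definition free_malcev_algebra :: "('f::field, ('f, 'v) free_malcev) module" where
  "free_malcev_algebra =
     \<lparr>carrier = UNIV, monoid.mult = (*), one = undefined, zero = 0, add = (+), module.smult = fscale\<rparr>"

lemma free_malcev_algebra_simps [simp]:
  "carrier free_malcev_algebra = UNIV"
  "a \<otimes>\<^bsub>free_malcev_algebra\<^esub> b = a * b"
  "a \<oplus>\<^bsub>free_malcev_algebra\<^esub> b = a + b"
  "\<zero>\<^bsub>free_malcev_algebra\<^esub> = 0"
  "k \<odot>\<^bsub>free_malcev_algebra\<^esub> a = fscale k a"
  by (simp_all add: free_malcev_algebra_def)

lemma malcev_free_malcev:
  "malcev_algebra (free_malcev_algebra :: ('f::field, ('f, 'v) free_malcev) module)"
proof -
  let ?M = "free_malcev_algebra :: ('f, ('f, 'v) free_malcev) module"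
  have "nonassoc_algebra ?M"
    by (rule nonassoc_algebraI)
      (simp_all add: free_malcev_mult add.assoc add.commute free_malcev.scale_left_distrib
        free_malcev.scale_right_distrib)
  then show ?thesis
    unfolding malcev_algebra_def malcev_algebra_axioms_def jacobian_on_def
    by (simp add: free_malcev_mult(5,6))
qed

context malcev_algebra
begin

lemma eval_term_malcev_eq:
  assumes "malcev_eq s t" and f: "range f \<subseteq> carrier A"
  shows "eval_term A f s = eval_term A f t"
  using assms(1)
proof (induction rule: malcev_eq.induct)
  case (malcev a b c)
  show ?case
    using malcev_algebra.malcev[OF malcev_algebra_axioms, of "eval_term A f a" "eval_term A f b" "eval_term A f c"]
      eval_term_closed[OF f]
    by (simp add: jacobian_on_def)
next
  case (add_neg a)
  show ?case
    using smult_minus_one[of "eval_term A f a"] eval_term_closed[OF f]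
    by (simp add: add.m_comm smult_closed')
next
  case (scale_add_left k l a)
  show ?case using smult_l_distr[of k l "eval_term A f a"] eval_term_closed[OF f] by simp
next
  case (scale_add_right k a b)
  show ?case
    using smult_r_distr[of k "eval_term A f a" "eval_term A f b"] eval_term_closed[OF f] by simp
next
  case (scale_scale k l a)
  show ?case using smult_assoc1[of k l "eval_term A f a"] eval_term_closed[OF f] by simp
next
  case (scale_one a)
  show ?case using smult_one[of "eval_term A f a"] eval_term_closed[OF f] by simp
qed (simp_all add: eval_term_closed[OF f] a_ac mult_add_left mult_add_right
      mult_smult_left mult_smult_right square_zero)

end

text \<open>The universal property of the free Malcev algebra, for Malcev algebras on any type.\<close>

theorem free_malcev_universal:
  fixes A :: "('f::field, 'a) module" and f :: "'v \<Rightarrow> 'a"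
  assumes "malcev_algebra A" and f: "range f \<subseteq> carrier A"
  shows "\<exists>!h. h \<in> algebra_hom free_malcev_algebra A \<and> (\<forall>v. h (gen v) = f v)"
proof -
  interpret malcev_algebra A by fact
  define h where "h q = eval_term A f (rep_free_malcev q)" for q
  have abs: "h (abs_free_malcev t) = eval_term A f t" for t
    unfolding h_def
    by (rule eval_term_malcev_eq[OF _ f])
      (metis Quotient3_rep_abs[OF Quotient3_free_malcev] malcev_eq.refl)
  have closed: "h q \<in> carrier A" for q unfolding h_def by (rule eval_term_closed[OF f])
  have ops: "h (p * q) = h p \<otimes>\<^bsub>A\<^esub> h q" "h (p + q) = h p \<oplus>\<^bsub>A\<^esub> h q"
    "h (fscale k p) = k \<odot>\<^bsub>A\<^esub> h p" for p q k
    by (induction p rule: free_malcev.abs_induct, induction q rule: free_malcev.abs_induct,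
        simp add: times_free_malcev.abs_eq plus_free_malcev.abs_eq fscale.abs_eq abs)+
  show ?thesis
  proof (intro ex1I[of _ h] conjI allI)
    show "h \<in> algebra_hom free_malcev_algebra A"
      using closed ops by (simp add: algebra_hom_def hom_def)
    show "h (gen v) = f v" for v by (simp add: gen.abs_eq abs)
  next
    fix g assume g: "g \<in> algebra_hom free_malcev_algebra A \<and> (\<forall>v. g (gen v) = f v)"
    have g_closed: "g q \<in> carrier A"
      and g_ops: "g (p * q) = g p \<otimes>\<^bsub>A\<^esub> g q" "g (p + q) = g p \<oplus>\<^bsub>A\<^esub> g q"
      "g (fscale k p) = k \<odot>\<^bsub>A\<^esub> g p" "g (gen v) = f v" for p q k v
      using g by (auto simp: algebra_hom_def hom_def)
    have g0: "g 0 = \<zero>\<^bsub>A\<^esub>"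
      using g_ops(2)[of 0 0] g_closed[of 0] by (simp add: add.r_cancel_one')
    have "g (abs_free_malcev t) = eval_term A f t" for t
      by (induction t)
        (simp_all add: g0 g_ops flip: times_free_malcev.abs_eq plus_free_malcev.abs_eq
          fscale.abs_eq gen.abs_eq zero_free_malcev.abs_eq)
    then have "g (abs_free_malcev t) = h (abs_free_malcev t)" for t by (simp add: abs)
    then show "g = h" by (intro ext) (rule free_malcev.abs_induct)
  qed
qed


section \<open>The free Malcev algebra of rank three\<close>

datatype gens = Gen_x | Gen_y | Gen_z

type_synonym 'f M3 = "('f, gens) free_malcev"

definition jac :: "('f::field, 'v) free_malcev \<Rightarrow> ('f, 'v) free_malcev \<Rightarrow> ('f, 'v) free_malcev \<Rightarrow>
    ('f, 'v) free_malcev" where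
  "jac a b c = (a * b) * c + (c * a) * b + (b * c) * a"

definition Gfun :: "('f::field, 'v) free_malcev \<Rightarrow> ('f, 'v) free_malcev \<Rightarrow> ('f, 'v) free_malcev \<Rightarrow>
    ('f, 'v) free_malcev \<Rightarrow> ('f, 'v) free_malcev" where
  "Gfun a b c d = jac (a * b) c d - b * jac a c d - jac b c d * a"

text \<open>Operators are functions here: \<open>Lop a b u\<close> is \<open>u L\<^sub>a\<^sub>,\<^sub>b\<close> in right operator notation.\<close>

definition Lop :: "('f::field, 'v) free_malcev \<Rightarrow> ('f, 'v) free_malcev \<Rightarrow> ('f, 'v) free_malcev \<Rightarrow>
    ('f, 'v) free_malcev" where
  "Lop a b u = fscale (1/2) ((u * a) * b + (u * b) * a)"

definition JMMM :: "('f::field, 'v) free_malcev set" where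
  "JMMM = free_malcev.span {jac a b c | a b c. True}"

text \<open>The operators act from left to right on \<open>J(x,y,z)\<close>, so the power of \<open>G\<close> is innermost.\<close>

definition U_set :: "('f::field, 'v) free_malcev \<Rightarrow> ('f, 'v) free_malcev \<Rightarrow> ('f, 'v) free_malcev \<Rightarrow>
    ('f, 'v) free_malcev set" where
  "U_set x y z =
     {(Lop y z ^^ r) ((Lop x z ^^ q) ((Lop x y ^^ p)
        ((Lop z z ^^ n) ((Lop y y ^^ m) ((Lop x x ^^ l)
          (((\<lambda>t. Gfun t x y z) ^^ k) (jac x y z)))))))
      | k l m n p q r. True}"

definition basis_of :: "('f::field, 'v) free_malcev set \<Rightarrow> ('f, 'v) free_malcev set \<Rightarrow> bool" where
  "basis_of B V \<longleftrightarrow> free_malcev.independent B \<and> free_malcev.span B = V"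

end

theory Submission
  imports Defs "HOL-Library.Poly_Mapping"
begin

text \<open>
  Write operators on the right, let \<open>R\<^sub>a\<close> be right multiplication by \<open>a\<close>, and put
  \<open>E(a,b) = R\<^sub>a\<^sub>b + 1/2 [R\<^sub>a, R\<^sub>b]\<close>; twice this operator is \<open>rot\<close>.

  \<^emph>\<open>Spanning.\<close> Call an alternating trilinear function \<open>f\<close> Jacobian-like if
  \<open>f(a,b,ac) = f(a,b,c)a\<close> and \<open>f(a,b,c)E(a,b) = 0\<close>.  The Jacobian is such a function
  (\<open>rot_jac\<close>).  The key fact is that the class is stable under multiplication by a square:
  \<open>f(a,b,d)cc\<close> becomes Jacobian-like after adding the correction \<open>2/3 f(a,b,c)E(c,d)\<close>, which
  vanishes when \<open>c\<close> is one of \<open>a\<close>, \<open>b\<close>, \<open>d\<close> (\<open>jacobian_like_square_scaled\<close>).  Taking for \<open>c\<close> the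
  elements \<open>x\<close>, \<open>y\<close>, \<open>z\<close>, their pairwise sums, and \<open>x +- yz\<close>, one finds that the set of all
  values \<open>f(x,y,z)\<close> of Jacobian-like functions is stable under the operators \<open>L\<close> and \<open>G\<close>; the
  two defining identities make these operators commute with each other, and the \<open>L\<close> with
  \<open>R\<^sub>x\<close>, \<open>R\<^sub>y\<close>, \<open>R\<^sub>z\<close>.  Hence every word of length three in \<open>R\<^sub>x\<close>, \<open>R\<^sub>y\<close>, \<open>R\<^sub>z\<close> applied to \<open>U\<close>
  reduces to shorter ones (\<open>U_set_words\<close>), and the span of the seven families is stable under
  right multiplication by generators and under \<open>E\<close> of two generators.  By
  \<open>rot_product_general\<close> this makes it a right ideal, and Sagle's identity \<open>jac_product\<close> then
  puts every Jacobian into it.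

  \<^emph>\<open>Independence.\<close> In the split octonions (Zorn's vector matrices) over a polynomial ring in
  seven variables, matrices of trace zero can be chosen for \<open>x\<close>, \<open>y\<close>, \<open>z\<close> so that the seven
  operators act on the image of \<open>J(x,y,z)\<close> as multiplication by nonzero multiples of powers of
  the seven variables (\<open>zj_L\<close>, \<open>zj_G\<close>).  The image of \<open>U\<close> then consists of multiples of one
  octonion \<open>j\<close> by distinct monomials, and \<open>j\<close>, \<open>jx\<close>, \<open>jy\<close>, \<open>jz\<close>, \<open>jxy\<close>, \<open>jxz\<close>, \<open>jyz\<close> are
  independent over the ring (\<open>words_independent\<close>).

  \<^emph>\<open>Speciality.\<close> By the preceding argument the octonion representation is injective on the ideal
  \<open>J(M,M,M)\<close>.  The quotient \<open>M/J(M,M,M)\<close> is a Lie algebra; it acts by affine maps on itself,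
  the translation part being the derivation \<open>D\<close> that multiplies by the degree.  In
  characteristic zero \<open>D\<close> is injective on the quotient, so this associative
  representation has kernel exactly \<open>J(M,M,M)\<close>.  The sum of the two representations is faithful
  and takes values in the commutator algebra of an alternative algebra
  (\<open>special_free_malcev\<close>).
\<close>

section \<open>Identities of Malcev algebras\<close>

text \<open>
  Deciding whether an identity follows linearly from given ones is a problem about vectors, while
  the arithmetic decision procedures work on numbers.  The functionals that are merely additive
  and take rational values separate points, because the algebra is a rational vector space;
  applying one of them turns each product term into an unknown rational number.
\<close>

lemma eq_by_functionals:
  fixes a b :: "('f::field_char_0, 'v) free_malcev"
  assumes "\<And>\<phi> :: ('f, 'v) free_malcev \<Rightarrow> rat. additive \<phi> \<Longrightarrow> \<phi> a = \<phi> b"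
  shows "a = b"
proof (rule ccontr)
  assume "a \<noteq> b"
  interpret Q: vector_space "\<lambda>(q::rat) u :: ('f, 'v) free_malcev. fscale (of_rat q) u"
    by unfold_locales
      (simp_all add: free_malcev.scale_right_distrib free_malcev.scale_left_distrib of_rat_add of_rat_mult)
  let ?v = "a - b"
  have ind: "Q.independent {?v}" using \<open>a \<noteq> b\<close> by simp
  define B where "B = Q.extend_basis {?v}"
  have B: "Q.independent B" "Q.span B = UNIV" "?v \<in> B"
    using Q.independent_extend_basis[OF ind] Q.span_extend_basis[OF ind] Q.extend_basis_superset[OF ind]
    by (auto simp: B_def)
  define \<phi> where "\<phi> u = Q.representation B u ?v" for u
  have "additive \<phi>"
    by unfold_locales (simp add: \<phi>_def Q.representation_add[OF B(1)] B(2))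
  then have "\<phi> a = \<phi> b" and d: "\<phi> (a - b) = \<phi> a - \<phi> b"
    using assms by (auto simp: additive.diff)
  moreover have "\<phi> ?v = 1" unfolding \<phi>_def by (simp add: Q.representation_basis[OF B(1,3)])
  ultimately show False by simp
qed

context
  fixes \<phi> :: "('f::field, 'v) free_malcev \<Rightarrow> rat"
  assumes "additive \<phi>"
begin
lemmas additive_rules = additive.add[OF \<open>additive \<phi>\<close>] additive.diff[OF \<open>additive \<phi>\<close>]
  additive.minus[OF \<open>additive \<phi>\<close>] additive.zero[OF \<open>additive \<phi>\<close>]
end

lemma fm_distrib:
  fixes a b c :: "('f::field, 'v) free_malcev"
  shows "(a + b) * c = a * c + b * c" "a * (b + c) = a * b + a * c"
    "0 * a = 0" "a * 0 = 0" "(- a) * b = - (a * b)" "a * (- b) = - (a * b)"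
    "(a - b) * c = a * c - b * c" "a * (b - c) = a * b - a * c"
proof -
  show d: "(a + b) * c = a * c + b * c" "a * (b + c) = a * b + a * c" for a b c :: "('f, 'v) free_malcev"
    by (rule free_malcev_mult)+
  show z: "0 * a = 0" "a * 0 = 0" for a :: "('f, 'v) free_malcev"
    using d(1)[of 0 0 a] d(2)[of a 0 0] by simp_all
  show m: "(- a) * b = - (a * b)" "a * (- b) = - (a * b)" for a b :: "('f, 'v) free_malcev"
    using d(1)[of a "- a" b] d(2)[of a b "- b"] by (simp_all add: z eq_neg_iff_add_eq_0 add.commute)
  show "(a - b) * c = a * c - b * c" "a * (b - c) = a * b - a * c"
    using d(1)[of a "- b" c] d(2)[of a b "- c"] by (simp_all add: m)
qed

lemma fm_anticomm: "a * b = - (b * a)" for a b :: "('f::field, 'v) free_malcev"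
proof -
  have "(a + b) * (a + b) = 0" "a * a = 0" "b * b = 0" by (rule free_malcev_mult)+
  then show ?thesis by (simp add: fm_distrib(1,2) eq_neg_iff_add_eq_0 add.commute)
qed

lemma jac_op: "jac u a b = u * a * b - u * b * a - u * (a * b)"
  for a b u :: "('f::field, 'v) free_malcev"
  unfolding jac_def fm_anticomm[of u b] fm_anticomm[of u "a * b"] by (simp add: fm_distrib)

lemma jac_rotate: "jac b c a = jac a b c" for a b c :: "('f::field, 'v) free_malcev"
  by (simp add: jac_def add_ac)

lemma jac_swap: "jac u b a = - jac u a b" "jac a u b = - jac u a b" "jac b a u = - jac u a b"
  for a b u :: "('f::field, 'v) free_malcev"
proof -
  show s: "jac u b a = - jac u a b" for u a b :: "('f, 'v) free_malcev"
    unfolding jac_op fm_anticomm[of a b] by (simp add: fm_distrib)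
  show "jac a u b = - jac u a b" using s[of a u b] by (metis jac_rotate minus_minus)
  show "jac b a u = - jac u a b" using s[of b u a] by (metis jac_rotate s)
qed

lemma jac_add:
  fixes a b c a' :: "('f::field, 'v) free_malcev"
  shows "jac (a + a') b c = jac a b c + jac a' b c"
    "jac b (a + a') c = jac b a c + jac b a' c"
    "jac b c (a + a') = jac b c a + jac b c a'"
  by (simp_all add: jac_def fm_distrib algebra_simps)

lemma jac_same [simp]: "jac a a b = 0" "jac b a a = 0" "jac a b a = 0"
  for a b :: "('f::field, 'v) free_malcev"
proof -
  show s: "jac b a a = 0" for a b :: "('f, 'v) free_malcev"
    by (simp add: jac_op free_malcev_mult(5) fm_distrib)
  show "jac a a b = 0" "jac a b a = 0" using s[of b a] jac_rotate[of a b a] jac_rotate[of a a b] by simp_all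
qed

lemma jac_malcev: "jac a b (a * c) = jac a b c * a" for a b c :: "('f::field, 'v) free_malcev"
  using free_malcev_mult(6)[of a b c] by (simp add: jac_def)

lemma jac_malcev_linear: "jac a b (d * c) + jac d b (a * c) = jac a b c * d + jac d b c * a"
  for a b c d :: "('f::field, 'v) free_malcev"
  using jac_malcev[of "a + d" b c] jac_malcev[of a b c] jac_malcev[of d b c]
  by (simp add: jac_add fm_distrib algebra_simps)

text \<open>
  Twice the operator \<open>E(a,b) = R\<^sub>a\<^sub>b + 1/2 [R\<^sub>a, R\<^sub>b]\<close>; the factor avoids denominators.  Since
  \<open>R\<^sub>a\<^sub>b = E(a,b) - 1/2 [R\<^sub>a, R\<^sub>b]\<close>, right multiplication by a product can be traded for \<open>E\<close>,
  which has the advantage of killing Jacobians of its arguments.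
\<close>

definition rot :: "('f::field, 'v) free_malcev \<Rightarrow> ('f, 'v) free_malcev \<Rightarrow> ('f, 'v) free_malcev \<Rightarrow>
    ('f, 'v) free_malcev" where
  "rot u a b = u * (a * b) + u * (a * b) + u * a * b - u * b * a"

lemma rot_linear:
  fixes u v a b c :: "('f::field, 'v) free_malcev"
  shows "rot (u + v) a b = rot u a b + rot v a b" "rot u (a + c) b = rot u a b + rot u c b"
    "rot u a (b + c) = rot u a b + rot u a c"
    "rot (u - v) a b = rot u a b - rot v a b" "rot u (a - c) b = rot u a b - rot u c b"
    "rot u a (b - c) = rot u a b - rot u a c"
    "rot (- u) a b = - rot u a b" "rot u (- a) b = - rot u a b" "rot u a (- b) = - rot u a b"
    "rot 0 a b = 0" "rot u 0 b = 0" "rot u a 0 = 0"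
  by (simp_all add: rot_def fm_distrib algebra_simps)

lemma rot_same [simp]: "rot u a a = 0" for u a :: "('f::field, 'v) free_malcev"
  by (simp add: rot_def fm_distrib free_malcev_mult(5))

lemma rot_swap: "rot u b a = - rot u a b" for u a b :: "('f::field, 'v) free_malcev"
  by (simp add: rot_def fm_distrib fm_anticomm[of a b])

text \<open>
  The Malcev identity, linearized, as a formula for the operators \<open>R\<^sub>a\<^sub>(\<^sub>d\<^sub>c\<^sub>) + R\<^sub>d\<^sub>(\<^sub>a\<^sub>c\<^sub>)\<close>.
\<close>

lemma mult_product_middle:
  fixes u a c d :: "('f::field_char_0, 'v) free_malcev"
  shows "u * (a * (d * c)) + u * (d * (a * c)) =
     u * a * (d * c) + u * d * (a * c) - (u * a * c - u * c * a) * d - (u * d * c - u * c * d) * a"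
proof -
  have e: "jac a u (d * c) + jac d u (a * c) = jac a u c * d + jac d u c * a"
    by (rule jac_malcev_linear)
  show ?thesis
  proof (rule eq_by_functionals)
    fix \<phi> :: "('f, 'v) free_malcev \<Rightarrow> rat"
    assume "additive \<phi>"
    note rules = additive_rules[OF this]
    show "\<phi> (u * (a * (d * c)) + u * (d * (a * c))) =
       \<phi> (u * a * (d * c) + u * d * (a * c) - (u * a * c - u * c * a) * d - (u * d * c - u * c * d) * a)"
      using e[THEN arg_cong[where f = \<phi>]]
      unfolding jac_swap(2)[where a = a and u = u] jac_swap(2)[where a = d and u = u]
      unfolding jac_op fm_distrib rules by linarith
  qed
qed

lemma jac_anticommutes: "jac (u * a) a b = - (jac u a b * a)" for u a b :: "('f::field, 'v) free_malcev"
proof -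
  have "jac (u * a) a b = jac a b (u * a)" by (simp only: jac_rotate)
  also have "\<dots> = - jac a b (a * u)" unfolding fm_anticomm[of a u] jac_op fm_distrib by simp
  also have "\<dots> = - (jac a b u * a)" by (simp only: jac_malcev)
  also have "jac a b u = jac u a b" by (simp only: jac_rotate)
  finally show ?thesis .
qed

text \<open>
  In operator form: \<open>[R\<^sub>a, R\<^sub>c\<^sup>2] = 2/3 (R\<^sub>c E(a,c) + E(a,c) R\<^sub>c)\<close>.  So \<open>R\<^sub>a\<close> commutes with the square
  of \<open>R\<^sub>c\<close> on every vector \<open>u\<close> for which \<open>E(a,c)\<close> kills both \<open>u\<close> and \<open>uc\<close>.
\<close>

lemma rot_anticommutator:
  fixes u a c :: "('f::field_char_0, 'v) free_malcev"
  shows "rot (u * c) a c + rot u a c * c =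
     (u * a * c * c - u * c * c * a) + (u * a * c * c - u * c * c * a) + (u * a * c * c - u * c * c * a)"
    (is "?l = ?r")
proof (rule eq_by_functionals)
  fix \<phi> :: "('f, 'v) free_malcev \<Rightarrow> rat" assume \<phi>: "additive \<phi>"
  note app = arg_cong[where f = \<phi>]
  show "\<phi> ?l = \<phi> ?r"
    using jac_anticommutes[of u c a, THEN app]
    unfolding jac_op rot_def fm_anticomm[of a c]
    unfolding fm_distrib additive_rules[OF \<phi>] by linarith
qed

lemma rot_product:
  fixes u a c :: "('f::field_char_0, 'v) free_malcev"
  shows "rot u c (a * c) = rot (u * c) a c - rot u a c * c" (is "?l = ?r")
proof (rule eq_by_functionals)
  fix \<phi> :: "('f, 'v) free_malcev \<Rightarrow> rat" assume \<phi>: "additive \<phi>"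
  note app = arg_cong[where f = \<phi>]
  show "\<phi> ?l = \<phi> ?r"
    using mult_product_middle[of u c c a, THEN app]
      jac_anticommutes[of u c a, THEN app]
    unfolding jac_op rot_def fm_anticomm[of a c]
    unfolding fm_distrib additive_rules[OF \<phi>] by linarith
qed

lemma rot_anticommutator_linear:
  fixes u a c d :: "('f::field_char_0, 'v) free_malcev"
  shows "rot (u * c) a d + rot (u * d) a c + rot u a c * d + rot u a d * c =
     (u * a * c * d + u * a * d * c - u * c * d * a - u * d * c * a)
     + (u * a * c * d + u * a * d * c - u * c * d * a - u * d * c * a)
     + (u * a * c * d + u * a * d * c - u * c * d * a - u * d * c * a)" (is "?l = ?r")
proof (rule eq_by_functionals)
  fix \<phi> :: "('f, 'v) free_malcev \<Rightarrow> rat" assume \<phi>: "additive \<phi>"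
  note app = arg_cong[where f = \<phi>]
  show "\<phi> ?l = \<phi> ?r"
    using rot_anticommutator[of u c a, THEN app]
      rot_anticommutator[of u d a, THEN app]
      rot_anticommutator[of u "c + d" a, THEN app]
    unfolding fm_distrib rot_linear
    unfolding fm_distrib additive_rules[OF \<phi>] by linarith
qed

lemma jac_malcev_operator:
  fixes u b c d :: "('f::field, 'v) free_malcev"
  shows "jac u b (d * c) + jac (u * c) d b = jac u b c * d - u * jac d b c"
  using jac_malcev_linear[of u b d c] jac_rotate[of d b "u * c"] fm_anticomm[of u "jac d b c"] by simp

text \<open>
  The operator identity \<open>R\<^sub>J = [R\<^sub>c, R\<^sub>a\<^sub>b] + [R\<^sub>a, R\<^sub>b\<^sub>c] + [R\<^sub>b, R\<^sub>c\<^sub>a]\<close> for \<open>J = J(a,b,c)\<close>, obtained by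
  antisymmetrizing \<open>jac_malcev_operator\<close> over the six orderings of \<open>a\<close>, \<open>b\<close>, \<open>c\<close>.
\<close>

lemma mult_jac:
  fixes u a b c :: "('f::field_char_0, 'v) free_malcev"
  shows "u * jac a b c = (u * c * (a * b) - u * (a * b) * c) + (u * a * (b * c) - u * (b * c) * a)
     + (u * b * (c * a) - u * (c * a) * b)" (is "?l = ?r")
proof (rule eq_by_functionals)
  fix \<phi> :: "('f, 'v) free_malcev \<Rightarrow> rat" assume \<phi>: "additive \<phi>"
  note app = arg_cong[where f = \<phi>]
  show "\<phi> ?l = \<phi> ?r"
    using jac_malcev_operator[of u a b c, THEN app]
      jac_malcev_operator[of u b c a, THEN app]
      jac_malcev_operator[of u c a b, THEN app]
      jac_malcev_operator[of u b a c, THEN app]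
      jac_malcev_operator[of u c b a, THEN app]
      jac_malcev_operator[of u a c b, THEN app]
    unfolding jac_op
    unfolding fm_anticomm[of a b] fm_anticomm[of b c] fm_anticomm[of c a] fm_distrib
      fm_anticomm[of "b * a" a] fm_anticomm[of "b * a" b] fm_anticomm[of "b * a" c]
      fm_anticomm[of "c * b" a] fm_anticomm[of "c * b" b] fm_anticomm[of "c * b" c]
      fm_anticomm[of "a * c" a] fm_anticomm[of "a * c" b] fm_anticomm[of "a * c" c]
    unfolding fm_distrib additive_rules[OF \<phi>] by linarith
qed

lemma mult_jac_rot:
  fixes u a b c :: "('f::field_char_0, 'v) free_malcev"
  shows "u * jac a b c + u * jac a b c = (rot (u * c) a b - rot u a b * c) + (rot (u * a) b c - rot u b c * a)
     + (rot (u * b) c a - rot u c a * b)" (is "?l = ?r")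
proof (rule eq_by_functionals)
  fix \<phi> :: "('f, 'v) free_malcev \<Rightarrow> rat" assume \<phi>: "additive \<phi>"
  note app = arg_cong[where f = \<phi>]
  show "\<phi> ?l = \<phi> ?r"
    using mult_jac[of u a b c, THEN app]
    unfolding rot_def
    unfolding fm_distrib additive_rules[OF \<phi>] by linarith
qed

lemma rot_product_linear:
  fixes u a c d :: "('f::field_char_0, 'v) free_malcev"
  shows "rot u c (a * d) + rot u d (a * c) =
    (rot (u * c) a d - rot u a d * c) + (rot (u * d) a c - rot u a c * d)" (is "?l = ?r")
proof (rule eq_by_functionals)
  fix \<phi> :: "('f, 'v) free_malcev \<Rightarrow> rat" assume \<phi>: "additive \<phi>"
  note app = arg_cong[where f = \<phi>]
  show "\<phi> ?l = \<phi> ?r"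
    using rot_product[of u c a, THEN app]
      rot_product[of u d a, THEN app]
      rot_product[of u "c + d" a, THEN app]
    unfolding fm_distrib rot_linear
    unfolding fm_distrib additive_rules[OF \<phi>] by linarith
qed

lemma rot_product_cyclic:
  fixes u a b c :: "('f::field_char_0, 'v) free_malcev"
  shows "(rot u c (a * b) + rot u a (b * c) + rot u b (c * a)) + (rot u c (a * b) + rot u a (b * c) + rot u b (c * a)) =
    - ((rot (u * c) a b - rot u a b * c) + (rot (u * a) b c - rot u b c * a) + (rot (u * b) c a - rot u c a * b))"
    (is "?l = ?r")
proof (rule eq_by_functionals)
  fix \<phi> :: "('f, 'v) free_malcev \<Rightarrow> rat" assume \<phi>: "additive \<phi>"
  note app = arg_cong[where f = \<phi>]
  show "\<phi> ?l = \<phi> ?r"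
    using mult_jac[of u a b c, THEN app]
    unfolding jac_def[of a b c] rot_def
    unfolding fm_anticomm[of a "b * c"] fm_anticomm[of b "c * a"] fm_anticomm[of c "a * b"]
    unfolding fm_distrib additive_rules[OF \<phi>] by linarith
qed

text \<open>
  This recursion, \<open>2 E(c,ad) = [R\<^sub>c, E(a,d)] + [R\<^sub>a, E(c,d)] + [R\<^sub>d, E(a,c)]\<close>, is what lets properties
  of \<open>E\<close> on generators propagate to products: a subspace stable under all \<open>R\<close> and \<open>E\<close> of a set of
  elements is stable under those of their products.
\<close>

lemma rot_product_general:
  fixes u a c d :: "('f::field_char_0, 'v) free_malcev"
  shows "rot u c (a * d) + rot u c (a * d) =
    (rot (u * c) a d - rot u a d * c) + (rot (u * a) c d - rot u c d * a) + (rot (u * d) a c - rot u a c * d)"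
    (is "?l = ?r")
proof (rule eq_by_functionals)
  fix \<phi> :: "('f, 'v) free_malcev \<Rightarrow> rat" assume \<phi>: "additive \<phi>"
  note app = arg_cong[where f = \<phi>]
  show "\<phi> ?l = \<phi> ?r"
    using rot_product_cyclic[of u c a d, THEN app]
      rot_product_linear[of u c a d, THEN app]
      rot_product_linear[of u a c d, THEN app]
      rot_product_linear[of u a d c, THEN app]
    unfolding fm_anticomm[of a d] fm_anticomm[of c d] fm_anticomm[of c a] rot_swap[of _ a d]
      rot_swap[of _ c d] rot_swap[of _ a c] fm_distrib rot_linear
    unfolding fm_distrib additive_rules[OF \<phi>] by linarith
qed

lemma jac_commutes_commutator:
  fixes u a b :: "('f::field_char_0, 'v) free_malcev"
  shows "jac (u * a * b - u * b * a) a b = jac u a b * a * b - jac u a b * b * a" (is "?l = ?r")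
proof -
  have a: "jac (u * a) a b = - (jac u a b * a)" for u by (rule jac_anticommutes)
  have b: "jac (u * b) a b = - (jac u a b * b)" for u
    using jac_anticommutes[of u b a] unfolding jac_swap(1)[of _ b a] fm_distrib by (metis minus_minus)
  have d: "jac (p - q) a b = jac p a b - jac q a b" for p q by (simp add: jac_op fm_distrib)
  show ?thesis unfolding d a b fm_distrib by simp
qed

text \<open>
  Let \<open>C = [R\<^sub>a, R\<^sub>b]\<close> and \<open>E = E(a,b)\<close>.  The operator \<open>\<Delta>\<close> sending \<open>u\<close> to \<open>J(u,a,b)\<close> is
  \<open>3/2 C - E\<close>.  By \<open>jac_anticommutes\<close> it anticommutes with \<open>R\<^sub>a\<close> and \<open>R\<^sub>b\<close>, hence commutes with
  \<open>C\<close>, and so does \<open>E\<close>.  Linearizing \<open>rot_anticommutator\<close> in the direction \<open>ab\<close> and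
  inserting \<open>rot_product\<close> gives \<open>E\<^sup>2 = 3/4 (CE + EC) = 3/2 CE\<close>, that is, \<open>\<Delta>E = 0\<close>.
\<close>

lemma rot_jac:
  fixes u a b :: "('f::field_char_0, 'v) free_malcev"
  shows "rot (jac u a b) a b = 0" (is "?l = ?r")
proof -
  note times_a = arg_cong[where f = "\<lambda>t. t * a"] and times_b = arg_cong[where f = "\<lambda>t. t * b"]
  show ?thesis
  proof (rule eq_by_functionals)
    fix \<phi> :: "('f, 'v) free_malcev \<Rightarrow> rat" assume \<phi>: "additive \<phi>"
    note app = arg_cong[where f = \<phi>]
    show "\<phi> ?l = \<phi> ?r"
      using rot_anticommutator_linear[of u b a "a * b", THEN app]
        jac_commutes_commutator[of u a b, THEN app]
        rot_product[of "u * b" a b, THEN app]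
        rot_product[of u a b, THEN times_b, THEN app]
        rot_anticommutator[of "u * a" b a, THEN app]
        rot_anticommutator[of u b a, THEN times_a, THEN app]
      unfolding jac_op rot_def
      unfolding fm_anticomm[of a b] fm_distrib
      unfolding fm_distrib additive_rules[OF \<phi>] by linarith
  qed
qed

section \<open>Jacobian-like functions\<close>

text \<open>
  The properties of the Jacobian that the commutation of \<open>G\<close> and of the \<open>L\<close> rests on.  They are
  abstracted because the values obtained from \<open>J(x,y,z)\<close> by applying these operators are no longer
  Jacobians of \<open>x\<close>, \<open>y\<close>, \<open>z\<close>, but are still values \<open>f(x,y,z)\<close> of some function of this kind.
\<close>

locale jacobian_like =
  fixes f :: "('f::field_char_0, 'v) free_malcev \<Rightarrow> ('f, 'v) free_malcev \<Rightarrow> ('f, 'v) free_malcev \<Rightarrow>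
    ('f, 'v) free_malcev"
  assumes f_add1: "f (a + a') b c = f a b c + f a' b c"
    and f_add2: "f a (b + b') c = f a b c + f a b' c"
    and f_add3: "f a b (c + c') = f a b c + f a b c'"
    and f_same12 [simp]: "f a a b = 0" and f_same23 [simp]: "f a b b = 0"
    and f_mult: "f a b (a * c) = f a b c * a"
    and f_rot: "rot (f a b c) a b = 0"
begin

lemma f_perm: "f q p r = - f p q r" "f p r q = - f p q r" "f r q p = - f p q r"
  "f q r p = f p q r" "f r p q = f p q r"
proof -
  have 1: "f q p r = - f p q r" for p q r
  proof -
    have "f p q r + f q p r = 0" using f_same12[of "p + q" r] unfolding f_add1 f_add2
      by (simp add: add.commute)
    then show ?thesis by (metis add.commute eq_neg_iff_add_eq_0)
  qed
  have 2: "f p r q = - f p q r" for p q r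
  proof -
    have "f p q r + f p r q = 0" using f_same23[of p "q + r"] unfolding f_add2 f_add3
      by (simp add: add.commute)
    then show ?thesis by (metis add.commute eq_neg_iff_add_eq_0)
  qed
  show "f q p r = - f p q r" "f p r q = - f p q r" "f r q p = - f p q r"
    "f q r p = f p q r" "f r p q = f p q r"
    using 1[of p q r] 2[of p q r] 1[of q r p] 2[of q p r] 1[of p r q] 2[of r p q] by simp_all
qed

lemma f_same13 [simp]: "f a b a = 0"
  using f_perm(2)[of a a b] by simp

lemma f_zero: "f 0 b c = 0" "f a 0 c = 0" "f a b 0 = 0"
  using f_add1[of 0 0 b c] f_add2[of a 0 0 c] f_add3[of a b 0 0] by simp_all

lemma f_minus: "f (- a) b c = - f a b c" "f a (- b) c = - f a b c" "f a b (- c) = - f a b c"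
  using f_add1[of a "- a" b c] f_add2[of a b "- b" c] f_add3[of a b c "- c"]
  by (simp_all add: f_zero eq_neg_iff_add_eq_0 add.commute)

lemmas f_linear = f_add1 f_add2 f_add3 f_zero f_minus

lemma f_mult_linear: "f a b (d * c) + f d b (a * c) = f a b c * d + f d b c * a"
  using f_mult[of "a + d" b c] by (simp add: f_linear fm_distrib f_mult algebra_simps)

lemma f_mult': "f (c * a) a b = - f c a b * a" "f (a * c) a b = f c a b * a" "f (c * a) b a = - f c b a * a"
  "f (a * c) b a = f c b a * a"
proof -
  have 1: "f (a * c) a b = f c a b * a" for a b c
    using f_mult[of a b c] f_perm[of a b "a * c"] f_perm[of a b c] by simp
  have 2: "f (a * c) b a = f c b a * a"
    using 1[of a c b] f_perm(2)[of "a*c" a b] f_perm(2)[of c a b] by (simp add: fm_distrib)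
  show "f (c * a) a b = - f c a b * a" "f (a * c) a b = f c a b * a" "f (c * a) b a = - f c b a * a"
    "f (a * c) b a = f c b a * a"
    using 1[of a c b] 2 unfolding fm_anticomm[of c a] by (simp_all add: f_minus fm_distrib)
qed

lemma f_mult_snd: "f a b (b * c) = f a b c * b"
  using f_mult[of b a c] f_perm(1)[where p = a and q = b] by (simp add: fm_distrib)

lemma f_rot': "rot (f a b c) b c = 0" "rot (f a b c) a c = 0"
  using f_rot[of b c a] f_rot[of a c b] f_perm[of a b c] by (simp_all add: rot_linear)

text \<open>
  Linearizing \<open>f(a,b,c)E(b,c) = 0\<close>: the vector \<open>f(a,b,c)E(c,d)\<close> is alternating in \<open>a\<close>, \<open>b\<close>, \<open>d\<close>.
  This is why it can serve as a correction term for an alternating function.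
\<close>

lemma f_rot_exchange: "rot (f a b c) c d = - rot (f a d c) c b"
proof -
  have "rot (f a (b + d) c) (b + d) c = 0" by (rule f_rot')
  then have "rot (f a d c) b c + rot (f a b c) d c = 0" by (simp add: f_linear rot_linear f_rot')
  then have "rot (f a b c) d c = - rot (f a d c) b c" by (metis add.commute eq_neg_iff_add_eq_0)
  then show ?thesis using rot_swap[of "f a b c" c d] rot_swap[of "f a d c" c b] by simp
qed

lemma f_rot_mult: "rot (f a b c * a) a b = 0" "rot (f a b c * a) a c = 0" "rot (f a b c * b) a b = 0"
   "rot (f a b c * b) b c = 0" "rot (f a b c * c) a c = 0" "rot (f a b c * c) b c = 0"
proof -
  have 1: "rot (f a b c * a) a b = 0" for a b c
    using f_rot[of a b "a * c"] by (simp add: f_mult)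
  show "rot (f a b c * a) a b = 0" "rot (f a b c * a) a c = 0" "rot (f a b c * b) a b = 0"
   "rot (f a b c * b) b c = 0" "rot (f a b c * c) a c = 0" "rot (f a b c * c) b c = 0"
    using 1[of a b c] 1[of a c b] 1[of b a c] 1[of b c a] 1[of c a b] 1[of c b a] f_perm[of a b c]
    by (simp_all add: fm_distrib rot_linear rot_swap[of _ a b] rot_swap[of _ b c] rot_swap[of _ a c])
qed

lemma rot_f_mult1: "rot (f a b c * a) c d = rot (f a d c) c (b * a)"
proof -
  have "rot (f (b * a) a c) c d = - rot (f (b * a) d c) c a" by (rule f_rot_exchange)
  also have "\<dots> = rot (f d (b * a) c) c a" using f_perm(1)[where p = "b * a" and q = d and r = c] by (simp add: rot_linear)
  also have "\<dots> = - rot (f d a c) c (b * a)" by (rule f_rot_exchange)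
  finally show ?thesis
    using f_mult'(1)[where c = b and a = a and b = c] f_perm(1)[where p = a and q = b and r = c]
      f_perm(1)[where p = a and q = d and r = c]
    by (simp add: rot_linear fm_distrib)
qed

lemma rot_f_mult2: "rot (f a b c) c (a * d) = rot (f d a c * a) c b"
proof -
  have "rot (f a b c) c (a * d) = - rot (f a (a * d) c) c b" by (rule f_rot_exchange)
  also have "f a (a * d) c = - (f d a c * a)"
    using f_mult'(2)[of a d c] f_perm(1)[where p = "a * d" and q = a and r = c] by simp
  finally show ?thesis by (simp add: rot_linear fm_distrib)
qed

lemma rot_f_mult_pair: "rot (f a b d * c) a c + rot (f a b c * d) a c + rot (f a b c * c) a d = 0"
  (is "?l = ?r")
proof (rule eq_by_functionals)
  fix \<phi> :: "('f, 'v) free_malcev \<Rightarrow> rat" assume \<phi>: "additive \<phi>"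
  note app = arg_cong[where f = \<phi>]
  show "\<phi> ?l = \<phi> ?r"
    using f_rot_mult(5)[of a b "c + d", THEN app]
      f_rot_mult(5)[of a b "c + - d", THEN app]
      f_rot_mult(5)[of a b d, THEN app]
    unfolding f_linear fm_distrib rot_linear f_rot_mult
    unfolding fm_distrib additive_rules[OF \<phi>] by linarith
qed

lemma rot_f_mult3: "rot (f a b (c * d)) a c = rot (f d c a * c) a b"
proof -
  have "rot (f a b (c * d)) a c = rot (f b (c * d) a) a c"
    using f_perm(4)[where p = a and q = b and r = "c * d"] by simp
  also have "\<dots> = - rot (f b c a) a (c * d)" by (rule f_rot_exchange)
  also have "\<dots> = rot (f c b a) a (c * d)"
    by (simp add: f_perm(1)[where p = c and q = b and r = a] rot_linear)
  finally show ?thesis using rot_f_mult2[of c b a d] by simp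
qed

lemma rot_f_mult_cross:
  "rot (f a b d * c) a c + rot (f c b d * a) a c = rot (f d c a * c) a b - rot (f d a c * a) c b"
proof -
  have "f a b (c * d) + f c b (a * d) = f a b d * c + f c b d * a" by (rule f_mult_linear)
  then have "rot (f a b d * c) a c + rot (f c b d * a) a c = rot (f a b (c * d)) a c + rot (f c b (a * d)) a c"
    by (metis rot_linear(1))
  also have "rot (f c b (a * d)) a c = - rot (f c b (a * d)) c a" by (rule rot_swap)
  finally show ?thesis by (simp add: rot_f_mult3)
qed

text \<open>
  The central identity: \<open>f(a,b,c) R\<^sub>a E(c,d) = f(a,b,c) E(c,ad)\<close>.  The preceding lemmas rewrite
  both sides, for all ways of exchanging \<open>a\<close> with \<open>c\<close> and \<open>b\<close> with \<open>d\<close>, and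
  \<open>rot_product_general\<close> ties them together; all equations combined force three times the
  difference of the two sides to vanish.
\<close>

lemma rot_f_shift: "rot (f a b c * a) c d = rot (f a b c) c (a * d)" (is "?l = ?r")
proof (rule eq_by_functionals)
  fix \<phi> :: "('f, 'v) free_malcev \<Rightarrow> rat" assume \<phi>: "additive \<phi>"
  note app = arg_cong[where f = \<phi>]
  show "\<phi> ?l = \<phi> ?r"
    using rot_f_mult1[of a b c d, THEN app]
      rot_f_mult1[of a d c b, THEN app]
      rot_f_mult1[of c b a d, THEN app]
      rot_f_mult1[of c d a b, THEN app]
      rot_f_mult2[of a b c d, THEN app]
      rot_f_mult2[of a d c b, THEN app]
      rot_f_mult2[of c b a d, THEN app]
      rot_f_mult2[of c d a b, THEN app]
      rot_f_mult_pair[of a b d c, THEN app]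
      rot_f_mult_pair[of c b d a, THEN app]
      rot_f_mult_pair[of a d b c, THEN app]
      rot_f_mult_pair[of c d b a, THEN app]
      rot_f_mult_cross[of a b d c, THEN app]
      rot_f_mult_cross[of a d b c, THEN app]
      rot_product_general[of "f a b c" c a d, THEN app]
      rot_product_general[of "f a b c" a c d, THEN app]
      rot_product_general[of "f a d c" c a b, THEN app]
      rot_product_general[of "f a d c" a c b, THEN app]
    unfolding f_perm[where p = a and q = b and r = c] f_perm[where p = a and q = b and r = d]
      f_perm[where p = a and q = c and r = d] f_perm[where p = b and q = c and r = d] fm_anticomm[of d c]
      fm_anticomm[of b a] fm_anticomm[of d a] fm_anticomm[of b c] fm_distrib rot_linear
    unfolding f_rot f_rot' f_rot_mult rot_swap[of _ c a] rot_swap[of _ d a] rot_swap[of _ d c]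
      rot_swap[of _ b a] rot_swap[of _ c b] fm_distrib rot_linear
    unfolding fm_distrib additive_rules[OF \<phi>] by linarith
qed

lemma rot_f_mult_outside: "rot (f a b d * c) a c = - rot (f a b c) c (a * d)" (is "?l = ?r")
proof (rule eq_by_functionals)
  fix \<phi> :: "('f, 'v) free_malcev \<Rightarrow> rat" assume \<phi>: "additive \<phi>"
  note app = arg_cong[where f = \<phi>]
  show "\<phi> ?l = \<phi> ?r"
    using rot_f_mult_pair[of a b d c, THEN app]
      rot_f_shift[of a b c d, THEN app]
      rot_f_shift[of c b a d, THEN app]
      rot_product_general[of "f a b c" c a d, THEN app]
      rot_product_general[of "f a b c" a c d, THEN app]
    unfolding f_perm[where p = a and q = b and r = c] rot_linear
    unfolding f_rot f_rot' f_rot_mult rot_swap[of _ c a] rot_swap[of _ d a] rot_swap[of _ d c] fm_distrib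
      rot_linear
    unfolding fm_distrib additive_rules[OF \<phi>] by linarith
qed

lemma rot_f_turn: "rot (f a b d) a c * c = rot (f a b c) c d * a" (is "?l = ?r")
proof -
  have 1: "rot (f a b d) a c = - rot (f a b c) a d"
    using f_rot_exchange[of b c a d] f_rot_exchange[of b d a c]
      f_perm(4)[where p = a and q = b and r = c] f_perm(4)[where p = a and q = b and r = d]
      f_perm(2)[where p = b and q = c and r = a] by simp
  note times_c = arg_cong[where f = "\<lambda>t. t * c"]
  show ?thesis
  proof (rule eq_by_functionals)
    fix \<phi> :: "('f, 'v) free_malcev \<Rightarrow> rat" assume \<phi>: "additive \<phi>"
    note app = arg_cong[where f = \<phi>]
    show "\<phi> ?l = \<phi> ?r"
      using 1[THEN times_c, THEN app]
        rot_f_shift[of a b c d, THEN app]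
        rot_f_shift[of c b a d, THEN app]
        rot_product_general[of "f a b c" c a d, THEN app]
        rot_product_general[of "f a b c" a c d, THEN app]
      unfolding f_perm[where p = a and q = b and r = c] rot_linear
      unfolding f_rot f_rot' f_rot_mult rot_swap[of _ c a] rot_swap[of _ d a] rot_swap[of _ d c] fm_distrib
        rot_linear
      unfolding fm_distrib additive_rules[OF \<phi>] by linarith
  qed
qed

text \<open>
  For \<open>g(d) = 3 f(a,b,d)cc\<close> the left side is \<open>g(ad) - g(d)a\<close>.  For \<open>g(d) = 2 f(a,b,c)E(c,d)\<close> the right
  side is \<open>g(d)a - g(ad)\<close>.  So the sum of the two functions, \<open>square_scaled\<close>, satisfies
  \<open>g(ad) = g(d)a\<close>.
\<close>

lemma f_commutator_square:
  "(f a b d * a * c * c - f a b d * c * c * a) + (f a b d * a * c * c - f a b d * c * c * a)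
     + (f a b d * a * c * c - f a b d * c * c * a) =
   rot (f a b c) c d * a - rot (f a b c) c (a * d)"
  using rot_anticommutator[of "f a b d" c a] rot_f_turn[of a b d c] rot_f_mult_outside[of a b d c] by simp

text \<open>
  This says \<open>f(a,b,c) E(c, J(a,b,d) - 3(ab)d) = 0\<close>.  It follows by linearizing
  \<open>rot_f_shift\<close> in the direction \<open>ab\<close> and antisymmetrizing in \<open>a\<close> and \<open>b\<close>.
\<close>

lemma rot_f_double_shift:
  "rot (f a b c) c (b * (a * d)) - rot (f a b c) c (a * (b * d)) =
   rot (f a b c) c ((a * b) * d) + rot (f a b c) c ((a * b) * d)" (is "?l = ?r")
proof -
  note rot_cd = arg_cong[where f = "\<lambda>t. rot t c d"]
  show ?thesis
  proof (rule eq_by_functionals)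
    fix \<phi> :: "('f, 'v) free_malcev \<Rightarrow> rat" assume \<phi>: "additive \<phi>"
    note app = arg_cong[where f = \<phi>]
    show "\<phi> ?l = \<phi> ?r"
      using rot_f_shift[of a b c d, THEN app]
        rot_f_shift[of "a * b" b c d, THEN app]
        rot_f_shift[of "a + a * b" b c d, THEN app]
        rot_f_shift[of b a c d, THEN app]
        rot_f_shift[of "b * a" a c d, THEN app]
        rot_f_shift[of "b + b * a" a c d, THEN app]
        rot_f_shift[of a b c "b * d", THEN app]
        rot_f_shift[of b a c "a * d", THEN app]
        f_rot[of a b c, unfolded rot_def, THEN rot_cd, THEN app]
      unfolding f_linear f_mult' fm_distrib rot_linear
      unfolding f_perm(1)[where p = a and q = b and r = c] fm_anticomm[of b a] fm_distrib rot_linear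
      unfolding fm_distrib additive_rules[OF \<phi>] by linarith
  qed
qed

text \<open>
  This is three times \<open>f(a,b,d)cc + 2/3 f(a,b,c)E(c,d)\<close>, the factor clearing the denominator.
\<close>

definition square_scaled :: "('f, 'v) free_malcev \<Rightarrow> ('f, 'v) free_malcev \<Rightarrow> ('f, 'v) free_malcev \<Rightarrow>
    ('f, 'v) free_malcev \<Rightarrow> ('f, 'v) free_malcev" where
  "square_scaled c a b d = f a b d * c * c + f a b d * c * c + f a b d * c * c + rot (f a b c) c d"

lemma square_scaled_mult: "square_scaled c a b (a * d) = square_scaled c a b d * a"
  using f_commutator_square[of a b d c] unfolding square_scaled_def f_mult fm_distrib by (simp add: algebra_simps)

text \<open>
  Moving \<open>R\<^sub>c\<^sup>2\<close> past \<open>E(a,b)\<close>, which kills \<open>f(a,b,d)\<close>, by \<open>f_commutator_square\<close> leaves only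
  vectors \<open>f(a,b,c)E(c,\<dots>)\<close> multiplied by \<open>a\<close> or \<open>b\<close>; by \<open>rot_f_shift\<close> they combine to
  \<open>rot_f_double_shift\<close>.
\<close>

lemma square_scaled_rot: "rot (square_scaled c a b d) a b = 0" (is "?l = ?r")
proof -
  note times_a = arg_cong[where f = "\<lambda>t. t * a"] and times_b = arg_cong[where f = "\<lambda>t. t * b"]
    and times_c = arg_cong[where f = "\<lambda>t. t * c"] and times_cc = arg_cong[where f = "\<lambda>t. t * c * c"]
  show ?thesis
  proof (rule eq_by_functionals)
    fix \<phi> :: "('f, 'v) free_malcev \<Rightarrow> rat" assume \<phi>: "additive \<phi>"
    note app = arg_cong[where f = \<phi>]
    show "\<phi> ?l = \<phi> ?r"
      using f_commutator_square[of a b d c, THEN times_b, THEN app]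
        f_commutator_square[of b a d c, THEN times_a, THEN app]
        f_commutator_square[of b a "a * d" c, THEN app]
        f_commutator_square[of a b "b * d" c, THEN app]
        f_commutator_square[of a b d c, THEN app]
        f_commutator_square[of "a * b" b d c, THEN app]
        f_commutator_square[of "a + a * b" b d c, THEN app]
        f_rot[of a b d, unfolded rot_def, THEN times_cc, THEN app]
        rot_f_double_shift[of a b c d, THEN app]
        rot_f_shift[of b a c d, THEN app]
        rot_f_shift[of b a c d, THEN times_a, THEN app]
        rot_f_shift[of b a c "a * d", THEN app]
        rot_f_shift[of a b c "b * d", THEN app]
        rot_f_shift[of a b c d, THEN app]
      unfolding square_scaled_def f_linear f_mult f_mult' f_mult_snd fm_distrib rot_linear
      unfolding f_perm(1)[where p = a and q = b and r = c] f_perm(1)[where p = a and q = b and r = d]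
        f_perm(1)[where p = a and q = b and r = "a * d"] fm_anticomm[of b a] fm_distrib rot_linear f_mult
      unfolding rot_def[of _ a b] fm_distrib
      unfolding fm_distrib additive_rules[OF \<phi>] by linarith
  qed
qed

lemma jacobian_like_square_scaled: "jacobian_like (square_scaled c)"
proof
  fix a a' b b' d d'
  show "square_scaled c (a + a') b d = square_scaled c a b d + square_scaled c a' b d"
    "square_scaled c a (b + b') d = square_scaled c a b d + square_scaled c a b' d"
    "square_scaled c a b (d + d') = square_scaled c a b d + square_scaled c a b d'"
    unfolding square_scaled_def by (simp_all add: f_linear fm_distrib rot_linear algebra_simps)
  show "square_scaled c a a b = 0" unfolding square_scaled_def by (simp add: fm_distrib rot_linear)
  show "square_scaled c a b b = 0"
    unfolding square_scaled_def using rot_swap[of "f a b c" c b] by (simp add: fm_distrib f_rot')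
  show "square_scaled c a b (a * d) = square_scaled c a b d * a" by (rule square_scaled_mult)
  show "rot (square_scaled c a b d) a b = 0" by (rule square_scaled_rot)
qed

end

lemma jacobian_like_jac: "jacobian_like (jac :: ('f::field_char_0, 'v) free_malcev \<Rightarrow> _)"
proof
  show "rot (jac a b c) a b = 0" for a b c :: "('f, 'v) free_malcev"
    using rot_jac[of c a b] jac_rotate[of a b c] by simp
qed (simp_all add: jac_add jac_malcev)

lemma jacobian_like_zero: "jacobian_like (\<lambda>a b c. 0 :: ('f::field_char_0, 'v) free_malcev)"
  by unfold_locales (simp_all add: rot_linear fm_distrib)

lemma jacobian_like_add:
  assumes "jacobian_like f" "jacobian_like g"
  shows "jacobian_like (\<lambda>a b c. f a b c + g a b c)"
proof -
  interpret f: jacobian_like f by fact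
  interpret g: jacobian_like g by fact
  show ?thesis
    by unfold_locales
      (simp_all add: f.f_linear g.f_linear f.f_mult g.f_mult f.f_rot g.f_rot fm_distrib rot_linear algebra_simps)
qed

lemma fscale_mult: "fscale k a * b = fscale k (a * b)" "a * fscale k b = fscale k (a * b)"
  for a b :: "('f::field, 'v) free_malcev"
  by (rule free_malcev_mult)+

lemma fscale_rot: "rot (fscale k u) a b = fscale k (rot u a b)"
  for a b u :: "('f::field, 'v) free_malcev"
  by (simp add: rot_def fscale_mult free_malcev.scale_right_distrib free_malcev.scale_right_diff_distrib)

lemma jacobian_like_fscale:
  assumes "jacobian_like f"
  shows "jacobian_like (\<lambda>a b c. fscale k (f a b c))"
proof -
  interpret f: jacobian_like f by fact
  show ?thesis
    by unfold_locales
      (simp_all add: f.f_linear f.f_mult f.f_rot fm_distrib fscale_rot fscale_mult free_malcev.scale_right_distrib)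
qed

lemma (in jacobian_like) f_square_commute: "f a b c * a * a * b = f a b c * b * a * a" (is "?l = ?r")
proof (rule eq_by_functionals)
  fix \<phi> :: "('f, 'v) free_malcev \<Rightarrow> rat" assume \<phi>: "additive \<phi>"
  note app = arg_cong[where f = \<phi>]
  show "\<phi> ?l = \<phi> ?r"
    using rot_anticommutator[of "f a b c" a b, THEN app]
    unfolding f_rot f_rot_mult rot_swap[of _ b a] fm_distrib
    unfolding fm_distrib additive_rules[OF \<phi>] by linarith
qed

text \<open>
  As \<open>f(a,b,c)b = f(a,b,bc)\<close> is again a value with first arguments \<open>a\<close> and \<open>b\<close>, the square of \<open>R\<^sub>a\<close> can
  be moved past one factor \<open>R\<^sub>b\<close> at a time.
\<close>

lemma (in jacobian_like) f_squares_commute: "f a b c * a * a * b * b = f a b c * b * b * a * a"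
  using f_square_commute[of a b c] f_square_commute[of a b "b * c"] by (simp add: f_mult_snd)

section \<open>The operators \<open>L\<close> and \<open>G\<close>\<close>

definition jac_values :: "('f::field_char_0, 'v) free_malcev \<Rightarrow> ('f, 'v) free_malcev \<Rightarrow> ('f, 'v) free_malcev \<Rightarrow>
    ('f, 'v) free_malcev set" where
  "jac_values a b c = {f a b c | f. jacobian_like f}"

lemma jac_values_rotate: "jac_values b c a = jac_values a b c"
  for a b c :: "('f::field_char_0, 'v) free_malcev"
  unfolding jac_values_def using jacobian_like.f_perm(4) by metis

lemma subspace_jac_values: "free_malcev.subspace (jac_values a b c)"
  for a b c :: "('f::field_char_0, 'v) free_malcev"
proof (rule free_malcev.subspaceI)
  show "0 \<in> jac_values a b c" unfolding jac_values_def using jacobian_like_zero by force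
  show "u + v \<in> jac_values a b c" if "u \<in> jac_values a b c" "v \<in> jac_values a b c" for u v
    using that unfolding jac_values_def using jacobian_like_add by fastforce
  show "fscale k u \<in> jac_values a b c" if "u \<in> jac_values a b c" for k u
    using that unfolding jac_values_def using jacobian_like_fscale by fastforce
qed

lemma jac_in_jac_values: "jac a b c \<in> jac_values a b c" for a b c :: "('f::field_char_0, 'v) free_malcev"
  unfolding jac_values_def using jacobian_like_jac by blast

lemma jac_values_cases:
  assumes "t \<in> jac_values x y z"
  obtains f where "jacobian_like f" "t = f x y z"
  using assms unfolding jac_values_def by blast

text \<open>
  By polarization the operators \<open>L\<close> are combinations of squares \<open>R\<^sub>a\<^sup>2\<close> with \<open>a\<close> in this set.  Any
  two distinct elements of it are, up to sign and together with a suitable third element, arguments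
  of \<open>f\<close> yielding the value \<open>f(x,y,z)\<close>, so that the identities for \<open>f(a,b,c)\<close> apply to them.
\<close>

definition axes :: "('f::field_char_0, 'v) free_malcev \<Rightarrow> ('f, 'v) free_malcev \<Rightarrow> ('f, 'v) free_malcev \<Rightarrow>
    ('f, 'v) free_malcev set" where
  "axes x y z = {x, y, z, x + y, x + z, y + z}"

lemma (in jacobian_like) f_two_axes:
  assumes "a \<in> axes x y z" "b \<in> axes x y z" "a \<noteq> b"
  shows "\<exists>c. f x y z = f a b c"
proof -
  note p = f_perm[where p = x and q = y and r = z]
  have "\<exists>c\<in>{x, - x, y, - y, z, - z}. f x y z = f a b c"
    using assms unfolding axes_def by (elim insertE emptyE) (simp_all add: f_linear p)
  then show ?thesis by blast
qed

text \<open>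
  As \<open>f(yz,y,z) = 0\<close>, the elements \<open>x + yz\<close> and \<open>x - yz\<close> may also replace \<open>x\<close>.  Their squares give
  the operator \<open>G\<close>, see \<open>Gfun_shift\<close>.
\<close>

lemma (in jacobian_like) f_axis_shift:
  assumes "a \<in> {y, z, y + z}"
  shows "\<exists>c. f x y z = f (x + y * z) a c" "\<exists>c. f x y z = f (x - y * z) a c"
proof -
  note p = f_perm[where p = x and q = y and r = z] f_perm[where p = "y * z" and q = y and r = z]
  have 0: "f (y * z) y z = 0" using f_mult[of y z z] f_perm(5)[where p = y and q = z and r = "y * z"] by (simp add: fm_distrib)
  have m: "f (p - q) b c = f p b c - f q b c" for p q b c using f_add1[of p "- q" b c] by (simp add: f_minus)
  have "\<exists>c\<in>{z, - y}. f x y z = f (x + y * z) a c" "\<exists>c\<in>{z, - y}. f x y z = f (x - y * z) a c"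
    using assms by (elim insertE emptyE; simp add: f_linear m p 0)+
  then show "\<exists>c. f x y z = f (x + y * z) a c" "\<exists>c. f x y z = f (x - y * z) a c" by blast+
qed

lemma square_commute:
  assumes "t \<in> jac_values x y z" "a \<in> axes x y z" "b \<in> axes x y z"
  shows "t * a * a * b = t * b * a * a"
proof (cases "a = b")
  case False
  from assms(1) obtain f where "jacobian_like f" and t: "t = f x y z" by (rule jac_values_cases)
  then interpret jacobian_like f by simp
  from f_two_axes[OF assms(2,3) False] obtain c where "t = f a b c" unfolding t ..
  then show ?thesis using f_square_commute[of a b c] by simp
qed simp

lemma squares_commute:
  assumes "t \<in> jac_values x y z" "a \<in> axes x y z" "b \<in> axes x y z"
  shows "t * a * a * b * b = t * b * b * a * a"
proof (cases "a = b")
  case False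
  from assms(1) obtain f where "jacobian_like f" and t: "t = f x y z" by (rule jac_values_cases)
  then interpret jacobian_like f by simp
  from f_two_axes[OF assms(2,3) False] obtain c where "t = f a b c" unfolding t ..
  then show ?thesis using f_squares_commute[of a b c] by simp
qed simp

lemma (in jacobian_like) f_rot_mult_opposite: "rot (f a b c * a) b c = 0" (is "?l = ?r")
proof (rule eq_by_functionals)
  fix \<phi> :: "('f, 'v) free_malcev \<Rightarrow> rat" assume \<phi>: "additive \<phi>"
  note app = arg_cong[where f = \<phi>]
  show "\<phi> ?l = \<phi> ?r"
    using rot_f_mult_pair[of a b b c, THEN app]
      rot_f_mult_pair[of b a a c, THEN app]
      rot_f_shift[of a b c b, THEN app]
      rot_product_general[of "f a b c" c a b, THEN app]
    unfolding f_perm[where p = a and q = b and r = c] f_same12 f_same23 fm_distrib rot_linear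
    unfolding f_rot f_rot' f_rot_mult rot_swap[of _ c a] rot_swap[of _ c b] rot_swap[of _ b a] fm_distrib
      rot_linear
    unfolding fm_distrib additive_rules[OF \<phi>] by linarith
qed

lemma rot_jac_values:
  assumes t: "t \<in> jac_values x y z"
  shows "rot t x y = 0" "rot t y z = 0" "rot t x z = 0"
    "rot (t * x) x y = 0" "rot (t * x) y z = 0" "rot (t * x) x z = 0"
    "rot (t * y) x y = 0" "rot (t * y) y z = 0" "rot (t * y) x z = 0"
    "rot (t * z) x y = 0" "rot (t * z) y z = 0" "rot (t * z) x z = 0"
proof -
  from t obtain f where "jacobian_like f" and t_eq: "t = f x y z" by (rule jac_values_cases)
  then interpret jacobian_like f by simp
  have p: "f y z x = f x y z" "f z x y = f x y z"
    by (rule f_perm(4)[where p = x and q = y and r = z] f_perm(5)[where p = x and q = y and r = z])+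
  show "rot t x y = 0" "rot t y z = 0" "rot t x z = 0"
    "rot (t * x) x y = 0" "rot (t * x) y z = 0" "rot (t * x) x z = 0"
    "rot (t * y) x y = 0" "rot (t * y) y z = 0" "rot (t * y) x z = 0"
    "rot (t * z) x y = 0" "rot (t * z) y z = 0" "rot (t * z) x z = 0"
    using f_rot_mult_opposite[of x y z] f_rot_mult_opposite[of y z x] f_rot_mult_opposite[of z x y]
      rot_swap[of "t * y" z x]
    unfolding t_eq p by (simp_all add: f_rot f_rot' f_rot_mult)
qed

lemma fscale_half: "fscale (1/2) (u + u) = u" for u :: "('f::field_char_0, 'v) free_malcev"
  using free_malcev.scale_left_distrib[of "1/2" "1/2" u] by (simp add: free_malcev.scale_right_distrib)

lemma fscale_three: "fscale 3 u = u + u + u" for u :: "('f::field, 'v) free_malcev"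
proof -
  have "fscale (1 + 1 + 1) u = u + u + u" by (simp only: free_malcev.scale_left_distrib free_malcev.scale_one)
  then show ?thesis by simp
qed

text \<open>
  For \<open>c\<close> in \<open>axes\<close> the correction term of \<open>square_scaled\<close> vanishes at \<open>x\<close>, \<open>y\<close>, \<open>z\<close>.
\<close>

lemma square_in_jac_values:
  assumes "t \<in> jac_values x y z" "a \<in> axes x y z"
  shows "t * a * a \<in> jac_values x y z"
proof -
  from assms(1) obtain f where f: "jacobian_like f" and t_eq: "t = f x y z" by (rule jac_values_cases)
  interpret jacobian_like f by (rule f)
  have "rot (f x y a) a z = 0"
    using assms(2) rot_jac_values(2,3)[OF assms(1)] unfolding axes_def t_eq by (auto simp: f_linear rot_linear)
  then have "jacobian_like.square_scaled f a x y z = fscale 3 (t * a * a)"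
    by (simp add: square_scaled_def t_eq fscale_three)
  then have "fscale 3 (t * a * a) \<in> jac_values x y z"
    unfolding jac_values_def using jacobian_like_square_scaled[of a] by (metis (mono_tags, lifting)
      mem_Collect_eq)
  then have "fscale (1/3) (fscale 3 (t * a * a)) \<in> jac_values x y z"
    by (rule free_malcev.subspace_scale[OF subspace_jac_values])
  then show ?thesis by simp
qed

lemma Lop_squares:
  "Lop a b t = fscale (1/2) (t * (a + b) * (a + b) - t * a * a - t * b * b)"
  "Lop a a t = t * a * a"
  for a b t :: "('f::field_char_0, 'v) free_malcev"
  using free_malcev.scale_left_distrib[of "1/2" "1/2" "t * a * a"]
  by (simp_all add: Lop_def fm_distrib free_malcev.scale_right_distrib algebra_simps)

lemma sum_in_axes: "a \<in> {x, y, z} \<Longrightarrow> a \<in> axes x y z" "a \<in> {x, y, z} \<Longrightarrow> b \<in> {x, y, z} \<Longrightarrow> a \<noteq> b \<Longrightarrow> a + b \<in> axes x y z"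
  for x y z :: "('f::field_char_0, 'v) free_malcev"
  unfolding axes_def by (auto simp: add.commute)

lemma Lop_commute_mult:
  assumes "t \<in> jac_values x y z" "a \<in> {x, y, z}" "b \<in> {x, y, z}" "c \<in> {x, y, z}"
  shows "Lop a b t * c = Lop a b (t * c)"
proof (cases "a = b")
  case True
  then show ?thesis using square_commute[OF assms(1) sum_in_axes(1)[OF assms(2)] sum_in_axes(1)[OF assms(4)]]
    by (simp add: Lop_squares(2))
next
  case False
  note q = sum_in_axes(2)[OF assms(2,3) False] sum_in_axes(1)[OF assms(2)] sum_in_axes(1)[OF assms(3)] sum_in_axes(1)[OF assms(4)]
  show ?thesis
    unfolding Lop_squares(1) fscale_mult fm_distrib(7)
    using q square_commute[OF assms(1) q(1,4)] square_commute[OF assms(1) q(2,4)] square_commute[OF assms(1) q(3,4)] by simp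
qed

lemma Lop_in_jac_values:
  assumes "t \<in> jac_values x y z" "a \<in> {x, y, z}" "b \<in> {x, y, z}"
  shows "Lop a b t \<in> jac_values x y z"
proof (cases "a = b")
  case True
  then show ?thesis using square_in_jac_values[OF assms(1) sum_in_axes(1)[OF assms(2)]] by (simp add: Lop_squares(2))
next
  case False
  show ?thesis unfolding Lop_squares(1)
    using square_in_jac_values[OF assms(1)] sum_in_axes(2)[OF assms(2,3) False] sum_in_axes(1)[OF assms(2)] sum_in_axes(1)[OF assms(3)]
    by (intro free_malcev.subspace_scale free_malcev.subspace_diff subspace_jac_values)
qed

lemma Lop_linear: "Lop a b (s + t) = Lop a b s + Lop a b t" "Lop a b (s - t) = Lop a b s - Lop a b t"
    "Lop a b (fscale k t) = fscale k (Lop a b t)"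
  for a b t :: "('f::field_char_0, 'v) free_malcev"
  by (simp_all add: Lop_def fm_distrib fscale_mult free_malcev.scale_right_distrib free_malcev.scale_right_diff_distrib
    mult.commute algebra_simps)

lemma Lop_square_commute:
  assumes "t \<in> jac_values x y z" "a \<in> {x, y, z}" "b \<in> {x, y, z}" "c \<in> axes x y z"
  shows "Lop a b t * c * c = Lop a b (t * c * c)"
proof (cases "a = b")
  case True
  then show ?thesis using squares_commute[OF assms(1) sum_in_axes(1)[OF assms(2)] assms(4)]
    by (simp add: Lop_squares(2))
next
  case False
  note q = sum_in_axes(2)[OF assms(2,3) False] sum_in_axes(1)[OF assms(2)] sum_in_axes(1)[OF assms(3)]
  show ?thesis
    unfolding Lop_squares(1) fscale_mult fm_distrib(7)
    using squares_commute[OF assms(1) q(1) assms(4)] squares_commute[OF assms(1) q(2) assms(4)]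
      squares_commute[OF assms(1) q(3) assms(4)] by simp
qed

lemma Lop_commute:
  assumes "t \<in> jac_values x y z" "a \<in> {x, y, z}" "b \<in> {x, y, z}" "c \<in> {x, y, z}" "d \<in> {x, y, z}"
  shows "Lop a b (Lop c d t) = Lop c d (Lop a b t)"
proof (cases "c = d")
  case True
  then show ?thesis using Lop_square_commute[OF assms(1-3) sum_in_axes(1)[OF assms(4)]] by (simp add: Lop_squares(2))
next
  case False
  note q = sum_in_axes(2)[OF assms(4,5) False] sum_in_axes(1)[OF assms(4)] sum_in_axes(1)[OF assms(5)]
  show ?thesis
    unfolding Lop_squares(1)[of c d] Lop_linear
    using Lop_square_commute[OF assms(1-3)] q by simp
qed

lemma mult_jac_zero:
  fixes t :: "('f::field_char_0, 'v) free_malcev"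
  assumes "t \<in> jac_values x y z"
  shows "t * jac x y z = 0" (is "?l = ?r")
proof (rule eq_by_functionals)
  fix \<phi> :: "('f, 'v) free_malcev \<Rightarrow> rat" assume \<phi>: "additive \<phi>"
  note app = arg_cong[where f = \<phi>]
  show "\<phi> ?l = \<phi> ?r"
    using mult_jac_rot[of t x y z, THEN app]
    unfolding rot_swap[of _ z x] rot_jac_values[OF assms] fm_distrib
    unfolding fm_distrib additive_rules[OF \<phi>] by linarith
qed

lemma mult_product_jac_values:
  assumes "t \<in> jac_values x y z" "(a, b) \<in> {(x, y), (y, z), (x, z)}" "s \<in> {t, t * x, t * y, t * z}"
  shows "s * (a * b) + s * (a * b) = s * b * a - s * a * b"
proof -
  have "rot s a b = 0" using rot_jac_values[OF assms(1)] assms(2,3) by auto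
  then show ?thesis unfolding rot_def by (simp add: algebra_simps)
qed

lemma square_pair_commute:
  assumes "t \<in> jac_values x y z" "a \<in> {x, y, z}" "b \<in> {x, y, z}" "c \<in> {x, y, z}"
  shows "t * a * b * c + t * b * a * c = t * c * a * b + t * c * b * a"
proof -
  have "fscale 2 (Lop a b t * c) = fscale 2 (Lop a b (t * c))" using Lop_commute_mult[OF assms] by simp
  then show ?thesis by (simp add: Lop_def fscale_mult fm_distrib)
qed

text \<open>
  On these values \<open>G\<close> is the alternating sum of the six words in \<open>R\<^sub>x\<close>, \<open>R\<^sub>y\<close>, \<open>R\<^sub>z\<close>; this explains
  its invariance under rotation of the generators and lets \<open>uxyz\<close> be expressed by \<open>uG\<close> and the \<open>L\<close>.
\<close>

lemma Gfun_jac_values: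
  fixes t :: "('f::field_char_0, 'v) free_malcev"
  assumes t: "t \<in> jac_values x y z"
  shows "Gfun t x y z = (t * x * y * z + t * y * z * x + t * z * x * y) - (t * y * x * z + t * x * z * y + t * z * y * x)"
   (is "?l = ?r")
proof -
  have 1: "t * (y * z) + t * (y * z) = t * z * y - t * y * z"
    "t * x * (y * z) + t * x * (y * z) = t * x * z * y - t * x * y * z"
    using mult_product_jac_values[OF t, of y z] by simp_all
  have 2: "t * x * y * z + t * y * x * z = t * z * x * y + t * z * y * x"
    "t * x * z * y + t * z * x * y = t * y * x * z + t * y * z * x"
    "t * y * z * x + t * z * y * x = t * x * y * z + t * x * z * y"
    by (rule square_pair_commute[OF t]; simp)+
  show ?thesis
  proof (rule eq_by_functionals)
    fix \<phi> :: "('f, 'v) free_malcev \<Rightarrow> rat" assume \<phi>: "additive \<phi>"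
    note app = arg_cong[where f = \<phi>]
    show "\<phi> ?l = \<phi> ?r"
      using 2(1)[THEN app]
        2(2)[THEN app]
        2(3)[THEN app]
        fm_anticomm[of "jac x y z" t, THEN app]
        mult_jac_zero[OF t, THEN app]
        fm_anticomm[of x "jac t y z", THEN app]
        1(1)[THEN arg_cong[where f = "\<lambda>t. t * x"], THEN app]
        1(2)[THEN app]
      unfolding Gfun_def
      unfolding jac_op[of t] jac_op[of "t * x"]
      unfolding fm_distrib additive_rules[OF \<phi>] by linarith
  qed
qed

lemma Gfun_rotate: "t \<in> jac_values x y z \<Longrightarrow> Gfun t y z x = Gfun t x y z"
  using Gfun_jac_values[of t x y z] Gfun_jac_values[of t y z x] by (simp add: jac_values_rotate add_ac)

text \<open>
  Here \<open>tG = -6 t L\<close> with \<open>L\<close> formed for \<open>x\<close> and \<open>yz\<close>, and this \<open>L\<close> is a difference of two squares.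
  Thus \<open>G\<close> is handled in the same way as the other operators.
\<close>

lemma Gfun_shift:
  fixes t :: "('f::field_char_0, 'v) free_malcev"
  assumes t: "t \<in> jac_values x y z"
  shows "Gfun t x y z = fscale (- 3 / 2) (t * (x + y * z) * (x + y * z) - t * (x - y * z) * (x - y * z))"
proof -
  let ?D = "t * (x + y * z) * (x + y * z) - t * (x - y * z) * (x - y * z)"
  have 1: "t * (y * z) + t * (y * z) = t * z * y - t * y * z"
    "t * x * (y * z) + t * x * (y * z) = t * x * z * y - t * x * y * z"
    using mult_product_jac_values[OF t, of y z] by simp_all
  have 2: "t * x * y * z + t * y * x * z = t * z * x * y + t * z * y * x"
    "t * x * z * y + t * z * x * y = t * y * x * z + t * y * z * x"
    "t * y * z * x + t * z * y * x = t * x * y * z + t * x * z * y"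
    by (rule square_pair_commute[OF t]; simp)+
  have "Gfun t x y z + Gfun t x y z = - fscale 3 ?D" (is "?l = ?r")
  proof (rule eq_by_functionals)
    fix \<phi> :: "('f, 'v) free_malcev \<Rightarrow> rat" assume \<phi>: "additive \<phi>"
    note app = arg_cong[where f = \<phi>]
    show "\<phi> ?l = \<phi> ?r"
      using Gfun_jac_values[OF t, THEN app]
        1(1)[THEN arg_cong[where f = "\<lambda>t. t * x"], THEN app]
        1(2)[THEN app]
        2(1)[THEN app]
        2(2)[THEN app]
        2(3)[THEN app]
      unfolding fscale_three
      unfolding fm_distrib additive_rules[OF \<phi>] by linarith
  qed
  then have "fscale (1/2) (Gfun t x y z + Gfun t x y z) = fscale (1/2) (- fscale 3 ?D)" by simp
  then show ?thesis unfolding fscale_half by simp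
qed

lemma shift_square_in_jac_values:
  assumes "t \<in> jac_values x y z" "p = x + y * z \<or> p = x - y * z"
  shows "t * p * p \<in> jac_values x y z"
proof -
  have "t \<in> jac_values y z x" using assms(1) by (simp add: jac_values_rotate)
  then obtain f where f: "jacobian_like f" and t_eq: "t = f y z x" by (rule jac_values_cases)
  interpret jacobian_like f by (rule f)
  have m: "f b c (p - q) = f b c p - f b c q" for p q b c using f_add3[of b c p "- q"] by (simp add: f_minus)
  have 0: "f y z (y * z) = 0" using f_mult[of y z z] by (simp add: fm_distrib)
  have "rot (f y z x) x (y * z) = 0"
    using rot_f_shift[of y z x z] f_rot_mult(2)[of y z x] rot_jac_values(9)[OF assms(1)] unfolding t_eq by simp
  then have "rot (f y z p) p x = 0"
    using assms(2) rot_swap[of "f y z x" x "y * z"] by (auto simp: f_linear m 0 rot_linear)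
  then have "jacobian_like.square_scaled f p y z x = fscale 3 (t * p * p)"
    by (simp add: square_scaled_def t_eq fscale_three)
  then have "fscale 3 (t * p * p) \<in> jac_values y z x"
    unfolding jac_values_def using jacobian_like_square_scaled[of p] by (metis (mono_tags, lifting)
      mem_Collect_eq)
  then have "fscale (1/3) (fscale 3 (t * p * p)) \<in> jac_values y z x"
    by (rule free_malcev.subspace_scale[OF subspace_jac_values])
  then show ?thesis by (simp add: jac_values_rotate)
qed

lemma shift_squares_commute:
  assumes "t \<in> jac_values x y z" "p = x + y * z \<or> p = x - y * z" "a \<in> {y, z, y + z}"
  shows "t * p * p * a * a = t * a * a * p * p"
proof -
  from assms(1) obtain f where "jacobian_like f" and t: "t = f x y z" by (rule jac_values_cases)
  then interpret jacobian_like f by simp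
  obtain c where "t = f p a c" using f_axis_shift[OF assms(3), of x] assms(2) unfolding t by blast
  then show ?thesis using f_squares_commute[of p a c] by simp
qed

lemma Gfun_in_jac_values:
  assumes "t \<in> jac_values x y z"
  shows "Gfun t x y z \<in> jac_values x y z"
  unfolding Gfun_shift[OF assms] using shift_square_in_jac_values[OF assms]
  by (intro free_malcev.subspace_scale free_malcev.subspace_diff subspace_jac_values) auto

lemma Gfun_linear: "Gfun (s + t) x y z = Gfun s x y z + Gfun t x y z" "Gfun (s - t) x y z = Gfun s x y z - Gfun t x y z"
    "Gfun (fscale k t) x y z = fscale k (Gfun t x y z)"
  for s t x y z :: "('f::field_char_0, 'v) free_malcev"
  by (simp_all add: Gfun_def jac_op fm_distrib fscale_mult free_malcev.scale_right_distrib free_malcev.scale_right_diff_distrib algebra_simps)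

text \<open>
  \<open>Gfun_shift\<close> favours the generator \<open>x\<close> and only covers axes in the plane of \<open>y\<close> and \<open>z\<close>; the
  others are reached by rotating the generators.
\<close>

lemma Gfun_square_commute:
  assumes t: "t \<in> jac_values x y z" and a: "a \<in> axes x y z"
  shows "Gfun (t * a * a) x y z = Gfun t x y z * a * a"
proof -
  have *: "Gfun (t * a * a) x y z = Gfun t x y z * a * a"
    if t: "t \<in> jac_values x y z" and a: "a \<in> {y, z, y + z}" for x y z t
  proof -
    have "t * a * a \<in> jac_values x y z"
      using square_in_jac_values[OF t, of a] a by (auto simp: axes_def)
    then show ?thesis
      unfolding Gfun_shift[OF t] Gfun_shift[OF \<open>t * a * a \<in> _\<close>] fscale_mult fm_distrib(7)
      using shift_squares_commute[OF t _ a] by simp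
  qed
  have s: "t * a * a \<in> jac_values x y z" by (rule square_in_jac_values[OF assms])
  have r: "Gfun u y z x = Gfun u x y z" "Gfun u z x y = Gfun u x y z" if "u \<in> jac_values x y z" for u
    using Gfun_rotate[of u x y z] Gfun_rotate[of u y z x] that by (simp_all add: jac_values_rotate)
  consider "a \<in> {y, z, y + z}" | "a \<in> {z, x, z + x}" | "a \<in> {x, y, x + y}"
    using a by (auto simp: axes_def add.commute)
  then show ?thesis
  proof cases
    case 1
    then show ?thesis by (rule *[OF t])
  next
    case 2
    then have "Gfun (t * a * a) y z x = Gfun t y z x * a * a" using *[of t y z x] t by (simp add: jac_values_rotate)
    then show ?thesis using r(1)[OF t] r(1)[OF s] by simp
  next
    case 3
    then have "Gfun (t * a * a) z x y = Gfun t z x y * a * a" using *[of t z x y] t by (simp add: jac_values_rotate)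
    then show ?thesis using r(2)[OF t] r(2)[OF s] by simp
  qed
qed

lemma Gfun_Lop_commute:
  assumes "t \<in> jac_values x y z" "a \<in> {x, y, z}" "b \<in> {x, y, z}"
  shows "Gfun (Lop a b t) x y z = Lop a b (Gfun t x y z)"
proof (cases "a = b")
  case True
  then show ?thesis using Gfun_square_commute[OF assms(1) sum_in_axes(1)[OF assms(2)]] by (simp add: Lop_squares(2))
next
  case False
  show ?thesis
    unfolding Lop_squares(1)[of a b] Gfun_linear
    using Gfun_square_commute[OF assms(1)] sum_in_axes(2)[OF assms(2,3) False] sum_in_axes(1)[OF assms(2)] sum_in_axes(1)[OF assms(3)] by simp
qed

section \<open>The ideal generated by the Jacobians\<close>

lemma jac_perm: "jac q p r = - jac p q r" "jac p r q = - jac p q r" "jac r q p = - jac p q r"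
  "jac q r p = jac p q r" "jac r p q = jac p q r"
  for p q r :: "('f::field_char_0, 'v) free_malcev"
  by (rule jacobian_like.f_perm[OF jacobian_like_jac])+

lemma jac_minus: "jac (- a) b c = - jac a b c" "jac a (- b) c = - jac a b c" "jac a b (- c) = - jac a b c"
  for a b c :: "('f::field_char_0, 'v) free_malcev"
  by (rule jacobian_like.f_minus[OF jacobian_like_jac])+

lemma jac_product_pair: "jac (w * x) y z + jac (y * z) w x = w * x * y * z - w * x * z * y + y * z * w * x - y * z * x * w"
  for w x y z :: "('f::field, 'v) free_malcev"
  unfolding jac_op using fm_anticomm[of "y * z" "w * x"] by simp

text \<open>
  Sagle's identity.  It shows that an ideal containing the Jacobians of the generators contains all
  Jacobians.
\<close>

lemma jac_product:
  fixes w x y z :: "('f::field_char_0, 'v) free_malcev"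
  shows "jac (w * x) y z + jac (w * x) y z + jac (w * x) y z =
    jac x y z * w - jac y z w * x - (jac z w x * y + jac z w x * y) + (jac w x y * z + jac w x y * z)"
  (is "?l = ?r")
proof (rule eq_by_functionals)
  fix \<phi> :: "('f, 'v) free_malcev \<Rightarrow> rat" assume \<phi>: "additive \<phi>"
  note app = arg_cong[where f = \<phi>]
  show "\<phi> ?l = \<phi> ?r"
    using jac_product_pair[of w x y z, THEN app]
      jac_product_pair[of w y z x, THEN app]
      jac_product_pair[of w z x y, THEN app]
      jac_malcev_linear[of y w z x, THEN app]
      jac_malcev_linear[of x w z y, THEN app]
      jac_malcev_linear[of x w y z, THEN app]
      jac_malcev_linear[of y x z w, THEN app]
      jac_malcev_linear[of w x z y, THEN app]
      jac_malcev_linear[of w x y z, THEN app]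
      jac_malcev_linear[of x y z w, THEN app]
      jac_malcev_linear[of w y z x, THEN app]
      jac_malcev_linear[of w y x z, THEN app]
      jac_malcev_linear[of x z y w, THEN app]
      jac_malcev_linear[of w z y x, THEN app]
      jac_malcev_linear[of w z x y, THEN app]
      arg_cong[OF jac_def[of x y z], of "\<lambda>t. t * w", THEN app]
      arg_cong[OF jac_def[of y z w], of "\<lambda>t. t * x", THEN app]
      arg_cong[OF jac_def[of z w x], of "\<lambda>t. t * y", THEN app]
      arg_cong[OF jac_def[of w x y], of "\<lambda>t. t * z", THEN app]
    unfolding fm_anticomm[of x w] fm_anticomm[of y w] fm_anticomm[of z w] fm_anticomm[of y x]
      fm_anticomm[of z x] fm_anticomm[of z y] fm_distrib jac_minus
    unfolding jac_perm[where p = w and q = x and r = y] jac_perm[where p = w and q = x and r = z]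
      jac_perm[where p = w and q = y and r = z] jac_perm[where p = x and q = y and r = z]
      jac_perm[where p = "w * x" and q = y and r = z] jac_perm[where p = "w * y" and q = x and r = z]
      jac_perm[where p = "w * z" and q = x and r = y] jac_perm[where p = "x * y" and q = w and r = z]
      jac_perm[where p = "x * z" and q = w and r = y] jac_perm[where p = "y * z" and q = w and r = x]
      fm_distrib
    unfolding fm_distrib additive_rules[OF \<phi>] by linarith
qed

text \<open>
  Five instances of Sagle's identity can be solved for a product of a Jacobian, so the span of the
  Jacobians is an ideal whatever the number of generators.
\<close>

lemma jac_mult_in_span:
  fixes w x y z :: "('f::field_char_0, 'v) free_malcev"
  shows "jac y z w * x + jac y z w * x =
    - (jac (w * x) y z + jac (w * y) x z + jac (x * y) z w + jac (z * w) x y + jac (z * w) x y)"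
  (is "?l = ?r")
proof (rule eq_by_functionals)
  fix \<phi> :: "('f, 'v) free_malcev \<Rightarrow> rat" assume \<phi>: "additive \<phi>"
  note app = arg_cong[where f = \<phi>]
  show "\<phi> ?l = \<phi> ?r"
    using jac_product[of w x y z, THEN app]
      jac_product[of x y z w, THEN app]
      jac_product[of y z w x, THEN app]
      jac_product[of z w x y, THEN app]
      jac_product[of w y x z, THEN app]
    unfolding fm_anticomm[of x w] fm_anticomm[of y w] fm_anticomm[of z w] fm_anticomm[of y x]
      fm_anticomm[of z x] fm_anticomm[of z y] fm_distrib jac_minus
    unfolding jac_perm[where p = w and q = x and r = y] jac_perm[where p = w and q = x and r = z]
      jac_perm[where p = w and q = y and r = z] jac_perm[where p = x and q = y and r = z]
      jac_perm[where p = "w * x" and q = y and r = z] jac_perm[where p = "w * y" and q = x and r = z]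
      jac_perm[where p = "w * z" and q = x and r = y] jac_perm[where p = "x * y" and q = w and r = z]
      jac_perm[where p = "x * z" and q = w and r = y] jac_perm[where p = "y * z" and q = w and r = x]
      fm_distrib
    unfolding fm_distrib additive_rules[OF \<phi>] by linarith
qed

lemma JMMM_subspace: "free_malcev.subspace (JMMM :: ('f::field, 'v) free_malcev set)"
  unfolding JMMM_def by (rule free_malcev.subspace_span)

lemma jac_in_JMMM: "jac a b c \<in> JMMM" for a b c :: "('f::field, 'v) free_malcev"
  unfolding JMMM_def by (rule free_malcev.span_base) blast

lemma JMMM_mult:
  fixes v w :: "('f::field_char_0, 'v) free_malcev"
  assumes "v \<in> JMMM" shows "v * w \<in> JMMM" "w * v \<in> JMMM"
proof -
  have "jac a b c * w \<in> JMMM" for a b c :: "('f, 'v) free_malcev"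
  proof -
    have "jac a b c * w + jac a b c * w \<in> JMMM"
      unfolding jac_mult_in_span by (intro free_malcev.subspace_add free_malcev.subspace_neg JMMM_subspace
        jac_in_JMMM)
    from free_malcev.subspace_scale[OF JMMM_subspace this, of "1/2"] show ?thesis by (simp add: fscale_half)
  qed
  moreover have "free_malcev.subspace {v. v * w \<in> JMMM}"
    by (rule free_malcev.subspaceI)
      (simp_all add: fm_distrib fscale_mult free_malcev.subspace_0 free_malcev.subspace_add free_malcev.subspace_scale JMMM_subspace)
  ultimately have "JMMM \<subseteq> {v. v * w \<in> JMMM}"
    unfolding JMMM_def by (intro free_malcev.span_minimal) auto
  then show "v * w \<in> JMMM" using assms by blast
  then show "w * v \<in> JMMM" unfolding fm_anticomm[of w v] by (rule free_malcev.subspace_neg[OF JMMM_subspace])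
qed

text \<open>
  Exponents are given by a function, so that applying one more operator is a function update and
  the elements of \<open>U\<close> are indexed by exponent vectors.
\<close>

primrec iterates :: "('a \<Rightarrow> 'a) list \<Rightarrow> (nat \<Rightarrow> nat) \<Rightarrow> 'a \<Rightarrow> 'a" where
  "iterates [] e t = t"
| "iterates (F # Fs) e t = iterates Fs (\<lambda>i. e (Suc i)) ((F ^^ e 0) t)"

lemma funpow_invariant: "(\<And>t. t \<in> S \<Longrightarrow> F t \<in> S) \<Longrightarrow> t \<in> S \<Longrightarrow> (F ^^ n) t \<in> S"
  by (induction n) auto

lemma funpow_commute_on:
  assumes "\<And>t. t \<in> S \<Longrightarrow> F t \<in> S" "\<And>t. t \<in> S \<Longrightarrow> H (F t) = F (H t)" "t \<in> S"
  shows "H ((F ^^ n) t) = (F ^^ n) (H t)"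
  by (induction n) (simp_all add: assms funpow_invariant[OF assms(1)])

lemma iterates_invariant: "(\<And>F t. F \<in> set Fs \<Longrightarrow> t \<in> S \<Longrightarrow> F t \<in> S) \<Longrightarrow> t \<in> S \<Longrightarrow> iterates Fs e t \<in> S"
  by (induction Fs arbitrary: e t) (simp_all add: funpow_invariant)

lemma iterates_commute:
  assumes "\<And>F t. F \<in> set Fs \<Longrightarrow> t \<in> S \<Longrightarrow> F t \<in> S"
    and "\<And>F t. F \<in> set Fs \<Longrightarrow> t \<in> S \<Longrightarrow> H (F t) = F (H t)" and "t \<in> S"
  shows "H (iterates Fs e t) = iterates Fs e (H t)"
  using assms
proof (induction Fs arbitrary: e t)
  case (Cons F Fs)
  have "H ((F ^^ e 0) t) = (F ^^ e 0) (H t)" using Cons.prems by (intro funpow_commute_on[where S = S]) auto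
  moreover have "(F ^^ e 0) t \<in> S" using Cons.prems by (intro funpow_invariant) auto
  ultimately show ?case using Cons.IH[of "(F ^^ e 0) t"] Cons.prems(1,2) by simp
qed simp

lemma iterates_step:
  assumes "\<And>F t. F \<in> set Fs \<Longrightarrow> t \<in> S \<Longrightarrow> F t \<in> S"
    and "\<And>F H t. F \<in> set Fs \<Longrightarrow> H \<in> set Fs \<Longrightarrow> t \<in> S \<Longrightarrow> H (F t) = F (H t)"
    and "t \<in> S" "i < length Fs"
  shows "(Fs ! i) (iterates Fs e t) = iterates Fs (e(i := Suc (e i))) t"
  using assms
proof (induction Fs arbitrary: e t i)
  case (Cons F Fs)
  have S: "(F ^^ n) t \<in> S" for n using Cons.prems by (intro funpow_invariant) auto
  show ?case
  proof (cases i)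
    case 0
    have "F (iterates Fs (\<lambda>i. e (Suc i)) ((F ^^ e 0) t)) = iterates Fs (\<lambda>i. e (Suc i)) (F ((F ^^ e 0) t))"
      using Cons.prems S by (intro iterates_commute[where S = S]) auto
    then show ?thesis using 0 by simp
  next
    case (Suc k)
    have "(Fs ! k) (iterates Fs (\<lambda>i. e (Suc i)) ((F ^^ e 0) t)) =
        iterates Fs ((\<lambda>i. e (Suc i))(k := Suc (e (Suc k)))) ((F ^^ e 0) t)"
      using Cons.prems Suc S by (intro Cons.IH) auto
    moreover have "(\<lambda>i. e (Suc i))(k := Suc (e (Suc k))) = (\<lambda>i. (e(Suc k := Suc (e (Suc k)))) (Suc i))"
      by auto
    ultimately show ?thesis using Suc by simp
  qed
qed simp

definition central_ops :: "('f::field_char_0, 'v) free_malcev \<Rightarrow> ('f, 'v) free_malcev \<Rightarrow> ('f, 'v) free_malcev \<Rightarrow>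
    (('f, 'v) free_malcev \<Rightarrow> ('f, 'v) free_malcev) list" where
  "central_ops x y z = [\<lambda>t. Gfun t x y z, Lop x x, Lop y y, Lop z z, Lop x y, Lop x z, Lop y z]"

lemma U_set_eq: "U_set x y z = range (\<lambda>e. iterates (central_ops x y z) e (jac x y z))"
  for x y z :: "('f::field_char_0, 'v) free_malcev"
proof -
  have "iterates (central_ops x y z) e (jac x y z) \<in> U_set x y z" for e
    unfolding U_set_def central_ops_def by (simp add: numeral_eq_Suc) blast
  moreover have "\<exists>e. u = iterates (central_ops x y z) e (jac x y z)" if u: "u \<in> U_set x y z" for u
  proof -
    from u obtain k l m n p q r where "u = (Lop y z ^^ r) ((Lop x z ^^ q) ((Lop x y ^^ p)
        ((Lop z z ^^ n) ((Lop y y ^^ m) ((Lop x x ^^ l)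
          (((\<lambda>t. Gfun t x y z) ^^ k) (jac x y z)))))))" unfolding U_set_def by blast
    then have "u = iterates (central_ops x y z) (\<lambda>i. [k, l, m, n, p, q, r] ! i) (jac x y z)"
      unfolding central_ops_def by (simp add: numeral_eq_Suc)
    then show ?thesis by blast
  qed
  ultimately show ?thesis by blast
qed

lemma central_ops_props:
  assumes "t \<in> jac_values x y z" "F \<in> set (central_ops x y z)" "H \<in> set (central_ops x y z)"
  shows "F t \<in> jac_values x y z" "H (F t) = F (H t)"
proof -
  have r: "F \<in> {\<lambda>t. Gfun t x y z} \<union> {Lop a b | a b. a \<in> {x, y, z} \<and> b \<in> {x, y, z}}" if "F \<in> set (central_ops x y z)" for F
    using that unfolding central_ops_def by auto
  show "F t \<in> jac_values x y z"
    using r[OF assms(2)] Gfun_in_jac_values[OF assms(1)] Lop_in_jac_values[OF assms(1)] by auto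
  show "H (F t) = F (H t)"
    using r[OF assms(2)] r[OF assms(3)]
  proof (elim UnE)
    assume "F \<in> {Lop a b | a b. a \<in> {x, y, z} \<and> b \<in> {x, y, z}}" "H \<in> {Lop a b | a b. a \<in> {x, y, z} \<and> b \<in> {x, y, z}}"
    then show ?thesis using Lop_commute[OF assms(1)] by blast
  next
    assume "F \<in> {Lop a b | a b. a \<in> {x, y, z} \<and> b \<in> {x, y, z}}" "H \<in> {\<lambda>t. Gfun t x y z}"
    then show ?thesis using Gfun_Lop_commute[OF assms(1)] by blast
  next
    assume "F \<in> {\<lambda>t. Gfun t x y z}" "H \<in> {Lop a b | a b. a \<in> {x, y, z} \<and> b \<in> {x, y, z}}"
    then show ?thesis using Gfun_Lop_commute[OF assms(1), symmetric] by blast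
  qed simp
qed

lemma U_set_props:
  fixes x y z :: "('f::field_char_0, 'v) free_malcev"
  assumes "u \<in> U_set x y z"
  shows "u \<in> jac_values x y z" "Gfun u x y z \<in> U_set x y z"
    "Lop x x u \<in> U_set x y z" "Lop y y u \<in> U_set x y z" "Lop z z u \<in> U_set x y z"
    "Lop x y u \<in> U_set x y z" "Lop x z u \<in> U_set x y z" "Lop y z u \<in> U_set x y z"
proof -
  from assms obtain e where u: "u = iterates (central_ops x y z) e (jac x y z)" unfolding U_set_eq by blast
  show "u \<in> jac_values x y z" unfolding u
    by (rule iterates_invariant) (simp_all add: central_ops_props jac_in_jac_values)
  have "(central_ops x y z ! i) u \<in> U_set x y z" if "i < length (central_ops x y z)" for i
    unfolding u using iterates_step[of "central_ops x y z" "jac_values x y z" "jac x y z" i e] that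
    by (simp add: central_ops_props jac_in_jac_values U_set_eq)
  from this[of 0] this[of 1] this[of 2] this[of 3] this[of 4] this[of 5] this[of 6]
  show "Gfun u x y z \<in> U_set x y z"
    "Lop x x u \<in> U_set x y z" "Lop y y u \<in> U_set x y z" "Lop z z u \<in> U_set x y z"
    "Lop x y u \<in> U_set x y z" "Lop x z u \<in> U_set x y z" "Lop y z u \<in> U_set x y z"
    unfolding central_ops_def by simp_all
qed

definition spanning_set :: "('f::field_char_0, 'v) free_malcev \<Rightarrow> ('f, 'v) free_malcev \<Rightarrow> ('f, 'v) free_malcev \<Rightarrow>
    ('f, 'v) free_malcev set" where
  "spanning_set x y z = U_set x y z \<union> (\<lambda>u. u * x) ` U_set x y z \<union> (\<lambda>u. u * y) ` U_set x y z \<union> (\<lambda>u. u * z) ` U_set x y z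
     \<union> (\<lambda>u. (u * x) * y) ` U_set x y z \<union> (\<lambda>u. (u * x) * z) ` U_set x y z \<union> (\<lambda>u. (u * y) * z) ` U_set x y z"

text \<open>
  A rewriting system: every word in \<open>x\<close>, \<open>y\<close>, \<open>z\<close> of length two or three that does not appear in
  the basis reduces to a combination of basis words applied to other elements of \<open>U\<close>.
\<close>

lemma U_set_words:
  fixes x y z :: "('f::field_char_0, 'v) free_malcev"
  assumes u: "u \<in> U_set x y z"
  shows "u * x * x = Lop x x u" "u * y * y = Lop y y u" "u * z * z = Lop z z u"
    "u * y * x = fscale 2 (Lop x y u) - u * x * y" "u * z * x = fscale 2 (Lop x z u) - u * x * z"
    "u * z * y = fscale 2 (Lop y z u) - u * y * z"
    "u * x * y * x = fscale 2 (Lop x y u * x) - Lop x x u * y"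
    "u * x * y * y = Lop y y u * x"
    "u * x * y * z = fscale (1/6) (Gfun u x y z) + Lop x y u * z - Lop x z u * y + Lop y z u * x"
    "u * x * z * x = fscale 2 (Lop x z u * x) - Lop x x u * z"
    "u * x * z * y = fscale 2 (Lop y z u * x) - u * x * y * z"
    "u * x * z * z = Lop z z u * x"
    "u * y * z * x = fscale 2 (Lop x z u * y) - fscale 2 (Lop x y u * z) + u * x * y * z"
    "u * y * z * y = fscale 2 (Lop y z u * y) - Lop y y u * z"
    "u * y * z * z = Lop z z u * y"
proof -
  have t: "u \<in> jac_values x y z" by (rule U_set_props[OF u])
  have L2: "fscale 2 (Lop a b u) = u * a * b + u * b * a" for a b by (simp add: Lop_def)
  have L2m: "fscale 2 (Lop a b u * c) = u * a * b * c + u * b * a * c" for a b c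
    unfolding fscale_mult[symmetric] L2 fm_distrib ..
  have c: "u * a * b * c + u * b * a * c = u * c * a * b + u * c * b * a"
    if "a \<in> {x, y, z}" "b \<in> {x, y, z}" "c \<in> {x, y, z}" for a b c
    by (rule square_pair_commute[OF t that])
  have s: "u * a * a * b = u * b * a * a" if "a \<in> {x, y, z}" "b \<in> {x, y, z}" for a b
    by (rule square_commute[OF t]) (use that in \<open>auto simp: axes_def\<close>)
  show "u * x * x = Lop x x u" "u * y * y = Lop y y u" "u * z * z = Lop z z u"
    by (simp_all add: Lop_squares(2))
  show "u * y * x = fscale 2 (Lop x y u) - u * x * y" "u * z * x = fscale 2 (Lop x z u) - u * x * z"
    "u * z * y = fscale 2 (Lop y z u) - u * y * z"
    unfolding L2 by simp_all
  show "u * x * y * x = fscale 2 (Lop x y u * x) - Lop x x u * y"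
    "u * x * z * x = fscale 2 (Lop x z u * x) - Lop x x u * z"
    "u * y * z * y = fscale 2 (Lop y z u * y) - Lop y y u * z"
    unfolding L2m Lop_squares(2) using s[of x y] s[of x z] s[of y z] by simp_all
  show "u * x * y * y = Lop y y u * x" "u * x * z * z = Lop z z u * x" "u * y * z * z = Lop z z u * y"
    unfolding Lop_squares(2) using s[of y x] s[of z x] s[of z y] by simp_all
  show "u * x * z * y = fscale 2 (Lop y z u * x) - u * x * y * z"
    unfolding L2m using c[of y z x] by (simp add: algebra_simps)
  show "u * y * z * x = fscale 2 (Lop x z u * y) - fscale 2 (Lop x y u * z) + u * x * y * z"
    unfolding L2m using c[of x z y] by (simp add: algebra_simps)
  have 6: "fscale 6 v = v + v + v + (v + v + v)" for v :: "('f, 'v) free_malcev"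
    using free_malcev.scale_left_distrib[of 3 3 v] by (simp add: fscale_three)
  have "fscale 6 (u * x * y * z) = Gfun u x y z + fscale 3 (fscale 2 (Lop x y u * z)) - fscale 3 (fscale 2 (Lop x z u * y))
     + fscale 3 (fscale 2 (Lop y z u * x))" (is "?l = ?r")
  proof (rule eq_by_functionals)
    fix \<phi> :: "('f, 'v) free_malcev \<Rightarrow> rat" assume \<phi>: "additive \<phi>"
    note app = arg_cong[where f = \<phi>]
    show "\<phi> ?l = \<phi> ?r"
      using c[of x y z, simplified, THEN app]
        c[of x z y, simplified, THEN app]
        c[of y z x, simplified, THEN app]
      unfolding L2m 6 fscale_three Gfun_jac_values[OF t]
      unfolding fm_distrib additive_rules[OF \<phi>] by linarith
  qed
  then have "fscale (1/6) (fscale 6 (u * x * y * z)) = fscale (1/6) (Gfun u x y z + fscale 3 (fscale 2 (Lop x y u * z)) - fscale 3 (fscale 2 (Lop x z u * y))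
     + fscale 3 (fscale 2 (Lop y z u * x)))" by simp
  then show "u * x * y * z = fscale (1/6) (Gfun u x y z) + Lop x y u * z - Lop x z u * y + Lop y z u * x"
    by (simp add: free_malcev.scale_right_distrib free_malcev.scale_right_diff_distrib)
qed

lemma span_closed:
  assumes "\<And>b. b \<in> B \<Longrightarrow> F b \<in> free_malcev.span B"
    and "\<And>u v. F (u + v) = F u + F v" "\<And>k u. F (fscale k u) = fscale k (F u)"
    and "v \<in> free_malcev.span B"
  shows "F v \<in> free_malcev.span B"
proof -
  have "F 0 = 0" using assms(2)[of 0 0] by simp
  then have "free_malcev.subspace {v. F v \<in> free_malcev.span B}"
    by (intro free_malcev.subspaceI)
      (simp_all add: assms(2,3) free_malcev.span_add free_malcev.span_scale free_malcev.span_zero)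
  then have "free_malcev.span B \<subseteq> {v. F v \<in> free_malcev.span B}"
    by (intro free_malcev.span_minimal) (auto simp: assms(1))
  with assms(4) show ?thesis by blast
qed

lemma span_mult_generator:
  fixes x y z :: "('f::field_char_0, 'v) free_malcev"
  assumes v: "v \<in> free_malcev.span (spanning_set x y z)" and a: "a \<in> {x, y, z}"
  shows "v * a \<in> free_malcev.span (spanning_set x y z)"
proof (rule span_closed[OF _ _ _ v])
  let ?W = "free_malcev.span (spanning_set x y z)"
  fix b assume "b \<in> spanning_set x y z"
  then obtain u where u: "u \<in> U_set x y z" and b: "b \<in> {u, u * x, u * y, u * z, u * x * y, u * x * z, u * y * z}"
    unfolding spanning_set_def by blast
  have W: "u \<in> ?W" "u * x \<in> ?W" "u * y \<in> ?W" "u * z \<in> ?W" "u * x * y \<in> ?W" "u * x * z \<in> ?W" "u * y * z \<in> ?W"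
    if "u \<in> U_set x y z" for u
    by (rule free_malcev.span_base; use that in \<open>simp add: spanning_set_def\<close>)+
  note W' = W[OF u] W[OF U_set_props(2)[OF u]] W[OF U_set_props(3)[OF u]] W[OF U_set_props(4)[OF u]] W[OF U_set_props(5)[OF u]]
     W[OF U_set_props(6)[OF u]] W[OF U_set_props(7)[OF u]] W[OF U_set_props(8)[OF u]]
  show "b * a \<in> ?W"
    using a b
    by (elim insertE emptyE; simp only: U_set_words[OF u];
      intro free_malcev.span_add free_malcev.span_diff free_malcev.span_scale W')
qed (simp_all add: fm_distrib fscale_mult)

lemma rot_U_set:
  fixes x y z :: "('f::field_char_0, 'v) free_malcev"
  assumes "u \<in> U_set x y z" "a \<in> {x, y, z}" "b \<in> {x, y, z}" "s \<in> {u, u * x, u * y, u * z}"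
  shows "rot s a b = 0"
  using rot_jac_values[OF U_set_props(1)[OF assms(1)]] assms(2-4)
    rot_swap[of _ y x] rot_swap[of _ z x] rot_swap[of _ z y] by auto

text \<open>
  The operators \<open>E\<close> of generators kill \<open>u\<close>, \<open>ux\<close>, \<open>uy\<close>, \<open>uz\<close>.  On words of length two,
  \<open>rot_anticommutator\<close> and its linearization express them by right multiplications by
  generators.
\<close>

lemma span_rot_generator:
  fixes x y z :: "('f::field_char_0, 'v) free_malcev"
  assumes v: "v \<in> free_malcev.span (spanning_set x y z)" and a: "a \<in> {x, y, z}" and b: "b \<in> {x, y, z}"
  shows "rot v a b \<in> free_malcev.span (spanning_set x y z)"
proof (rule span_closed[OF _ _ _ v])
  let ?W = "free_malcev.span (spanning_set x y z)"
  fix w assume "w \<in> spanning_set x y z"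
  then obtain u where u: "u \<in> U_set x y z" and "w \<in> {u, u * x, u * y, u * z, u * x * y, u * x * z, u * y * z}"
    unfolding spanning_set_def by blast
  then consider "w \<in> {u, u * x, u * y, u * z}" | p c where "w = u * p * c" "p \<in> {x, y, z}" "c \<in> {x, y, z}"
      "(p, c) \<in> {(x, y), (x, z), (y, z)}"
    by blast
  then show "rot w a b \<in> ?W"
  proof cases
    case 1
    then show ?thesis using rot_U_set[OF u a b] by (simp add: free_malcev.span_zero)
  next
    case 2
    have uW: "u \<in> ?W" by (rule free_malcev.span_base) (use u in \<open>simp add: spanning_set_def\<close>)
    note m = span_mult_generator
    have A: "rot (u * p * c) a c \<in> ?W" if "p \<in> {x, y, z}" "a \<in> {x, y, z}" "c \<in> {x, y, z}" for p a c
    proof -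
      have "rot (u * p) a c = 0" using rot_U_set[OF u] that by auto
      then have "rot (u * p * c) a c = fscale 3 (u * p * a * c * c - u * p * c * c * a)"
        using rot_anticommutator[of "u * p" c a] by (simp add: fm_distrib fscale_three)
      moreover have "u * p * a * c * c \<in> ?W" "u * p * c * c * a \<in> ?W"
        by (intro m uW that)+
      ultimately show ?thesis by (simp add: free_malcev.span_diff free_malcev.span_scale)
    qed
    have B: "rot (u * p * c) a p \<in> ?W" if "p \<in> {x, y, z}" "a \<in> {x, y, z}" "c \<in> {x, y, z}" for p a c
    proof -
      have "u * p * p \<in> U_set x y z" using U_set_props[OF u] that(1) U_set_words(1-3)[OF u] by auto
      then have "rot (u * p * p) a c = 0" using rot_U_set that by blast
      moreover have "rot (u * p) a c = 0" "rot (u * p) a p = 0" using rot_U_set[OF u] that by auto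
      ultimately have "rot (u * p * c) a p = fscale 3 (u * p * a * c * p + u * p * a * p * c - u * p * c * p * a - u * p * p * c * a)"
        using rot_anticommutator_linear[of "u * p" c a p] by (simp add: fm_distrib fscale_three)
      moreover have "u * p * a * c * p \<in> ?W" "u * p * a * p * c \<in> ?W" "u * p * c * p * a \<in> ?W" "u * p * p * c * a \<in> ?W"
        by (intro m uW that)+
      ultimately show ?thesis by (simp add: free_malcev.span_diff free_malcev.span_add free_malcev.span_scale)
    qed
    \<comment> \<open>two of the four generators \<open>a\<close>, \<open>b\<close>, \<open>c\<close>, \<open>p\<close> coincide, and \<open>p\<close> differs from \<open>c\<close>\<close>
    consider "a = b" | "b = c" | "a = c" | "b = p" | "a = p" using 2 a b by auto
    then show ?thesis
    proof cases
      case 1 then show ?thesis by (simp add: free_malcev.span_zero)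
    next
      case 2 with A a \<open>w = _\<close> \<open>p \<in> _\<close> \<open>c \<in> _\<close> show ?thesis by simp
    next
      case 3
      then have "rot w a b = - rot (u * p * c) b c" using rot_swap[of w a b] \<open>w = _\<close> by simp
      with A[OF \<open>p \<in> _\<close> b \<open>c \<in> _\<close>] show ?thesis by (simp only: free_malcev.span_neg)
    next
      case 4 with B[OF \<open>p \<in> _\<close> a \<open>c \<in> _\<close>] \<open>w = _\<close> show ?thesis by simp
    next
      case 5
      then have "rot w a b = - rot (u * p * c) b p" using rot_swap[of w a b] \<open>w = _\<close> by simp
      with B[OF \<open>p \<in> _\<close> b \<open>c \<in> _\<close>] show ?thesis by (simp only: free_malcev.span_neg)
    qed
  qed
qed (simp_all add: rot_linear fscale_rot)

section \<open>The span is all of \<open>J(M,M,M)\<close>\<close>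

abbreviation (input) "cls \<equiv> abs_free_malcev"

lemma cls_simps: "cls (Var v) = gen v" "cls Zero = 0" "cls (Add s t) = cls s + cls t"
  "cls (Scale k t) = fscale k (cls t)" "cls (Mul s t) = cls s * cls t"
  by (simp_all add: gen.abs_eq zero_free_malcev.abs_eq plus_free_malcev.abs_eq fscale.abs_eq times_free_malcev.abs_eq)

text \<open>
  Induction on how an element is generated, for statements that involve several elements at once:
  the property is one of sets of elements, and each step adjoins a single sum, multiple or product.
\<close>

lemma growing_sets:
  assumes "\<And>A e a b k. P A \<Longrightarrow> a \<in> A \<Longrightarrow> b \<in> A \<Longrightarrow> e \<in> {0, a + b, fscale k a, a * b} \<Longrightarrow> P (insert e A)"
    and "P A" "range gen \<subseteq> A"
  obtains Y where "P Y" "A \<subseteq> Y" "u \<in> Y"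
proof -
  have "\<exists>Y. P Y \<and> A \<subseteq> Y \<and> cls t \<in> Y" for t
    using assms(2,3)
  proof (induction t arbitrary: A)
    case (Var v)
    then show ?case by (intro exI[of _ A]) (auto simp: cls_simps)
  next
    case Zero
    then obtain v where "gen v \<in> A" by blast
    then have "P (insert 0 A)" using Zero assms(1)[of A _ _ 0] by blast
    then show ?case by (intro exI[of _ "insert 0 A"]) (auto simp: cls_simps)
  next
    case (Add s t)
    then obtain Y where Y: "P Y" "A \<subseteq> Y" "cls s \<in> Y" by blast
    with Add obtain Z where Z: "P Z" "Y \<subseteq> Z" "cls t \<in> Z" by (meson order_trans)
    with Y have "P (insert (cls s + cls t) Z)" by (intro assms(1)[of Z "cls s" "cls t"]) auto
    with Y Z show ?case by (intro exI[of _ "insert (cls s + cls t) Z"]) (auto simp: cls_simps)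
  next
    case (Scale k t)
    then obtain Y where Y: "P Y" "A \<subseteq> Y" "cls t \<in> Y" by blast
    then have "P (insert (fscale k (cls t)) Y)" by (intro assms(1)[of Y "cls t" "cls t" _ k]) auto
    with Y show ?case by (intro exI[of _ "insert (fscale k (cls t)) Y"]) (auto simp: cls_simps)
  next
    case (Mul s t)
    then obtain Y where Y: "P Y" "A \<subseteq> Y" "cls s \<in> Y" by blast
    with Mul obtain Z where Z: "P Z" "Y \<subseteq> Z" "cls t \<in> Z" by (meson order_trans)
    with Y have "P (insert (cls s * cls t) Z)" by (intro assms(1)[of Z "cls s" "cls t"]) auto
    with Y Z show ?case by (intro exI[of _ "insert (cls s * cls t) Z"]) (auto simp: cls_simps)
  qed
  moreover have "\<exists>t. u = cls t" by (induction u rule: free_malcev.abs_induct) blast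
  ultimately show thesis using that by blast
qed

lemma fscale_rot_args: "rot u (fscale k a) b = fscale k (rot u a b)" "rot u a (fscale k b) = fscale k (rot u a b)"
  for a b u :: "('f::field, 'v) free_malcev"
  by (simp_all add: rot_def fscale_mult free_malcev.scale_right_distrib free_malcev.scale_right_diff_distrib)

lemma subspace_half: "free_malcev.subspace W \<Longrightarrow> u + u \<in> W \<Longrightarrow> u \<in> W" for u :: "('f::field_char_0, 'v) free_malcev"
  using free_malcev.subspace_scale[of W "u + u" "1/2"] by (simp only: fscale_half)

text \<open>
  The invariant is stability under \<open>R\<^sub>a\<close> and \<open>E(a,b)\<close> for all \<open>a\<close>, \<open>b\<close> in a growing set.  It passes to
  products by \<open>2 R\<^sub>a\<^sub>b = 2 E(a,b) - [R\<^sub>a, R\<^sub>b]\<close> and \<open>rot_product_general\<close>.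
\<close>

lemma right_ideal_generators:
  fixes W :: "('f::field_char_0, 'v) free_malcev set"
  assumes W: "free_malcev.subspace W"
    and gen_mult: "\<And>u i. u \<in> W \<Longrightarrow> u * gen i \<in> W"
    and gen_rot: "\<And>u i j. u \<in> W \<Longrightarrow> rot u (gen i) (gen j) \<in> W"
    and "u \<in> W"
  shows "u * a \<in> W"
proof -
  note sub = free_malcev.subspace_0[OF W] free_malcev.subspace_add[OF W] free_malcev.subspace_diff[OF W]
    free_malcev.subspace_scale[OF W] free_malcev.subspace_neg[OF W]
  define stable where "stable A \<longleftrightarrow> (\<forall>u\<in>W. \<forall>a\<in>A. u * a \<in> W \<and> (\<forall>b\<in>A. rot u a b \<in> W))" for A
  have ext: "stable (insert e A)"
    if A: "stable A" and e: "\<And>u. u \<in> W \<Longrightarrow> u * e \<in> W" "\<And>u c. u \<in> W \<Longrightarrow> c \<in> A \<Longrightarrow> rot u c e \<in> W" for A e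
  proof -
    have "rot u e c \<in> W" if "u \<in> W" "c \<in> A" for u c
      using sub(5)[OF e(2)[OF that]] rot_swap[of u e c] by simp
    with A e sub(1) show ?thesis unfolding stable_def by auto
  qed
  have "stable (insert e A)"
    if A: "stable A" and ab: "a \<in> A" "b \<in> A" and e: "e \<in> {0, a + b, fscale k a, a * b}" for A e a b k
  proof (rule ext[OF A])
    fix u assume u: "u \<in> W"
    have m: "v * c \<in> W" if "v \<in> W" "c \<in> A" for v c
      using A that unfolding stable_def by blast
    have r: "rot v c d \<in> W" if "v \<in> W" "c \<in> A" "d \<in> A" for v c d
      using A that unfolding stable_def by blast
    have "u * (a * b) \<in> W"
    proof (rule subspace_half[OF W])
      have "u * (a * b) + u * (a * b) = rot u a b + u * b * a - u * a * b" by (simp add: rot_def)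
      also have "\<dots> \<in> W" using u ab by (intro sub m r)
      finally show "u * (a * b) + u * (a * b) \<in> W" .
    qed
    then show "u * e \<in> W" using e u ab sub(1)
      by (elim insertE emptyE) (simp_all add: fm_distrib fscale_mult sub(2) sub(4) m)
    fix c assume c: "c \<in> A"
    have "rot u c (a * b) \<in> W"
    proof (rule subspace_half[OF W])
      show "rot u c (a * b) + rot u c (a * b) \<in> W"
        unfolding rot_product_general using u ab c by (intro sub m r)
    qed
    then show "rot u c e \<in> W" using e u ab c sub(1)
      by (elim insertE emptyE) (simp_all add: rot_linear fscale_rot_args sub(2) sub(4) r)
  qed
  moreover have "stable (range gen)" unfolding stable_def using gen_mult gen_rot by auto
  ultimately obtain Y where "stable Y" "a \<in> Y" by (rule growing_sets[where P = stable]) auto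
  then show ?thesis using \<open>u \<in> W\<close> unfolding stable_def by blast
qed

lemma fscale_jac: "jac (fscale k a) b c = fscale k (jac a b c)" for a b c :: "('f::field, 'v) free_malcev"
  by (simp add: jac_op fscale_mult free_malcev.scale_right_diff_distrib)

lemma jac_in_ideal:
  fixes W :: "('f::field_char_0, 'v) free_malcev set"
  assumes W: "free_malcev.subspace W" and mult: "\<And>u a. u \<in> W \<Longrightarrow> u * a \<in> W"
    and gens: "\<And>i j k. jac (gen i) (gen j) (gen k) \<in> W"
  shows "jac a b c \<in> W"
proof -
  note sub = free_malcev.subspace_0[OF W] free_malcev.subspace_add[OF W] free_malcev.subspace_diff[OF W]
    free_malcev.subspace_scale[OF W] free_malcev.subspace_neg[OF W]
  define closed where "closed A \<longleftrightarrow> (\<forall>a\<in>A. \<forall>b\<in>A. \<forall>c\<in>A. jac a b c \<in> W)" for A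
  have step: "closed (insert e A)"
    if A: "closed A" and ab: "a \<in> A" "b \<in> A" and e: "e \<in> {0, a + b, fscale k a, a * b}" for A e a b k
  proof -
    have j: "jac a b c \<in> W" if "a \<in> A" "b \<in> A" "c \<in> A" for a b c
      using A that unfolding closed_def by blast
    have 1: "jac e c d \<in> W" if cd: "c \<in> A" "d \<in> A" for c d
    proof -
      have "fscale 3 (jac (a * b) c d) \<in> W"
        unfolding fscale_three jac_product using ab cd by (intro sub mult j)
      then have "fscale (1/3) (fscale 3 (jac (a * b) c d)) \<in> W" by (rule sub)
      then have "jac (a * b) c d \<in> W" by simp
      moreover have "jac 0 c d = 0" by (simp add: jac_op fm_distrib)
      ultimately show ?thesis using e ab cd sub(1)
        by (elim insertE emptyE) (simp_all add: jac_add fscale_jac sub(2) sub(4) j)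
    qed
    have 2: "jac c e d \<in> W" "jac c d e \<in> W" if "c \<in> A" "d \<in> A" for c d
      using 1[OF that(2,1)] 1[OF that] jac_rotate[of e d c] jac_rotate[of c d e] by simp_all
    show ?thesis
      using j 1 2 sub(1) unfolding closed_def by auto
  qed
  have "closed (range gen)" unfolding closed_def using gens by auto
  have grow: "\<exists>Y. closed Y \<and> A \<subseteq> Y \<and> u \<in> Y" if A: "closed A" "range gen \<subseteq> A" for A u
    by (rule growing_sets[where P = closed and u = u, OF _ A]) (use step in blast)+
  obtain A where A: "closed A" "range gen \<subseteq> A" "a \<in> A" using grow[OF \<open>closed (range gen)\<close>] by blast
  obtain Y where Y: "closed Y" "A \<subseteq> Y" "b \<in> Y" using grow[OF A(1,2)] by blast
  have "range gen \<subseteq> Y" using A(2) Y(2) by blast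
  then obtain Z where "closed Z" "Y \<subseteq> Z" "c \<in> Z" using grow[OF Y(1)] by blast
  with A Y show ?thesis unfolding closed_def by blast
qed

lemma iterates_in_JMMM: "iterates (central_ops x y z) e t \<in> JMMM" if "t \<in> JMMM"
  for x y z t :: "('f::field_char_0, 'v) free_malcev"
proof (rule iterates_invariant[OF _ that])
  fix F and s :: "('f, 'v) free_malcev" assume F: "F \<in> set (central_ops x y z)" and s: "s \<in> JMMM"
  have "Lop a b s \<in> JMMM" for a b
    unfolding Lop_def using s
    by (intro free_malcev.subspace_scale free_malcev.subspace_add JMMM_subspace JMMM_mult(1))
  moreover have "Gfun s x y z \<in> JMMM"
    unfolding Gfun_def
    by (intro free_malcev.subspace_diff JMMM_subspace jac_in_JMMM JMMM_mult(2)[OF jac_in_JMMM] JMMM_mult(1)[OF jac_in_JMMM])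
  ultimately show "F s \<in> JMMM" using F unfolding central_ops_def by auto
qed

theorem span_spanning_set:
  fixes x y z :: "('f::field_char_0) M3"
  defines "x \<equiv> gen Gen_x" and "y \<equiv> gen Gen_y" and "z \<equiv> gen Gen_z"
  shows "free_malcev.span (spanning_set x y z) = JMMM"
proof
  have "U_set x y z \<subseteq> JMMM" unfolding U_set_eq using iterates_in_JMMM jac_in_JMMM by blast
  then have "spanning_set x y z \<subseteq> JMMM" unfolding spanning_set_def
    by (auto intro!: JMMM_mult(1))
  then show "free_malcev.span (spanning_set x y z) \<subseteq> JMMM"
    by (intro free_malcev.span_minimal JMMM_subspace)
  let ?W = "free_malcev.span (spanning_set x y z)"
  have g: "gen i \<in> {x, y, z}" for i unfolding x_def y_def z_def by (cases i) auto
  have mult: "u * a \<in> ?W" if "u \<in> ?W" for u a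
    by (rule right_ideal_generators[OF _ _ _ that])
      (simp_all add: span_mult_generator[OF _ g] span_rot_generator[OF _ g g])
  have "jac x y z \<in> ?W"
  proof (rule free_malcev.span_base)
    have "jac x y z = iterates (central_ops x y z) (\<lambda>_. 0) (jac x y z)" by (simp add: central_ops_def)
    then show "jac x y z \<in> spanning_set x y z" unfolding spanning_set_def U_set_eq by blast
  qed
  then have jac_gen: "jac (gen i) (gen j) (gen k) \<in> ?W" for i j k
    using free_malcev.span_neg[of "jac x y z" "spanning_set x y z"] free_malcev.span_zero
    by (cases i; cases j; cases k) (simp_all add: x_def[symmetric] y_def[symmetric] z_def[symmetric] jac_perm[where p = x and q = y and r = z])
  have "jac a b c \<in> ?W" for a b c
    by (rule jac_in_ideal[OF free_malcev.subspace_span mult jac_gen])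
  then show "JMMM \<subseteq> ?W"
    unfolding JMMM_def by (intro free_malcev.span_minimal) auto
qed

section \<open>Linear independence: a model in the split octonions\<close>

text \<open>
  The split octonions over a commutative ring, as Zorn's vector matrices with diagonal entries \<open>a\<close>, \<open>b\<close>
  and off-diagonal vectors \<open>u\<close>, \<open>v\<close>.
\<close>

datatype 'k zorn = Zorn 'k 'k 'k 'k 'k 'k 'k 'k

instantiation zorn :: (comm_ring_1) "{ab_group_add, times}"
begin

fun plus_zorn :: "'a zorn \<Rightarrow> 'a zorn \<Rightarrow> 'a zorn" where
  "Zorn a u1 u2 u3 v1 v2 v3 b + Zorn a' u1' u2' u3' v1' v2' v3' b' =
     Zorn (a + a') (u1 + u1') (u2 + u2') (u3 + u3') (v1 + v1') (v2 + v2') (v3 + v3') (b + b')"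
fun uminus_zorn :: "'a zorn \<Rightarrow> 'a zorn" where
  "- Zorn a u1 u2 u3 v1 v2 v3 b = Zorn (- a) (- u1) (- u2) (- u3) (- v1) (- v2) (- v3) (- b)"
fun minus_zorn :: "'a zorn \<Rightarrow> 'a zorn \<Rightarrow> 'a zorn" where
  "Zorn a u1 u2 u3 v1 v2 v3 b - Zorn a' u1' u2' u3' v1' v2' v3' b' =
     Zorn (a - a') (u1 - u1') (u2 - u2') (u3 - u3') (v1 - v1') (v2 - v2') (v3 - v3') (b - b')"
definition zero_zorn :: "'a zorn" where "0 = Zorn 0 0 0 0 0 0 0 0"
fun times_zorn :: "'a zorn \<Rightarrow> 'a zorn \<Rightarrow> 'a zorn" where
  "Zorn a u1 u2 u3 v1 v2 v3 b * Zorn a' u1' u2' u3' v1' v2' v3' b' =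
     Zorn (a * a' + u1 * v1' + u2 * v2' + u3 * v3')
       (a * u1' + b' * u1 - (v2 * v3' - v3 * v2'))
       (a * u2' + b' * u2 - (v3 * v1' - v1 * v3'))
       (a * u3' + b' * u3 - (v1 * v2' - v2 * v1'))
       (a' * v1 + b * v1' + (u2 * u3' - u3 * u2'))
       (a' * v2 + b * v2' + (u3 * u1' - u1 * u3'))
       (a' * v3 + b * v3' + (u1 * u2' - u2 * u1'))
       (b * b' + v1 * u1' + v2 * u2' + v3 * u3')"

instance
proof
  fix p q r :: "'a zorn"
  show "p + q + r = p + (q + r)" "p + q = q + p" "p - q = p + - q"
    by (cases p; cases q; cases r; simp add: algebra_simps)+
  show "0 + p = p" "- p + p = 0" by (cases p; simp add: zero_zorn_def)+
qed

end

fun zscale :: "'k::comm_ring_1 \<Rightarrow> 'k zorn \<Rightarrow> 'k zorn" where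
  "zscale k (Zorn a u1 u2 u3 v1 v2 v3 b) = Zorn (k * a) (k * u1) (k * u2) (k * u3) (k * v1) (k * v2) (k * v3) (k * b)"

lemma zorn_distrib:
  fixes p q r :: "'k::comm_ring_1 zorn"
  shows "(p + q) * r = p * r + q * r" "r * (p + q) = r * p + r * q"
    "zscale k p * q = zscale k (p * q)" "p * zscale k q = zscale k (p * q)"
    "(p - q) * r = p * r - q * r" "r * (p - q) = r * p - r * q"
  by (cases p; cases q; cases r; simp add: algebra_simps)+

lemma zscale_simps:
  fixes p q :: "'k::comm_ring_1 zorn"
  shows "zscale k (p + q) = zscale k p + zscale k q" "zscale (k + l) p = zscale k p + zscale l p"
    "zscale (k * l) p = zscale k (zscale l p)" "zscale 1 p = p" "zscale 0 p = 0" "zscale k 0 = 0"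
    "zscale k (p - q) = zscale k p - zscale k q" "zscale (-1) p = - p"
  by (cases p; cases q; simp add: algebra_simps zero_zorn_def)+

lemma zorn_left_alternative: "p * p * q = p * (p * q)" for p q :: "'k::comm_ring_1 zorn"
  by (cases p; cases q) (simp add: algebra_simps)

lemma zorn_right_alternative: "p * q * q = p * (q * q)" for p q :: "'k::comm_ring_1 zorn"
  by (cases p; cases q) (simp add: algebra_simps)

text \<open>
  The trace form \<open>tr(pq)\<close>.
\<close>

fun pairing :: "'k::comm_ring_1 zorn \<Rightarrow> 'k zorn \<Rightarrow> 'k" where
  "pairing (Zorn a u1 u2 u3 v1 v2 v3 b) (Zorn a' u1' u2' u3' v1' v2' v3' b') =
     a * a' + b * b' + (u1 * v1' + u2 * v2' + u3 * v3') + (v1 * u1' + v2 * u2' + v3 * u3')"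

lemma pairing_linear: "pairing (p + q) r = pairing p r + pairing q r" "pairing (zscale k p) r = k * pairing p r"
    "pairing 0 r = 0"
  for p q r :: "'k::comm_ring_1 zorn"
  by (cases p; cases q; cases r; simp add: algebra_simps zero_zorn_def)+

definition zcomm :: "'k::comm_ring_1 zorn \<Rightarrow> 'k zorn \<Rightarrow> 'k zorn" where
  "zcomm p q = p * q - q * p"

lemma zcomm_scale: "zcomm (zscale k p) q = zscale k (zcomm p q)" "zcomm p (zscale k q) = zscale k (zcomm p q)"
  for p q :: "'k::comm_ring_1 zorn"
  by (simp_all add: zcomm_def zorn_distrib zscale_simps)

lemma zcomm_distrib: "zcomm (p + q) r = zcomm p r + zcomm q r" "zcomm r (p + q) = zcomm r p + zcomm r q"
  for p q r :: "'k::comm_ring_1 zorn"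
  by (simp_all add: zcomm_def zorn_distrib)

text \<open>
  The images of the generators.  They have trace zero, and the entries are arranged so that
  \<open>x\<^sup>2 = A\<close>, \<open>y\<^sup>2 = B\<close>, \<open>z\<^sup>2 = g\<^sup>2\<close>, \<open>xy + yx = P\<close>, \<open>xz + zx = Q\<close> and \<open>yz + zy = R\<close>.  Then
  \<open>j = J(x,y,z)\<close> anticommutes with \<open>x\<close>, \<open>y\<close> and \<open>z\<close>, which makes it an eigenvector of every \<open>L\<close>.
  The remaining parameter \<open>h\<close> is shifted by \<open>P g\<close> so that the eigenvalue for \<open>G\<close> becomes a single
  term.
\<close>

context
  fixes A B P Q R g h :: "'k::comm_ring_1"
begin

definition "zx = Zorn 0 1 0 0 A 0 0 0"
definition "zy = Zorn 0 0 1 0 P B 0 0"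
definition "zz = Zorn g 0 0 (h - P * g) Q R 0 (- g)"
definition "zj = Zorn (- 6 * (h - P * g)) (6 * R) (- 6 * Q) (6 * P * (h - P * g) + 12 * A * B * g)
   (- 6 * A * R) (6 * B * Q - 6 * P * R) (12 * g) (6 * (h - P * g))"

lemma zj_eq: "zcomm (zcomm zx zy) zz + zcomm (zcomm zz zx) zy + zcomm (zcomm zy zz) zx = zj"
  unfolding zcomm_def zx_def zy_def zz_def zj_def by (simp add: algebra_simps)

lemma zj_L:
  "zcomm (zcomm zj zx) zx = zscale (4 * A) zj"
  "zcomm (zcomm zj zy) zy = zscale (4 * B) zj"
  "zcomm (zcomm zj zz) zz = zscale (4 * g ^ 2) zj"
  "zcomm (zcomm zj zx) zy + zcomm (zcomm zj zy) zx = zscale (4 * P) zj"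
  "zcomm (zcomm zj zx) zz + zcomm (zcomm zj zz) zx = zscale (4 * Q) zj"
  "zcomm (zcomm zj zy) zz + zcomm (zcomm zj zz) zy = zscale (4 * R) zj"
  unfolding zcomm_def zx_def zy_def zz_def zj_def by (simp add: algebra_simps power2_eq_square)+

definition "zjac p q r = zcomm (zcomm p q) r + zcomm (zcomm r p) q + zcomm (zcomm q r) p"

lemma zj_G: "zjac (zcomm zj zx) zy zz - zcomm zx (zjac zj zy zz) - zcomm (zjac zx zy zz) zj = zscale (- 24 * h) zj"
  unfolding zjac_def zcomm_def zx_def zy_def zz_def zj_def by (simp add: algebra_simps power2_eq_square)

text \<open>The octonion \<open>j\<close> satisfies \<open>j\<^sup>2 = 36 \<nu>\<close> for this discriminant \<open>\<nu>\<close>.\<close>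

definition "znu = h ^ 2 + P * Q * R - P ^ 2 * g ^ 2 - B * Q ^ 2 - A * R ^ 2 + 4 * A * B * g ^ 2"

end

lemmas z_defs = zx_def zy_def zz_def zj_def zcomm_def znu_def

text \<open>
  Pairing \<open>jxy\<close>, \<open>jxz\<close>, \<open>jyz\<close>, \<open>j\<close>, \<open>jx\<close>, \<open>jy\<close>, \<open>jz\<close> with \<open>z\<close>, \<open>y\<close>, \<open>x\<close>, \<open>j\<close>, \<open>yz\<close>, \<open>xz\<close>, \<open>xy\<close>
  gives a triangular matrix whose diagonal entries are nonzero integer multiples of the
  discriminant.
\<close>

lemma pairing_table:
  fixes A B P Q R g h :: "'k::comm_ring_1"
  defines "x \<equiv> zx A" and "y \<equiv> zy B P" and "z \<equiv> zz P Q R g h"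
    and "j \<equiv> zj A B P Q R g h" and "\<nu> \<equiv> znu A B P Q R g h"
  shows "pairing j z = 0" "pairing (zcomm j x) z = 0" "pairing (zcomm j y) z = 0" "pairing (zcomm j z) z = 0"
      "pairing (zcomm (zcomm j x) y) z = - 24 * \<nu>" "pairing (zcomm (zcomm j x) z) z = 0" "pairing (zcomm (zcomm j y) z) z = 0"
    "pairing j y = 0" "pairing (zcomm j x) y = 0" "pairing (zcomm j y) y = 0" "pairing (zcomm j z) y = 0"
      "pairing (zcomm (zcomm j x) z) y = 24 * \<nu>" "pairing (zcomm (zcomm j y) z) y = 0"
    "pairing j x = 0" "pairing (zcomm j x) x = 0" "pairing (zcomm j y) x = 0" "pairing (zcomm j z) x = 0"
      "pairing (zcomm (zcomm j y) z) x = - 24 * \<nu>"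
    "pairing j j = 72 * \<nu>" "pairing (zcomm j x) j = 0" "pairing (zcomm j y) j = 0" "pairing (zcomm j z) j = 0"
    "pairing (zcomm j x) (zcomm y z) = - 24 * \<nu>" "pairing (zcomm j y) (zcomm y z) = 0" "pairing (zcomm j z) (zcomm y z) = 0"
    "pairing (zcomm j y) (zcomm x z) = 24 * \<nu>" "pairing (zcomm j z) (zcomm x z) = 0"
    "pairing (zcomm j z) (zcomm x y) = - 24 * \<nu>"
  unfolding x_def y_def z_def j_def \<nu>_def z_defs
  by (simp_all add: algebra_simps power2_eq_square)

lemma words_independent:
  fixes A B P Q R g h :: "'k::{idom, ring_char_0}"
  defines "x \<equiv> zx A" and "y \<equiv> zy B P" and "z \<equiv> zz P Q R g h" and "j \<equiv> zj A B P Q R g h"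
  assumes \<nu>: "znu A B P Q R g h \<noteq> 0"
    and sum: "zscale f0 j + zscale f1 (zcomm j x) + zscale f2 (zcomm j y) + zscale f3 (zcomm j z)
     + zscale f4 (zcomm (zcomm j x) y) + zscale f5 (zcomm (zcomm j x) z) + zscale f6 (zcomm (zcomm j y) z) = 0"
      (is "?s = 0")
  shows "f0 = 0 \<and> f1 = 0 \<and> f2 = 0 \<and> f3 = 0 \<and> f4 = 0 \<and> f5 = 0 \<and> f6 = 0"
proof -
  note t = pairing_table[of A B P Q R g h, folded x_def y_def z_def j_def] pairing_linear
  have p: "pairing ?s u = 0" for u by (simp add: sum pairing_linear)
  have f4: "f4 = 0" using p[of z] \<nu> by (simp add: t)
  have f5: "f5 = 0" using p[of y] \<nu> by (simp add: t f4)
  have f6: "f6 = 0" using p[of x] \<nu> by (simp add: t f4 f5)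
  have f0: "f0 = 0" using p[of j] \<nu> by (simp add: t f4 f5 f6)
  have f1: "f1 = 0" using p[of "zcomm y z"] \<nu> by (simp add: t f4 f5 f6 f0)
  have f2: "f2 = 0" using p[of "zcomm x z"] \<nu> by (simp add: t f4 f5 f6 f0 f1)
  have f3: "f3 = 0" using p[of "zcomm x y"] \<nu> by (simp add: t f4 f5 f6 f0 f1 f2)
  show ?thesis using f0 f1 f2 f3 f4 f5 f6 by simp
qed

lemma zorn_mult_zero: "0 * a = 0" "a * 0 = 0" for a :: "'k::comm_ring_1 zorn"
  using zorn_distrib(5)[of a a a] zorn_distrib(6)[of a a a] by simp_all

lemma zorn_mult_minus: "a * - b = - (a * b)" for a b :: "'k::comm_ring_1 zorn"
  using zorn_distrib(6)[of a 0 b] by (simp add: zorn_mult_zero)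

text \<open>
  In an alternative algebra the Jacobian of the commutator is six times the associator, and the
  Malcev identity for the commutator follows from the corresponding property of the associator.
  This avoids expanding the Malcev identity in the 24 coordinates of three matrices.
\<close>

definition zassoc :: "'k::comm_ring_1 zorn \<Rightarrow> 'k zorn \<Rightarrow> 'k zorn \<Rightarrow> 'k zorn" where
  "zassoc a b c = a * b * c - a * (b * c)"

lemma zassoc_add: "zassoc (a + a') b c = zassoc a b c + zassoc a' b c" "zassoc a (b + b') c = zassoc a b c + zassoc a b' c"
   "zassoc a b (c + c') = zassoc a b c + zassoc a b c'" "zassoc a b (c - c') = zassoc a b c - zassoc a b c'"
  for a b c :: "'k::comm_ring_1 zorn"
  by (simp_all add: zassoc_def zorn_distrib algebra_simps)

lemma zassoc_same: "zassoc a a b = 0" "zassoc b a a = 0" for a b :: "'k::comm_ring_1 zorn"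
  by (simp_all add: zassoc_def zorn_left_alternative zorn_right_alternative)

lemma zassoc_swap: "zassoc b a c = - zassoc a b c" "zassoc a c b = - zassoc a b c"
  for a b c :: "'k::comm_ring_1 zorn"
proof -
  have "zassoc b a c + zassoc a b c = 0" "zassoc a c b + zassoc a b c = 0"
    using zassoc_same(1)[of "a + b" c] zassoc_same(2)[of a "b + c"]
    unfolding zassoc_add by (simp_all add: zassoc_same)
  then show "zassoc b a c = - zassoc a b c" "zassoc a c b = - zassoc a b c"
    by (simp_all only: eq_neg_iff_add_eq_0)
qed

lemma zassoc_rotate: "zassoc b c a = zassoc a b c" for a b c :: "'k::comm_ring_1 zorn"
  using zassoc_swap(2)[of b c a] zassoc_swap(1)[of b a c] by simp

lemma zjac_zassoc: "zjac a b c = zscale 6 (zassoc a b c)" for a b c :: "'k::comm_ring_1 zorn"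
proof -
  have "zscale 6 u = u + u + u + u + u + u" for u :: "'k zorn"
    by (cases u) (simp add: algebra_simps)
  moreover have "zjac a b c = zassoc a b c - zassoc b a c + zassoc c a b - zassoc a c b + zassoc b c a - zassoc c b a"
    by (simp add: zjac_def zcomm_def zassoc_def zorn_distrib algebra_simps)
  ultimately show ?thesis
    using zassoc_swap[of a b c] zassoc_swap[of a c b] zassoc_swap[of b c a] by simp
qed

lemma zassoc_malcev: "zassoc a b (zcomm a c) = zcomm (zassoc a b c) a" for a b c :: "'k::comm_ring_1 zorn"
proof -
  have T: "zassoc (w * p) q r - zassoc w (p * q) r + zassoc w p (q * r) = w * zassoc p q r + zassoc w p q * r"
    for w p q r :: "'k zorn"
    by (simp add: zassoc_def zorn_distrib algebra_simps)
  have 1: "zassoc (a * a) b c - zassoc a b (c * a) = zassoc a b c * a"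
    using T[of b c a a] zassoc_rotate[of b "c * a" a] zassoc_rotate[of b c "a * a"] zassoc_rotate[of b c a]
    by (simp add: zassoc_same zorn_mult_zero)
  have 2: "zassoc (a * a) b c - zassoc a b (a * c) = a * zassoc a b c"
    using T[of a a c b] zassoc_swap(2)[of a "a * c" b] zassoc_swap(2)[of "a * a" c b] zassoc_swap(2)[of a c b]
    by (simp add: zassoc_same zorn_mult_zero zorn_mult_minus algebra_simps)
  show ?thesis using 1 2 by (simp add: zcomm_def zassoc_add algebra_simps)
qed

lemma zcomm_self: "zcomm a a = 0" for a :: "'k::comm_ring_1 zorn"
  by (simp add: zcomm_def)

lemma zjac_malcev: "zjac a b (zcomm a c) = zcomm (zjac a b c) a" for a b c :: "'k::comm_ring_1 zorn"
  by (simp add: zjac_zassoc zassoc_malcev zcomm_scale)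

text \<open>
  Polynomials as finitely supported functions on exponent vectors.  The indeterminates are indexed
  by natural numbers, of which only the first seven occur.
\<close>

type_synonym 'f poly7 = "(nat \<Rightarrow>\<^sub>0 nat) \<Rightarrow>\<^sub>0 'f"

abbreviation mon :: "'f \<Rightarrow> (nat \<Rightarrow>\<^sub>0 nat) \<Rightarrow> ('f::field_char_0) poly7" where
  "mon c m \<equiv> Poly_Mapping.single m c"

definition indet :: "nat \<Rightarrow> ('f::field_char_0) poly7" where
  "indet i = mon 1 (Poly_Mapping.single i 1)"

abbreviation fzscale :: "'f::field_char_0 \<Rightarrow> 'f poly7 zorn \<Rightarrow> 'f poly7 zorn" where
  "fzscale c \<equiv> zscale (mon c 0)"

lemma mon_const: "mon (c + d) 0 = mon c 0 + mon d 0" "mon (c * d) 0 = mon c 0 * mon d 0" "mon 1 0 = 1" "mon (-1) 0 = - 1"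
  for c d :: "'f::field_char_0"
  by (simp_all add: single_add mult_single single_uminus)

definition zorn_algebra :: "('f::field_char_0, 'f poly7 zorn) module" where
  "zorn_algebra = \<lparr>carrier = UNIV, monoid.mult = zcomm, one = undefined, zero = 0, add = (+), module.smult = fzscale\<rparr>"

lemma malcev_zorn: "malcev_algebra (zorn_algebra :: ('f::field_char_0, 'f poly7 zorn) module)"
proof -
  let ?A = "zorn_algebra :: ('f, 'f poly7 zorn) module"
  have "nonassoc_algebra ?A"
    by (rule nonassoc_algebraI)
      (simp_all add: zorn_algebra_def zcomm_distrib zcomm_scale zscale_simps mon_const add_ac)
  then show ?thesis
    unfolding malcev_algebra_def malcev_algebra_axioms_def jacobian_on_def
    by (simp add: zorn_algebra_def zjac_malcev[unfolded zjac_def] zcomm_self)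
qed

text \<open>
  The indeterminates are numbered like the operators in \<open>central_ops\<close>: \<open>h\<close> has number 0 and belongs to
  \<open>G\<close>, while \<open>A\<close>, \<open>B\<close>, \<open>g\<close>, \<open>P\<close>, \<open>Q\<close>, \<open>R\<close> have numbers 1 to 6 and belong to the \<open>L\<close>.
\<close>

definition zgen :: "gens \<Rightarrow> ('f::field_char_0) poly7 zorn" where
  "zgen i = (case i of Gen_x \<Rightarrow> zx (indet 1) | Gen_y \<Rightarrow> zy (indet 2) (indet 4)
     | Gen_z \<Rightarrow> zz (indet 4) (indet 5) (indet 6) (indet 3) (indet 0))"

lemma zorn_representation:
  obtains \<psi> :: "('f::field_char_0) M3 \<Rightarrow> 'f poly7 zorn"
  where "\<And>u v. \<psi> (u + v) = \<psi> u + \<psi> v" "\<And>c u. \<psi> (fscale c u) = fzscale c (\<psi> u)"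
    "\<And>u v. \<psi> (u * v) = zcomm (\<psi> u) (\<psi> v)" "\<And>i. \<psi> (gen i) = zgen i"
proof -
  have "\<exists>!\<psi>. \<psi> \<in> algebra_hom free_malcev_algebra (zorn_algebra :: ('f, 'f poly7 zorn) module) \<and> (\<forall>i. \<psi> (gen i) = zgen i)"
    by (rule free_malcev_universal[OF malcev_zorn]) (simp add: zorn_algebra_def)
  then obtain \<psi> where hom: "\<psi> \<in> algebra_hom free_malcev_algebra (zorn_algebra :: ('f, 'f poly7 zorn) module)"
    and gen: "\<And>i. \<psi> (gen i) = zgen i" by blast
  show thesis
  proof (rule that[OF _ _ _ gen])
    show "\<psi> (u + v) = \<psi> u + \<psi> v" "\<psi> (u * v) = zcomm (\<psi> u) (\<psi> v)" "\<psi> (fscale c u) = fzscale c (\<psi> u)" for u v c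
      using hom unfolding algebra_hom_def hom_def by (simp_all add: zorn_algebra_def)
  qed
qed

lemma znu_nonzero:
  "znu (indet 1) (indet 2) (indet 4) (indet 5) (indet 6) (indet 3) (indet 0 :: ('f::field_char_0) poly7) \<noteq> 0"
proof
  let ?s = "\<lambda>i. Poly_Mapping.single (i::nat) (1::nat)"
  assume "znu (indet 1) (indet 2) (indet 4) (indet 5) (indet 6) (indet 3) (indet 0 :: 'f poly7) = 0"
  then have "Poly_Mapping.lookup (znu (indet 1) (indet 2) (indet 4) (indet 5) (indet 6) (indet 3) (indet 0 :: 'f poly7)) (?s 0 + ?s 0) = 0"
    by simp
  \<comment> \<open>\<open>h\<^sup>2\<close> is the only term of the discriminant with this exponent vector\<close>
  moreover have four: "(4 :: 'f poly7) = mon 4 0"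
    by (metis (no_types) single_numeral)
  have ne: "m \<noteq> ?s 0 + ?s 0" if "Poly_Mapping.lookup m 0 = 0" for m
    using that by (auto simp: lookup_add)
  have "Poly_Mapping.lookup (znu (indet 1) (indet 2) (indet 4) (indet 5) (indet 6) (indet 3) (indet 0 :: 'f poly7)) (?s 0 + ?s 0) = 1"
    unfolding znu_def indet_def four
    by (simp add: power2_eq_square mult_single lookup_add lookup_minus lookup_single when_def ne
      del: single_numeral single_one One_nat_def)
  ultimately show False by simp
qed

text \<open>
  The eigenvalue of the \<open>i\<close>-th operator is a multiple of the \<open>i\<close>-th indeterminate, squared for
  \<open>i = 3\<close> because \<open>z\<^sup>2 = g\<^sup>2\<close>.  Different exponent vectors therefore give different monomials.
\<close>

definition weight_exponent :: "nat \<Rightarrow> nat" where "weight_exponent i = (if i = 3 then 2 else 1)"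

definition weight_coeff :: "nat \<Rightarrow> 'f::field_char_0" where
  "weight_coeff i = [- 24, 4, 4, 4, 2, 2, 2] ! i"

definition weight :: "nat \<Rightarrow> ('f::field_char_0) poly7" where
  "weight i = mon (weight_coeff i) (Poly_Mapping.single i (weight_exponent i))"

definition zj0 :: "('f::field_char_0) poly7 zorn" where
  "zj0 = zj (indet 1) (indet 2) (indet 4) (indet 5) (indet 6) (indet 3) (indet 0)"

lemma mon_numeral: "(numeral n :: ('f::field_char_0) poly7) = mon (numeral n) 0"
  by (simp add: single_numeral)

lemma weight_eqs: "weight 0 = - 24 * (indet 0 :: ('f::field_char_0) poly7)" "weight 1 = 4 * (indet 1 :: ('f::field_char_0) poly7)"
   "weight 2 = 4 * (indet 2 :: ('f::field_char_0) poly7)"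
   "weight 3 = 4 * (indet 3 :: ('f::field_char_0) poly7)^2"
   "weight 4 = 2 * (indet 4 :: ('f::field_char_0) poly7)"
   "weight 5 = 2 * (indet 5 :: ('f::field_char_0) poly7)" "weight 6 = 2 * (indet 6 :: ('f::field_char_0) poly7)"
  unfolding weight_def weight_coeff_def weight_exponent_def indet_def mon_numeral
  by (simp_all add: mult_single power2_eq_square single_uminus flip: single_add del: single_numeral One_nat_def)

locale zorn_rep =
  fixes \<psi> :: "('f::field_char_0) M3 \<Rightarrow> 'f poly7 zorn"
  assumes \<psi>_add: "\<psi> (u + v) = \<psi> u + \<psi> v" and \<psi>_scale: "\<psi> (fscale c u) = fzscale c (\<psi> u)"
    and \<psi>_mult: "\<psi> (u * v) = zcomm (\<psi> u) (\<psi> v)" and \<psi>_gen: "\<psi> (gen i) = zgen i"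
begin

lemma \<psi>_diff: "\<psi> (u - v) = \<psi> u - \<psi> v"
  using \<psi>_add[of "u - v" v] by (simp add: algebra_simps)

lemma \<psi>_zero: "\<psi> 0 = 0" using \<psi>_diff[of 0 0] by simp

lemma \<psi>_sum: "\<psi> (sum f I) = (\<Sum>i\<in>I. \<psi> (f i))"
  by (induction I rule: infinite_finite_induct) (simp_all add: \<psi>_add \<psi>_zero)

lemma \<psi>_jac: "\<psi> (jac a b c) = zjac (\<psi> a) (\<psi> b) (\<psi> c)"
  by (simp add: jac_def zjac_def \<psi>_add \<psi>_mult)

abbreviation "gx \<equiv> gen Gen_x :: 'f M3"
abbreviation "gy \<equiv> gen Gen_y :: 'f M3"
abbreviation "gz \<equiv> gen Gen_z :: 'f M3"

lemma \<psi>_jac_gens: "\<psi> (jac gx gy gz) = zj0"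
  by (simp add: \<psi>_jac \<psi>_gen zgen_def zj0_def zj_eq[symmetric] zjac_def)

lemma \<psi>_Lop:
  assumes "\<psi> t = zscale k zj0" "(a, b, i) \<in> {(gx, gx, 1), (gy, gy, 2), (gz, gz, 3), (gx, gy, 4), (gx, gz, 5), (gy, gz, 6)}"
  shows "\<psi> (Lop a b t) = zscale (weight i * k) zj0"
proof -
  have d: "fzscale (1/2) (p + p) = p" for p :: "'f poly7 zorn"
    using mon_const(1)[of "1/2" "1/2::'f"] zscale_simps(2)[of "mon (1/2) 0" "mon (1/2) 0" p]
    by (simp add: zscale_simps)
  have w: "zscale (weight i * k) zj0 = zscale k (zscale (weight i) zj0)" for i
    by (simp add: zscale_simps(3)[symmetric] mult.commute)
  have L: "zcomm (zcomm zj0 (\<psi> gx)) (\<psi> gx) = zscale (4 * indet 1) zj0"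
    "zcomm (zcomm zj0 (\<psi> gy)) (\<psi> gy) = zscale (4 * indet 2) zj0"
    "zcomm (zcomm zj0 (\<psi> gz)) (\<psi> gz) = zscale (4 * indet 3 ^ 2) zj0"
    "zcomm (zcomm zj0 (\<psi> gx)) (\<psi> gy) + zcomm (zcomm zj0 (\<psi> gy)) (\<psi> gx) = zscale (4 * indet 4) zj0"
    "zcomm (zcomm zj0 (\<psi> gx)) (\<psi> gz) + zcomm (zcomm zj0 (\<psi> gz)) (\<psi> gx) = zscale (4 * indet 5) zj0"
    "zcomm (zcomm zj0 (\<psi> gy)) (\<psi> gz) + zcomm (zcomm zj0 (\<psi> gz)) (\<psi> gy) = zscale (4 * indet 6) zj0"
    by (simp_all only: \<psi>_gen zgen_def gens.case zj0_def zj_L)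
  have sum: "zcomm (zcomm zj0 (\<psi> a)) (\<psi> b) + zcomm (zcomm zj0 (\<psi> b)) (\<psi> a) = zscale (weight i) zj0 + zscale (weight i) zj0"
    using assms(2) L
    by (auto simp: L weight_eqs zscale_simps(2)[symmetric] simp del: One_nat_def)
  have "\<psi> (Lop a b t) = fzscale (1/2) (zscale k (zcomm (zcomm zj0 (\<psi> a)) (\<psi> b) + zcomm (zcomm zj0 (\<psi> b)) (\<psi> a)))"
    by (simp add: Lop_def \<psi>_scale \<psi>_add \<psi>_mult assms(1) zcomm_scale zscale_simps(1))
  also have "\<dots> = zscale k (zscale (weight i) zj0)" unfolding sum zscale_simps(1)[of k] by (rule d)
  finally show ?thesis by (simp only: w)
qed

lemma \<psi>_Gfun:
  assumes "\<psi> t = zscale k zj0"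
  shows "\<psi> (Gfun t gx gy gz) = zscale (weight 0 * k) zj0"
proof -
  have w: "zscale (weight i * k) zj0 = zscale k (zscale (weight i) zj0)" for i
    by (simp add: zscale_simps(3)[symmetric] mult.commute)
  have "\<psi> (Gfun t gx gy gz) = zscale k (zjac (zcomm zj0 (\<psi> gx)) (\<psi> gy) (\<psi> gz) - zcomm (\<psi> gx) (zjac zj0 (\<psi> gy) (\<psi> gz))
      - zcomm (zjac (\<psi> gx) (\<psi> gy) (\<psi> gz)) zj0)"
    by (simp add: Gfun_def \<psi>_diff \<psi>_jac \<psi>_mult assms zjac_def zcomm_scale zcomm_distrib zscale_simps)
  also have "\<dots> = zscale k (zscale (weight 0) zj0)"
    by (simp add: \<psi>_gen zgen_def zj0_def zj_G weight_eqs)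
  finally show ?thesis by (simp only: w)
qed

lemma \<psi>_iterates_general:
  assumes "\<And>i t k. i < length Fs \<Longrightarrow> \<psi> t = zscale k zj0 \<Longrightarrow> \<psi> ((Fs ! i) t) = zscale (s i * k) zj0"
    and "\<psi> t = zscale k zj0"
  shows "\<psi> (iterates Fs e t) = zscale ((\<Prod>i<length Fs. s i ^ e i) * k) zj0"
  using assms
proof (induction Fs arbitrary: s e t k)
  case (Cons F Fs)
  have "\<psi> ((F ^^ n) t) = zscale (s 0 ^ n * k) zj0" for n
    by (induction n) (use Cons.prems(2) Cons.prems(1)[of 0] in \<open>simp_all add: mult.assoc\<close>)
  moreover have "\<psi> ((Fs ! i) t) = zscale (s (Suc i) * k) zj0" if "i < length Fs" "\<psi> t = zscale k zj0" for i t k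
    using Cons.prems(1)[of "Suc i"] that by simp
  ultimately have "\<psi> (iterates (F # Fs) e t) = zscale ((\<Prod>i<length Fs. s (Suc i) ^ e (Suc i)) * (s 0 ^ e 0 * k)) zj0"
    by (simp add: Cons.IH)
  then show ?case by (simp add: prod.lessThan_Suc_shift mult_ac del: prod.lessThan_Suc)
qed simp

lemma \<psi>_iterates: "\<psi> (iterates (central_ops gx gy gz) e (jac gx gy gz)) = zscale (\<Prod>i<7. weight i ^ e i) zj0"
proof -
  have "\<psi> ((central_ops gx gy gz ! i) t) = zscale (weight i * k) zj0"
    if "i < length (central_ops gx gy gz)" "\<psi> t = zscale k zj0" for i t k
  proof -
    have "i \<in> {0, 1, 2, 3, 4, 5, 6}" using that(1) by (auto simp: central_ops_def)
    then show ?thesis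
      using \<psi>_Gfun[OF that(2)] \<psi>_Lop[OF that(2)]
      by (auto simp: central_ops_def simp del: One_nat_def)
  qed
  moreover have "\<psi> (jac gx gy gz) = zscale 1 zj0" by (simp add: \<psi>_jac_gens zscale_simps)
  moreover have "length (central_ops gx gy gz) = 7" by (simp add: central_ops_def)
  ultimately show ?thesis
    using \<psi>_iterates_general[of "central_ops gx gy gz" weight "jac gx gy gz" 1 e] by simp
qed

end

definition exponent :: "(nat \<Rightarrow> nat) \<Rightarrow> nat \<Rightarrow>\<^sub>0 nat" where
  "exponent e = (\<Sum>i<7. Poly_Mapping.single i (weight_exponent i * e i))"

definition coefficient :: "(nat \<Rightarrow> nat) \<Rightarrow> 'f::field_char_0" where
  "coefficient e = (\<Prod>i<7. weight_coeff i ^ e i)"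

lemma weight_power: "weight i ^ n = mon (weight_coeff i ^ n) (Poly_Mapping.single i (weight_exponent i * n))"
  by (induction n) (simp_all add: weight_def mult_single flip: single_add)

lemma prod_weights: "(\<Prod>i<n. weight i ^ e i) =
    mon (\<Prod>i<n. weight_coeff i ^ e i) (\<Sum>i<n. Poly_Mapping.single i (weight_exponent i * e i))"
  by (induction n) (simp_all add: weight_power mult_single add.commute mult.commute)

lemma coefficient_nonzero: "coefficient e \<noteq> (0 :: 'f::field_char_0)"
proof -
  have "weight_coeff i \<noteq> (0 :: 'f)" if "i < 7" for i
  proof -
    have "i \<in> {0, 1, 2, 3, 4, 5, 6}" using that by auto
    then show ?thesis by (auto simp: weight_coeff_def)
  qed
  then show ?thesis by (simp add: coefficient_def)
qed

text \<open>
  Exponents beyond the seventh are normalized to zero, so that the indexing of \<open>U\<close> becomes injective.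
\<close>

definition multi_indices :: "(nat \<Rightarrow> nat) set" where "multi_indices = {e. \<forall>i\<ge>7. e i = 0}"

lemma inj_exponent: "inj_on exponent multi_indices"
proof (rule inj_onI)
  fix e e' assume e: "e \<in> multi_indices" "e' \<in> multi_indices" "exponent e = exponent e'"
  have "Poly_Mapping.lookup (exponent e) i = weight_exponent i * e i" if "i < 7" for e i
    using that by (simp add: exponent_def lookup_sum lookup_single when_def)
  then have "weight_exponent i * e i = weight_exponent i * e' i" if "i < 7" for i
    using e(3) that by metis
  moreover have "weight_exponent i \<noteq> 0" for i by (simp add: weight_exponent_def)
  ultimately have "e i = e' i" if "i < 7" for i using that by (metis mult_cancel1)
  moreover have "e i = e' i" if "\<not> i < 7" for i using e that by (simp add: multi_indices_def)
  ultimately show "e = e'" by blast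
qed

lemma iterates_cong: "(\<And>i. i < length Fs \<Longrightarrow> e i = e' i) \<Longrightarrow> iterates Fs e t = iterates Fs e' t"
  by (induction Fs arbitrary: e e' t) (simp, fastforce)

definition word :: "'f M3 \<Rightarrow> nat \<Rightarrow> ('f::field_char_0) M3" where
  "word u c = [u, u * gen Gen_x, u * gen Gen_y, u * gen Gen_z, u * gen Gen_x * gen Gen_y, u * gen Gen_x * gen Gen_z,
      u * gen Gen_y * gen Gen_z] ! c"

definition basis_element :: "nat \<times> (nat \<Rightarrow> nat) \<Rightarrow> ('f::field_char_0) M3" where
  "basis_element = (\<lambda>(c, e). word (iterates (central_ops (gen Gen_x) (gen Gen_y) (gen Gen_z)) e
      (jac (gen Gen_x) (gen Gen_y) (gen Gen_z))) c)"

lemma spanning_set_eq: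
  "spanning_set (gen Gen_x) (gen Gen_y) (gen Gen_z) = (basis_element ` ({..<7} \<times> multi_indices) :: 'f::field_char_0 M3 set)"
  (is "?S = _")
proof
  let ?it = "\<lambda>e. iterates (central_ops (gen Gen_x) (gen Gen_y) (gen Gen_z)) e (jac (gen Gen_x) (gen Gen_y) (gen Gen_z)) :: 'f M3"
  have "b \<in> basis_element ` ({..<7} \<times> multi_indices)" if b: "b \<in> ?S" for b
  proof -
    from b obtain e where "b \<in> {?it e, ?it e * gen Gen_x, ?it e * gen Gen_y, ?it e * gen Gen_z, ?it e * gen Gen_x * gen Gen_y,
        ?it e * gen Gen_x * gen Gen_z, ?it e * gen Gen_y * gen Gen_z}"
      unfolding spanning_set_def U_set_eq by blast
    then have "b \<in> word (?it e) ` {0, 1, 2, 3, 4, 5, 6}" by (simp add: word_def)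
    then obtain c where c: "b = word (?it e) c" "c \<in> {0, 1, 2, 3, 4, 5, 6}" by (rule imageE)
    have "?it e = ?it (\<lambda>i. if i < 7 then e i else 0)"
      by (rule iterates_cong) (simp add: central_ops_def)
    then have "b = basis_element (c, \<lambda>i. if i < 7 then e i else 0)"
      unfolding basis_element_def c(1) by simp
    moreover have "c < 7" using c(2) by auto
    moreover have "(\<lambda>i. if i < 7 then e i else 0) \<in> multi_indices" by (simp add: multi_indices_def)
    ultimately show ?thesis by blast
  qed
  then show "?S \<subseteq> basis_element ` ({..<7} \<times> multi_indices)" by blast
  show "basis_element ` ({..<7} \<times> multi_indices) \<subseteq> ?S"
  proof (rule image_subsetI)
    fix i :: "nat \<times> (nat \<Rightarrow> nat)" assume "i \<in> {..<7} \<times> multi_indices"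
    then obtain c e where i: "i = (c, e)" and "c < 7" by auto
    then have "c \<in> {0, 1, 2, 3, 4, 5, 6}" by auto
    then show "basis_element i \<in> ?S"
      unfolding spanning_set_def U_set_eq basis_element_def i by (auto simp: word_def simp del: One_nat_def)
  qed
qed

definition zword :: "nat \<Rightarrow> ('f::field_char_0) poly7 zorn" where
  "zword c = [zj0, zcomm zj0 (zgen Gen_x), zcomm zj0 (zgen Gen_y), zcomm zj0 (zgen Gen_z),
     zcomm (zcomm zj0 (zgen Gen_x)) (zgen Gen_y), zcomm (zcomm zj0 (zgen Gen_x)) (zgen Gen_z),
     zcomm (zcomm zj0 (zgen Gen_y)) (zgen Gen_z)] ! c"

lemma zword_independent:
  fixes f :: "nat \<Rightarrow> ('f::field_char_0) poly7"
  assumes "(\<Sum>c<7. zscale (f c) (zword c)) = 0" "c < 7"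
  shows "f c = 0"
proof -
  have "{..<7::nat} = {0, 1, 2, 3, 4, 5, 6}" by auto
  then have "f 0 = 0 \<and> f 1 = 0 \<and> f 2 = 0 \<and> f 3 = 0 \<and> f 4 = 0 \<and> f 5 = 0 \<and> f 6 = 0"
    using assms(1) by (intro words_independent[OF znu_nonzero]) (simp add: zword_def zj0_def zgen_def add_ac del: One_nat_def)
  moreover have "c \<in> {0, 1, 2, 3, 4, 5, 6}" using assms(2) by auto
  ultimately show ?thesis by auto
qed

context zorn_rep
begin

lemma \<psi>_basis_element:
  assumes "c < 7"
  shows "\<psi> (basis_element (c, e)) = zscale (mon (coefficient e) (exponent e)) (zword c)"
proof -
  have "c \<in> {0, 1, 2, 3, 4, 5, 6}" using assms by auto
  then show ?thesis
    unfolding basis_element_def coefficient_def exponent_def prod_weights[symmetric]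
    by (auto simp: word_def zword_def \<psi>_mult \<psi>_gen \<psi>_iterates zcomm_scale simp del: One_nat_def)
qed

text \<open>
  Grouping the terms by the word \<open>c\<close> gives a relation between the seven words with polynomial
  coefficients.  These vanish, and by \<open>inj_exponent\<close> each scalar \<open>k i\<close> can be read off as the
  coefficient of its own monomial, up to a nonzero factor.  Working with index sets
  also shows that no two indices name the same basis element.
\<close>

lemma basis_coefficients_zero:
  assumes I: "finite I" "I \<subseteq> {..<7} \<times> multi_indices"
    and sum: "\<psi> (\<Sum>i\<in>I. fscale (k i) (basis_element i)) = 0" and "i \<in> I"
  shows "k i = 0"
proof -
  obtain c0 e0 where i: "i = (c0, e0)" by (cases i)
  define f where "f c = (\<Sum>e | (c, e) \<in> I. mon (k (c, e) * coefficient e) (exponent e))" for c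
  have fin: "finite {e. (c, e) \<in> I}" for c
    by (rule finite_subset[OF _ finite_imageI[OF I(1), of snd]]) force
  have "0 = (\<Sum>(c, e)\<in>I. zscale (mon (k (c, e) * coefficient e) (exponent e)) (zword c))"
    using I(2) unfolding sum[symmetric] \<psi>_sum
    by (intro sum.cong HOL.refl) (auto simp: \<psi>_scale \<psi>_basis_element zscale_simps(3)[symmetric] mult_single)
  also have "I = (SIGMA c:{..<7}. {e. (c, e) \<in> I})" using I(2) by auto
  also have "(\<Sum>(c, e)\<in>(SIGMA c:{..<7}. {e. (c, e) \<in> I}). zscale (mon (k (c, e) * coefficient e) (exponent e)) (zword c)) =
     (\<Sum>c<7. \<Sum>e | (c, e) \<in> I. zscale (mon (k (c, e) * coefficient e) (exponent e)) (zword c))"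
    by (rule sum.Sigma[symmetric]) (use fin in auto)
  also have "\<dots> = (\<Sum>c<7. zscale (f c) (zword c))"
  proof (rule sum.cong[OF HOL.refl])
    fix c
    have sc: "(\<Sum>e\<in>S. zscale (g e) w) = zscale (\<Sum>e\<in>S. g e) w" if "finite S" for S g and w :: "'f poly7 zorn"
      using that by (induction S rule: finite_induct) (simp_all add: zscale_simps)
    show "(\<Sum>e | (c, e) \<in> I. zscale (mon (k (c, e) * coefficient e) (exponent e)) (zword c)) = zscale (f c) (zword c)"
      unfolding f_def by (rule sc[OF fin])
  qed
  finally have "f c0 = 0" using zword_independent[of f c0] I(2) \<open>i \<in> I\<close> i by auto
  then have "0 = Poly_Mapping.lookup (f c0) (exponent e0)" by simp
  also have "\<dots> = (\<Sum>e | (c0, e) \<in> I. if e = e0 then k (c0, e) * coefficient e else 0)"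
    unfolding f_def lookup_sum
  proof (rule sum.cong[OF HOL.refl])
    fix e assume "e \<in> {e. (c0, e) \<in> I}"
    then have "exponent e = exponent e0 \<longleftrightarrow> e = e0"
      using I(2) \<open>i \<in> I\<close> i inj_onD[OF inj_exponent, of e e0] by auto
    then show "Poly_Mapping.lookup (mon (k (c0, e) * coefficient e) (exponent e)) (exponent e0) =
        (if e = e0 then k (c0, e) * coefficient e else 0)"
      by (simp add: lookup_single when_def)
  qed
  also have "\<dots> = k i * coefficient e0" using fin \<open>i \<in> I\<close> i by (simp add: sum.delta)
  finally show ?thesis using coefficient_nonzero[of e0, where 'f = 'f] by simp
qed

lemma combination_coefficients_zero:
  assumes "finite T" "T \<subseteq> spanning_set gx gy gz" "\<psi> (\<Sum>b\<in>T. fscale (k b) b) = 0" "b \<in> T"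
  shows "k b = 0"
proof -
  have "T \<subseteq> (basis_element ` ({..<7} \<times> multi_indices) :: 'f M3 set)"
    using assms(2) by (simp only: spanning_set_eq)
  then have "\<exists>I\<subseteq>{..<7} \<times> multi_indices. inj_on (basis_element :: _ \<Rightarrow> 'f M3) I \<and> T = basis_element ` I"
    by (rule subset_image_inj[THEN iffD1])
  then obtain I where I: "I \<subseteq> {..<7} \<times> multi_indices" "inj_on (basis_element :: _ \<Rightarrow> 'f M3) I" "T = (basis_element ` I :: 'f M3 set)"
    by (elim exE conjE) (rule that)
  have "finite I" using assms(1) I(2,3) finite_imageD by blast
  moreover have "(\<Sum>b\<in>T. fscale (k b) b) = (\<Sum>i\<in>I. fscale (k (basis_element i)) (basis_element i))"
    unfolding I(3) by (rule sum.reindex_cong[OF I(2)]) simp_all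
  moreover obtain i where "i \<in> I" "b = basis_element i" using assms(4) unfolding I(3) by blast
  ultimately show ?thesis
    using basis_coefficients_zero[of I "\<lambda>i. k (basis_element i)" i] assms(3) I(1) by simp
qed

lemma independent_spanning_set: "free_malcev.independent (spanning_set gx gy gz)"
proof
  assume "free_malcev.dependent (spanning_set gx gy gz)"
  then obtain T k v where T: "finite T" "T \<subseteq> spanning_set gx gy gz" "(\<Sum>b\<in>T. fscale (k b) b) = 0" "v \<in> T" "k v \<noteq> 0"
    unfolding free_malcev.dependent_explicit by blast
  have "\<psi> (\<Sum>b\<in>T. fscale (k b) b) = 0" unfolding T(3) by (rule \<psi>_zero)
  from combination_coefficients_zero[OF T(1,2) this T(4)] T(5) show False by simp
qed

lemma \<psi>_injective_on_span:
  assumes "v \<in> free_malcev.span (spanning_set gx gy gz)" "\<psi> v = 0"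
  shows "v = 0"
proof -
  from assms(1) obtain T k where T: "finite T" "T \<subseteq> spanning_set gx gy gz" "v = (\<Sum>b\<in>T. fscale (k b) b)"
    unfolding free_malcev.span_explicit by blast
  then have "k b = 0" if "b \<in> T" for b using combination_coefficients_zero that assms(2) by blast
  then show ?thesis by (simp add: T(3))
qed

end

section \<open>The degree derivation\<close>

text \<open>
  The algebra \<open>M[\<epsilon>]\<close> with \<open>\<epsilon>\<^sup>2 = 0\<close>.  A homomorphism \<open>u \<mapsto> u + \<epsilon> D(u)\<close> into it is the same as a
  derivation \<open>D\<close>, so the universal property of the free algebra yields derivations with prescribed
  values on the generators.
\<close>

definition dual_numbers :: "('f::field, ('f, 'v) free_malcev \<times> ('f, 'v) free_malcev) module" where
  "dual_numbers = \<lparr>carrier = UNIV, monoid.mult = (\<lambda>(a, a') (b, b'). (a * b, a' * b + a * b')), one = undefined,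
     zero = (0, 0), add = (\<lambda>(a, a') (b, b'). (a + b, a' + b')),
     module.smult = (\<lambda>k (a, a'). (fscale k a, fscale k a'))\<rparr>"

lemma dual_numbers_simps:
  "carrier dual_numbers = UNIV"
  "(a, a') \<otimes>\<^bsub>dual_numbers\<^esub> (b, b') = (a * b, a' * b + a * b')"
  "(a, a') \<oplus>\<^bsub>dual_numbers\<^esub> (b, b') = (a + b, a' + b')"
  "\<zero>\<^bsub>dual_numbers\<^esub> = (0, 0)"
  "k \<odot>\<^bsub>dual_numbers\<^esub> (a, a') = (fscale k a, fscale k a')"
  by (simp_all add: dual_numbers_def)

lemma jacobian_dual_numbers:
  "jacobian_on dual_numbers (a, a') (b, b') (c, c') = (jac a b c, jac a' b c + jac a b' c + jac a b c')"
  by (simp add: jacobian_on_def dual_numbers_simps jac_def fm_distrib add_ac)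

lemma malcev_dual_numbers: "malcev_algebra (dual_numbers :: ('f::field_char_0, ('f, 'v) free_malcev \<times> _) module)"
proof -
  have "nonassoc_algebra (dual_numbers :: ('f, ('f, 'v) free_malcev \<times> ('f, 'v) free_malcev) module)"
    by (rule nonassoc_algebraI)
      (auto simp: dual_numbers_simps fm_distrib fscale_mult add_ac
        free_malcev.scale_right_distrib free_malcev.scale_left_distrib)
  moreover have "(a * a, a' * a + a * a') = (0, 0)" for a a' :: "('f, 'v) free_malcev"
    using fm_anticomm[of a a'] by (simp add: free_malcev_mult(5))
  moreover have "(jac a b (a * c), jac a' b (a * c) + jac a b' c * a + jac a b (a' * c + a * c')) =
      (jac a b c * a, (jac a' b c + jac a b' c + jac a b c') * a + jac a b c * a')"
    for a b c a' b' c' :: "('f, 'v) free_malcev"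
    using jac_malcev_linear[of a b a' c] by (simp add: jac_malcev jac_add fm_distrib add_ac)
  ultimately show ?thesis
    unfolding malcev_algebra_def malcev_algebra_axioms_def
    by (auto simp: jacobian_dual_numbers dual_numbers_simps)
qed

lemma degree_derivation_exists:
  obtains D :: "('f::field_char_0, 'v) free_malcev \<Rightarrow> ('f, 'v) free_malcev"
  where "\<And>u v. D (u + v) = D u + D v" "\<And>k u. D (fscale k u) = fscale k (D u)"
    "\<And>u v. D (u * v) = D u * v + u * D v" "\<And>i. D (gen i) = gen i"
proof -
  let ?A = "dual_numbers :: ('f, ('f, 'v) free_malcev \<times> _) module"
  have "\<exists>!h. h \<in> algebra_hom free_malcev_algebra ?A \<and> (\<forall>i. h (gen i) = (gen i, gen i))"
    by (rule free_malcev_universal[OF malcev_dual_numbers]) (simp add: dual_numbers_simps)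
  then obtain h where hom: "h \<in> algebra_hom free_malcev_algebra ?A" and gen: "\<And>i. h (gen i) = (gen i, gen i)" by blast
  have ops: "h (u + v) = h u \<oplus>\<^bsub>?A\<^esub> h v" "h (u * v) = h u \<otimes>\<^bsub>?A\<^esub> h v" "h (fscale k u) = k \<odot>\<^bsub>?A\<^esub> h u" for u v k
    using hom unfolding algebra_hom_def hom_def by simp_all
  have "h 0 = h (fscale 0 0)" by simp
  also have "\<dots> = (0, 0)" unfolding ops by (cases "h 0") (simp add: dual_numbers_simps)
  finally have zero: "h 0 = (0, 0)" .
  have "\<exists>b. h (cls t) = (cls t, b)" for t
    by (induction t) (auto simp: cls_simps ops gen zero dual_numbers_simps)
  then have "\<exists>b. h u = (u, b)" for u by (induction u rule: free_malcev.abs_induct)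
  then obtain D where D: "\<And>u. h u = (u, D u)" by metis
  show thesis
  proof (rule that)
    show "D (u + v) = D u + D v" "D (fscale k u) = fscale k (D u)" "D (u * v) = D u * v + u * D v" for u v k
      using ops(1)[of u v] ops(2)[of u v] ops(3)[of k u] unfolding D dual_numbers_simps by simp_all
    show "D (gen i) = gen i" for i using gen[of i] unfolding D by simp
  qed
qed

locale degree_derivation =
  fixes D :: "('f::field_char_0, 'v) free_malcev \<Rightarrow> ('f, 'v) free_malcev"
  assumes D_add: "D (u + v) = D u + D v" and D_scale: "D (fscale k u) = fscale k (D u)"
    and D_mult: "D (u * v) = D u * v + u * D v" and D_gen: "D (gen i) = gen i"
begin

lemma D_zero: "D 0 = 0" using D_scale[of 0 0] by simp

lemma D_diff: "D (u - v) = D u - D v"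
  using D_add[of "u - v" v] by (simp add: algebra_simps)

lemma D_jac: "D (jac a b c) = jac (D a) b c + jac a (D b) c + jac a b (D c)"
  by (simp add: jac_def D_add D_mult fm_distrib algebra_simps)

lemma D_JMMM: "v \<in> JMMM \<Longrightarrow> D v \<in> JMMM"
proof -
  have "free_malcev.subspace {v. D v \<in> JMMM}"
    by (rule free_malcev.subspaceI)
      (simp_all add: D_zero D_add D_scale free_malcev.subspace_0 free_malcev.subspace_add
        free_malcev.subspace_scale JMMM_subspace)
  moreover have "D (jac a b c) \<in> JMMM" for a b c
    unfolding D_jac by (intro free_malcev.subspace_add JMMM_subspace jac_in_JMMM)
  ultimately have "JMMM \<subseteq> {v. D v \<in> JMMM}"
    unfolding JMMM_def by (intro free_malcev.span_minimal) auto
  then show "v \<in> JMMM \<Longrightarrow> D v \<in> JMMM" by blast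
qed

definition homogeneous :: "nat \<Rightarrow> ('f, 'v) free_malcev set" where
  "homogeneous n = {v. D v = fscale (of_nat n) v}"

definition bounded_degree :: "nat \<Rightarrow> ('f, 'v) free_malcev set" where
  "bounded_degree N = free_malcev.span (\<Union>n\<in>{1..N}. homogeneous n)"

lemma bounded_degree_mono: "m \<le> n \<Longrightarrow> bounded_degree m \<subseteq> bounded_degree n"
  unfolding bounded_degree_def by (intro free_malcev.span_mono UN_mono) auto

lemma bounded_degree_subspace: "free_malcev.subspace (bounded_degree n)"
  unfolding bounded_degree_def by (rule free_malcev.subspace_span)

lemma homogeneous_mult: "u \<in> homogeneous m \<Longrightarrow> v \<in> homogeneous n \<Longrightarrow> u * v \<in> homogeneous (m + n)"
  by (simp add: homogeneous_def D_mult fscale_mult free_malcev.scale_left_distrib)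

lemma bounded_degree_mult:
  assumes "u \<in> bounded_degree m" "v \<in> bounded_degree n"
  shows "u * v \<in> bounded_degree (m + n)"
proof -
  let ?H = "\<lambda>m. \<Union>i\<in>{1..m}. homogeneous i"
  have "u * v \<in> bounded_degree (m + n)" if "u \<in> ?H m" "v \<in> ?H n" for u v
    unfolding bounded_degree_def
  proof (rule free_malcev.span_base)
    from that obtain i j where "i \<in> {1..m}" "u \<in> homogeneous i" "j \<in> {1..n}" "v \<in> homogeneous j" by blast
    then show "u * v \<in> ?H (m + n)" by (intro UN_I[of "i + j"] homogeneous_mult) auto
  qed
  moreover have "free_malcev.subspace {v. u * v \<in> bounded_degree (m + n)}" for u
    by (rule free_malcev.subspaceI)
      (simp_all add: fm_distrib fscale_mult free_malcev.subspace_0 free_malcev.subspace_add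
        free_malcev.subspace_scale bounded_degree_subspace)
  ultimately have *: "bounded_degree n \<subseteq> {v. u * v \<in> bounded_degree (m + n)}" if "u \<in> ?H m" for u
    using that unfolding bounded_degree_def[of n] by (intro free_malcev.span_minimal) auto
  have "free_malcev.subspace {u. u * v \<in> bounded_degree (m + n)}"
    by (rule free_malcev.subspaceI)
      (simp_all add: fm_distrib fscale_mult free_malcev.subspace_0 free_malcev.subspace_add
        free_malcev.subspace_scale bounded_degree_subspace)
  then have "bounded_degree m \<subseteq> {u. u * v \<in> bounded_degree (m + n)}"
    unfolding bounded_degree_def[of m] using * assms(2) by (intro free_malcev.span_minimal) auto
  then show ?thesis using assms(1) by blast
qed

lemma ex_bounded_degree: "\<exists>N. u \<in> bounded_degree N"
proof -
  have "\<exists>N. cls t \<in> bounded_degree N" for t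
  proof (induction t)
    case (Var i)
    have "gen i \<in> bounded_degree 1"
      unfolding bounded_degree_def by (rule free_malcev.span_base) (simp add: homogeneous_def D_gen)
    then show ?case unfolding cls_simps by blast
  next
    case (Add s t)
    then obtain m n where "cls s \<in> bounded_degree m" "cls t \<in> bounded_degree n" by blast
    then have "cls s + cls t \<in> bounded_degree (max m n)"
      using bounded_degree_mono[of m "max m n"] bounded_degree_mono[of n "max m n"]
      by (intro free_malcev.subspace_add bounded_degree_subspace) auto
    then show ?case unfolding cls_simps by blast
  next
    case (Mul s t)
    then show ?case unfolding cls_simps using bounded_degree_mult by blast
  next
    case (Scale k t)
    then show ?case unfolding cls_simps using free_malcev.subspace_scale[OF bounded_degree_subspace] by blast
  next
    case Zero
    show ?case unfolding cls_simps using free_malcev.subspace_0[OF bounded_degree_subspace] by blast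
  qed
  then show ?thesis by (induction u rule: free_malcev.abs_induct)
qed

lemma D_lowers_bound:
  assumes "u \<in> bounded_degree (Suc N)"
  shows "D u - fscale (of_nat (Suc N)) u \<in> bounded_degree N"
proof -
  let ?E = "\<lambda>u. D u - fscale (of_nat (Suc N)) u"
  have "?E u \<in> bounded_degree N" if u: "u \<in> homogeneous n" and n: "n \<in> {1..Suc N}" for u n
  proof (cases "n = Suc N")
    case True
    then have "?E u = 0" using u by (simp add: homogeneous_def)
    then show ?thesis by (simp only: free_malcev.subspace_0[OF bounded_degree_subspace])
  next
    case False
    then have "u \<in> bounded_degree N" unfolding bounded_degree_def using u n
      by (intro free_malcev.span_base) auto
    moreover have "D u = fscale (of_nat n) u" using u by (simp add: homogeneous_def)
    ultimately show ?thesis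
      by (simp only: free_malcev.subspace_diff free_malcev.subspace_scale bounded_degree_subspace)
  qed
  moreover have "free_malcev.subspace {u. ?E u \<in> bounded_degree N}"
  proof (rule free_malcev.subspaceI; unfold mem_Collect_eq)
    show "?E 0 \<in> bounded_degree N" by (simp add: D_zero free_malcev.subspace_0[OF bounded_degree_subspace])
    fix u assume u: "?E u \<in> bounded_degree N"
    have "?E (fscale k u) = fscale k (?E u)" for k
      by (simp add: D_scale free_malcev.scale_right_diff_distrib mult.commute)
    then show "?E (fscale k u) \<in> bounded_degree N" for k
      by (simp only: free_malcev.subspace_scale[OF bounded_degree_subspace u])
    fix v assume v: "?E v \<in> bounded_degree N"
    have "?E (u + v) = ?E u + ?E v" by (simp add: D_add free_malcev.scale_right_distrib)
    then show "?E (u + v) \<in> bounded_degree N"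
      by (simp only: free_malcev.subspace_add[OF bounded_degree_subspace u v])
  qed
  ultimately have "bounded_degree (Suc N) \<subseteq> {u. ?E u \<in> bounded_degree N}"
    unfolding bounded_degree_def[of "Suc N"] by (intro free_malcev.span_minimal) blast+
  then show ?thesis using assms by blast
qed

text \<open>
  The derivation \<open>D\<close> is injective modulo the ideal \<open>J(M,M,M)\<close>: with
  \<open>v = D(u) - (N+1) u\<close> of smaller degree, \<open>D(v)\<close> lies in the ideal, hence \<open>v\<close> does by induction, and
  \<open>(N+1) u = D(u) - v\<close>.
\<close>

lemma JMMM_if_D_JMMM:
  assumes "D u \<in> JMMM" shows "u \<in> JMMM"
proof -
  have "u \<in> bounded_degree N \<Longrightarrow> D u \<in> JMMM \<Longrightarrow> u \<in> JMMM" for N u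
  proof (induction N arbitrary: u)
    case 0
    then show ?case by (simp add: bounded_degree_def free_malcev.subspace_0[OF JMMM_subspace])
  next
    case (Suc N)
    let ?v = "D u - fscale (of_nat (Suc N)) u"
    have "D ?v = D (D u) - fscale (of_nat (Suc N)) (D u)" by (simp only: D_diff D_scale)
    also have "\<dots> \<in> JMMM"
      by (intro free_malcev.subspace_diff free_malcev.subspace_scale JMMM_subspace D_JMMM Suc.prems)
    finally have "?v \<in> JMMM" using Suc.IH D_lowers_bound[OF Suc.prems(1)] by blast
    then have "D u - ?v \<in> JMMM" by (rule free_malcev.subspace_diff[OF JMMM_subspace Suc.prems(2)])
    then have "fscale (of_nat (Suc N)) u \<in> JMMM" by (simp only: diff_diff_eq2 add_diff_cancel_left')
    then have "fscale (inverse (of_nat (Suc N))) (fscale (of_nat (Suc N)) u) \<in> JMMM"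
      by (rule free_malcev.subspace_scale[OF JMMM_subspace])
    moreover have "(of_nat (Suc N) :: 'f) \<noteq> 0" by (rule of_nat_neq_0)
    ultimately show ?case by (simp del: of_nat_Suc)
  qed
  then show ?thesis using ex_bounded_degree assms by blast
qed

end

lemma projection_along:
  assumes "free_malcev.subspace (S :: ('f::field, 'v) free_malcev set)"
  obtains \<pi> where "Vector_Spaces.linear fscale fscale \<pi>" "\<And>u. \<pi> u = 0 \<longleftrightarrow> u \<in> S" "\<And>u. u - \<pi> u \<in> S"
proof -
  interpret vector_space_pair "fscale :: 'f \<Rightarrow> ('f, 'v) free_malcev \<Rightarrow> _" "fscale :: 'f \<Rightarrow> ('f, 'v) free_malcev \<Rightarrow> _"
    by unfold_locales
  obtain g where g: "range g \<subseteq> S" "Vector_Spaces.linear fscale fscale g" "\<And>v. v \<in> S \<Longrightarrow> g v = v"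
    using linear_exists_left_inverse_on[OF free_malcev.linear_id assms] by (auto simp: id_def)
  show thesis
  proof (rule that)
    show "Vector_Spaces.linear fscale fscale (\<lambda>u. u - g u)"
      by (intro linear_compose_sub free_malcev.linear_ident g(2))
    show "u - (u - g u) \<in> S" for u using g(1) by auto
    show "u - g u = 0 \<longleftrightarrow> u \<in> S" for u using g(1,3) by (metis eq_iff_diff_eq_0 rangeI subsetD)
  qed
qed

section \<open>Speciality\<close>

text \<open>
  The direct product of the affine endomorphisms of \<open>M\<close> and the octonions.  A pair
  \<open>(\<alpha>, m)\<close> stands for the operator on \<open>M \<oplus> F\<close> that sends \<open>(w, s)\<close> to \<open>(\<alpha>(w) + s m, 0)\<close>; such
  operators are closed under composition, which is taken from left to right.
\<close>

type_synonym ('f, 'v) affine_zorn = "(('f, 'v) free_malcev \<Rightarrow> ('f, 'v) free_malcev) \<times> ('f, 'v) free_malcev \<times> 'f poly7 zorn"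

definition affine_zorn :: "('f::field_char_0, ('f, 'v) affine_zorn) module" where
  "affine_zorn = \<lparr>carrier = {(\<alpha>, m, p). Vector_Spaces.linear fscale fscale \<alpha>},
     monoid.mult = (\<lambda>(\<alpha>, m, p) (\<beta>, n, q). (\<lambda>w. \<beta> (\<alpha> w), \<beta> m, p * q)), one = undefined,
     zero = (\<lambda>w. 0, 0, 0), add = (\<lambda>(\<alpha>, m, p) (\<beta>, n, q). (\<lambda>w. \<alpha> w + \<beta> w, m + n, p + q)),
     module.smult = (\<lambda>k (\<alpha>, m, p). (\<lambda>w. fscale k (\<alpha> w), fscale k m, fzscale k p))\<rparr>"

lemma affine_zorn_simps:
  "(\<alpha>, m, p) \<in> carrier affine_zorn \<longleftrightarrow> Vector_Spaces.linear fscale fscale \<alpha>"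
  "(\<alpha>, m, p) \<otimes>\<^bsub>affine_zorn\<^esub> (\<beta>, n, q) = (\<lambda>w. \<beta> (\<alpha> w), \<beta> m, p * q)"
  "(\<alpha>, m, p) \<oplus>\<^bsub>affine_zorn\<^esub> (\<beta>, n, q) = (\<lambda>w. \<alpha> w + \<beta> w, m + n, p + q)"
  "\<zero>\<^bsub>affine_zorn\<^esub> = (\<lambda>w. 0, 0, 0)"
  "k \<odot>\<^bsub>affine_zorn\<^esub> (\<alpha>, m, p) = (\<lambda>w. fscale k (\<alpha> w), fscale k m, fzscale k p)"
  by (simp_all add: affine_zorn_def)

lemma linear_fm_iff: "Vector_Spaces.linear fscale fscale \<alpha> \<longleftrightarrow>
    (\<forall>u v. \<alpha> (u + v) = \<alpha> u + \<alpha> v) \<and> (\<forall>k u. \<alpha> (fscale k u) = fscale k (\<alpha> u))"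
  for \<alpha> :: "('f::field, 'v) free_malcev \<Rightarrow> ('f, 'v) free_malcev"
  unfolding Vector_Spaces.linear_def module_hom_def module_hom_axioms_def
  using free_malcev.vector_space_axioms free_malcev.module_axioms by blast

lemma alternative_affine_zorn: "alternative_algebra (affine_zorn :: ('f::field_char_0, ('f, 'v) affine_zorn) module)"
proof -
  have "nonassoc_algebra (affine_zorn :: ('f::field_char_0, ('f, 'v) affine_zorn) module)"
    by (rule nonassoc_algebraI)
      (auto simp: affine_zorn_simps linear_fm_iff add_ac zorn_distrib zscale_simps mon_const
        free_malcev.scale_right_distrib free_malcev.scale_left_distrib mult.commute)
  then show ?thesis
    unfolding alternative_algebra_def alternative_algebra_axioms_def
    by (auto simp: affine_zorn_simps zorn_left_alternative zorn_right_alternative)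
qed

lemma affine_zorn_diff:
  assumes "Vector_Spaces.linear fscale fscale \<alpha>" "Vector_Spaces.linear fscale fscale \<beta>"
  shows "(\<alpha>, m, p) \<ominus>\<^bsub>affine_zorn\<^esub> (\<beta>, n, q) = (\<lambda>w. \<alpha> w - \<beta> w, m - n, p - q)"
proof -
  interpret alternative_algebra "affine_zorn :: ('f::field_char_0, ('f, 'v) affine_zorn) module"
    by (rule alternative_affine_zorn)
  have "Vector_Spaces.linear fscale fscale (\<lambda>w. - \<beta> w)"
    using assms(2) by (simp add: linear_fm_iff)
  then have "\<ominus>\<^bsub>affine_zorn\<^esub> (\<beta>, n, q) = (\<lambda>w. - \<beta> w, - n, - q)"
    using assms(2) by (intro minus_equality) (simp_all add: affine_zorn_simps)
  then show ?thesis by (simp add: a_minus_def affine_zorn_simps)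
qed

text \<open>
  Let \<open>\<pi>\<close> be a linear projection with kernel \<open>J(M,M,M)\<close>.  An element \<open>u\<close> is represented by the operator
  sending \<open>(w, s)\<close> to \<open>(\<pi>(wu) + s \<pi>(D(u)), 0)\<close>.  Products go to commutators because \<open>\<pi>\<close> kills
  \<open>J(w,u,v) = (wu)v - (wv)u - w(uv)\<close> and \<open>D\<close> is a derivation.  The translation part \<open>\<pi>(D(u))\<close> vanishes only
  for \<open>u\<close> in the ideal, where \<open>\<psi>\<close> is injective.
\<close>

lemma special_free_malcev:
  fixes \<psi> :: "('f::field_char_0, 'v) free_malcev \<Rightarrow> 'f poly7 zorn"
  assumes \<psi>: "\<And>u v. \<psi> (u + v) = \<psi> u + \<psi> v" "\<And>c u. \<psi> (fscale c u) = fzscale c (\<psi> u)"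
      "\<And>u v. \<psi> (u * v) = zcomm (\<psi> u) (\<psi> v)"
    and inj: "\<And>v. v \<in> JMMM \<Longrightarrow> \<psi> v = 0 \<Longrightarrow> v = 0"
  shows "special (free_malcev_algebra :: ('f, ('f, 'v) free_malcev) module)"
proof -
  let ?A = "affine_zorn :: ('f, ('f, 'v) affine_zorn) module"
  obtain D :: "('f, 'v) free_malcev \<Rightarrow> ('f, 'v) free_malcev" where D: "degree_derivation D"
    using degree_derivation_exists unfolding degree_derivation_def by metis
  interpret degree_derivation D by (rule D)
  obtain \<pi> :: "('f, 'v) free_malcev \<Rightarrow> ('f, 'v) free_malcev"
    where lin: "Vector_Spaces.linear fscale fscale \<pi>" and ker: "\<And>u. \<pi> u = 0 \<longleftrightarrow> u \<in> JMMM" and res: "\<And>u. u - \<pi> u \<in> JMMM"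
    using projection_along[OF JMMM_subspace] by metis
  have \<pi>: "\<pi> (u + v) = \<pi> u + \<pi> v" "\<pi> (fscale k u) = fscale k (\<pi> u)" for u v k
    using lin unfolding linear_fm_iff by blast+
  have \<pi>_diff: "\<pi> (u - v) = \<pi> u - \<pi> v" for u v using \<pi>(1)[of "u - v" v] by (simp add: algebra_simps)
  define h where "h u = (\<lambda>w. \<pi> (w * u), \<pi> (D u), \<psi> u)" for u
  have \<psi>_diff: "\<psi> (u - v) = \<psi> u - \<psi> v" for u v using \<psi>(1)[of "u - v" v] by (simp add: algebra_simps)
  have linear_h: "Vector_Spaces.linear fscale fscale (\<lambda>w. \<pi> (w * u))" for u
    by (simp add: linear_fm_iff fm_distrib fscale_mult \<pi>)
  have \<pi>_mult: "\<pi> (\<pi> u * v) = \<pi> (u * v)" for u v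
  proof -
    have "(u - \<pi> u) * v \<in> JMMM" by (rule JMMM_mult(1)[OF res])
    then show ?thesis by (simp add: fm_distrib \<pi>_diff flip: ker)
  qed
  have "h \<in> algebra_hom free_malcev_algebra (commutator_algebra ?A)"
  proof -
    have "h u \<in> carrier ?A" for u by (simp add: h_def affine_zorn_simps linear_h)
    moreover have "h (u + v) = h u \<oplus>\<^bsub>?A\<^esub> h v" "h (fscale k u) = k \<odot>\<^bsub>?A\<^esub> h u" for u v k
      by (simp_all add: h_def affine_zorn_simps \<pi> \<psi> D_add D_scale fm_distrib fscale_mult)
    moreover have "h (u * v) = (h u \<otimes>\<^bsub>?A\<^esub> h v) \<ominus>\<^bsub>?A\<^esub> (h v \<otimes>\<^bsub>?A\<^esub> h u)" for u v
    proof -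
      have lin2: "Vector_Spaces.linear fscale fscale (\<lambda>w. \<pi> (w * u * v))" for u v
        by (simp add: linear_fm_iff fm_distrib fscale_mult \<pi>)
      have "\<pi> (w * (u * v)) = \<pi> (w * u * v) - \<pi> (w * v * u)" for w
      proof -
        have "\<pi> (jac w u v) = 0" unfolding ker by (rule jac_in_JMMM)
        then show ?thesis by (simp add: jac_op \<pi>_diff)
      qed
      moreover have "\<pi> (D (u * v)) = \<pi> (D u * v) - \<pi> (D v * u)"
        unfolding D_mult fm_anticomm[of u "D v"] by (simp add: \<pi>_diff)
      ultimately show ?thesis
        by (simp add: h_def affine_zorn_simps affine_zorn_diff[OF lin2 lin2] \<pi>_mult \<psi>(3) zcomm_def)
    qed
    ultimately show ?thesis by (simp add: algebra_hom_def hom_def commutator_algebra_def)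
  qed
  moreover have "inj h"
  proof (rule injI)
    fix u v assume "h u = h v"
    then have "\<pi> (D (u - v)) = 0" and \<psi>: "\<psi> (u - v) = 0"
      by (simp_all add: h_def D_diff \<pi>_diff \<psi>_diff)
    then have "u - v \<in> JMMM" using JMMM_if_D_JMMM ker by blast
    then have "u - v = 0" using \<psi> inj by blast
    then show "u = v" by simp
  qed
  ultimately show ?thesis by (intro specialI[OF alternative_affine_zorn]) simp_all
qed

theorem mainTheorem1:
  fixes x y z :: "('f::field_char_0) M3" and U :: "'f M3 set"
  defines "x \<equiv> gen Gen_x" and "y \<equiv> gen Gen_y" and "z \<equiv> gen Gen_z"
    and "U \<equiv> U_set x y z"
  shows "basis_of
           (U \<union> (\<lambda>u. u * x) ` U \<union> (\<lambda>u. u * y) ` U \<union> (\<lambda>u. u * z) ` U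
              \<union> (\<lambda>u. (u * x) * y) ` U \<union> (\<lambda>u. (u * x) * z) ` U \<union> (\<lambda>u. (u * y) * z) ` U)
           (JMMM :: 'f M3 set)
         \<and> special (free_malcev_algebra :: ('f, 'f M3) module)"
proof -
  obtain \<psi> :: "'f M3 \<Rightarrow> 'f poly7 zorn" where
    \<psi>: "\<And>u v. \<psi> (u + v) = \<psi> u + \<psi> v" "\<And>c u. \<psi> (fscale c u) = fzscale c (\<psi> u)"
      "\<And>u v. \<psi> (u * v) = zcomm (\<psi> u) (\<psi> v)" "\<And>i. \<psi> (gen i) = zgen i"
    by (rule zorn_representation) (rule that)
  interpret zorn_rep \<psi> by unfold_locales (fact \<psi>)+
  have span: "free_malcev.span (spanning_set x y z) = JMMM"
    unfolding x_def y_def z_def by (rule span_spanning_set)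
  have "free_malcev.independent (spanning_set x y z)"
    unfolding x_def y_def z_def by (rule independent_spanning_set)
  then have "basis_of (spanning_set x y z) JMMM" unfolding basis_of_def using span by blast
  moreover have "special (free_malcev_algebra :: ('f, 'f M3) module)"
  proof (rule special_free_malcev[of \<psi>])
    fix v :: "'f M3" assume "v \<in> JMMM" "\<psi> v = 0"
    then show "v = 0" using \<psi>_injective_on_span span unfolding x_def y_def z_def by blast
  qed (fact \<psi>)+
  ultimately show ?thesis unfolding spanning_set_def U_def by blast
qed

end
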